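(* Let $K$ be a number field of signature $(s,t)$ with $s,t\ge 1$, and let $U\subset \mathcal{O}_K^{\times,+}$ be an admissible subgroup such that $\mathbb{Q}(U)=K$. Define the group \[ A_U := \{\rho\in \operatorname{Aut}(K/\mathbb{Q}) \mid \rho(U)=U\}, \] and let $A_U$ act on $\mathcal{T}_K$ by \[ \rho\cdot T := \{\sigma\circ\rho \mid \sigma\in T\}\qquad (\rho\in A_U,\ T\in\mathcal{T}_K). \] Then, for $T,T'\in\mathcal{T}_K$, we have $X(K,U,T)=X(K,U,T')$ (that is, the corresponding Oeljeklaus–Toma manifolds are biholomorphic) if and only if there exists $\rho\in A_U$ such that $\rho\cdot T=T'$. In particular, the set $\{X(K,U,T)\mid T\in\mathcal{T}_K\}$ consists of exactly $|\mathcal{T}_K/A_U|$ biholomorphism classes of complex manifolds, where $\mathcal{T}_K/A_U$ denotes the set of orbits.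
   Context: Let $K$ be a number field of signature $(s,t)$, $s,t\ge1$: it has $s$ real embeddings $\sigma_1,\dots,\sigma_s:K\hookrightarrow\mathbb{R}$ and $2t$ complex (non-real) embeddings $\sigma_{s+1},\dots,\sigma_{s+2t}:K\hookrightarrow\mathbb{C}$, labelled so that $\sigma_{s+i}=\overline{\sigma_{s+t+i}}$ for $1\le i\le t$. Put \[ \mathcal{T}_K:=\{T\subset\{\sigma_{s+1},\dots,\sigma_{s+2t}\}\mid |T\cap\{\sigma_{s+i},\sigma_{s+t+i}\}|=1 \text{ for all } 1\le i\le t\}, \] and let $\widetilde{\mathcal{T}}_K$ be the set of tuples $\tau=(\tau_1,\dots,\tau_t)$ of complex embeddings such that $[\tau]:=\{\tau_1,\dots,\tau_t\}\in\mathcal{T}_K$. Let $\mathcal{O}_K$ be the ring of integers of $K$, $\mathcal{O}_K^\times$ its unit group, and $\mathcal{O}_K^{\times,+}:=\{u\in\mathcal{O}_K^\times\mid\sigma_i(u)>0\text{ for all }1\le i\le s\}$ the group of totally positive units. A subgroup $U\subset\mathcal{O}_K^{\times,+}$ is called admissible if $U$ has rank $s$ and the image $\{(\log\sigma_1(u),\dots,\log\sigma_s(u))\mid u\in U\}$ is a lattice in $\mathbb{R}^s$ (a discrete subgroup of rank $s$). $\mathbb{Q}(U)$ denotes the subfield of $K$ generated by $U$. Let $\mathbb{H}=\{z\in\mathbb{C}\mid\operatorname{Im}z>0\}$. For $\tau\in\widetilde{\mathcal{T}}_K$ and $U$ admissible, let $G_\tau:=U\ltimes\mathcal{O}_K$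 (with $U$ acting on $\mathcal{O}_K$ by multiplication) act on $\mathbb{H}^s\times\mathbb{C}^t$ by \[ (u,a)\cdot\big((w_i)_{i=1}^s,(z_j)_{j=1}^t\big)=\big((\sigma_i(u)w_i+\sigma_i(a))_{i=1}^s,(\tau_j(u)z_j+\tau_j(a))_{j=1}^t\big). \] It is known (Oeljeklaus–Toma) that this action is fixed-point-free, properly discontinuous and cocompact. The Oeljeklaus–Toma manifold is the compact complex manifold $X(K,U,\tau):=(\mathbb{H}^s\times\mathbb{C}^t)/G_\tau$ of complex dimension $s+t$. For $T=[\tau]\in\mathcal{T}_K$, $X(K,U,T)$ denotes the biholomorphism class of $X(K,U,\tau)$; this does not depend on the choice of $\tau$ with $[\tau]=T$, since changing the order of the $\tau_j$ amounts to permuting the coordinates of $\mathbb{C}^t$. The formula for $\rho\cdot T$ literally satisfies $\rho_1\cdot(\rho_2\cdot T)=(\rho_2\circ\rho_1)\cdot T$, i.e. it is a right action (equivalently, an action of the opposite group); its orbits are $\{\rho\cdot T\mid\rho\in A_U\}$. *)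

theory Defs
  imports
    "HOL-Analysis.Analysis"
    "HOL-Algebra.Group_Action"
    "HOL-Algebra.Generated_Fields"
    "HOL-Algebra.Algebraic_Closure_Type"
begin

section \<open>Number fields, embeddings and units\<close>

definition number_field :: "'k::field_char_0 itself \<Rightarrow> bool" where
  "number_field _ \<longleftrightarrow>
     (\<exists>B :: 'k set. finite B \<and> module.span (\<lambda>(q::rat) x. of_rat q * x) B = UNIV)"

text \<open>Real embeddings are also regarded as maps into the complex numbers.\<close>

definition real_embeddings :: "('k::field_char_0 \<Rightarrow> complex) set" where
  "real_embeddings = {\<sigma> \<in> ring_hom ring_of_type_algebra ring_of_type_algebra. range \<sigma> \<subseteq> \<real>}"

definition nonreal_embeddings :: "('k::field_char_0 \<Rightarrow> complex) set" where
  "nonreal_embeddings = {\<sigma> \<in> ring_hom ring_of_type_algebra ring_of_type_algebra. \<not> range \<sigma> \<subseteq> \<real>}"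

definition conj_embedding :: "('k \<Rightarrow> complex) \<Rightarrow> 'k \<Rightarrow> complex" where
  "conj_embedding \<sigma> = cnj \<circ> \<sigma>"

text \<open>
  A labelling of the embeddings of a field of signature \<open>(s,t)\<close>, where \<open>s = CARD('s)\<close> and
  \<open>t = CARD('t)\<close>; both are at least 1, as types are nonempty. The maps \<open>\<sigma> i\<close> are
  \<open>\<sigma>\<^sub>1,\<dots>,\<sigma>\<^sub>s\<close>, the maps \<open>\<kappa> j\<close> are
  \<open>\<sigma>\<^sub>s\<^sub>+\<^sub>1,\<dots>,\<sigma>\<^sub>s\<^sub>+\<^sub>t\<close>, and their conjugates are
  \<open>\<sigma>\<^sub>s\<^sub>+\<^sub>t\<^sub>+\<^sub>1,\<dots>,\<sigma>\<^sub>s\<^sub>+\<^sub>2\<^sub>t\<close>. A labelling exists exactly for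
  the number fields of signature \<open>(s,t)\<close>.
\<close>

definition embedding_labelling ::
    "('s::finite \<Rightarrow> 'k::field_char_0 \<Rightarrow> complex) \<Rightarrow> ('t::finite \<Rightarrow> 'k \<Rightarrow> complex) \<Rightarrow> bool" where
  "embedding_labelling \<sigma> \<kappa> \<longleftrightarrow>
     bij_betw \<sigma> UNIV real_embeddings \<and>
     bij_betw (case_sum \<kappa> (\<lambda>j. conj_embedding (\<kappa> j))) UNIV nonreal_embeddings"

definition embedding_types :: "('t::finite \<Rightarrow> 'k::field_char_0 \<Rightarrow> complex) \<Rightarrow> ('k \<Rightarrow> complex) set set" where
  "embedding_types \<kappa> =
     {T. T \<subseteq> nonreal_embeddings \<and> (\<forall>j. card (T \<inter> {\<kappa> j, conj_embedding (\<kappa> j)}) = 1)}"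

definition ring_of_integers :: "'k::field_char_0 ring" where
  "ring_of_integers = ring_of_type_algebra\<lparr>carrier := {x. algebraic_int x}\<rparr>"

definition totally_positive_units :: "('s \<Rightarrow> 'k::field_char_0 \<Rightarrow> complex) \<Rightarrow> 'k set" where
  "totally_positive_units \<sigma> = {u \<in> Units ring_of_integers. \<forall>i. Re (\<sigma> i u) > 0}"

text \<open>Rank of a commutative group: the largest size of a \<open>\<int>\<close>-linearly independent subset.\<close>

definition int_independent :: "('a, 'b) monoid_scheme \<Rightarrow> 'a set \<Rightarrow> bool" where
  "int_independent G B \<longleftrightarrow> finite B \<and> B \<subseteq> carrier G \<and>
     (\<forall>n :: 'a \<Rightarrow> int. finprod G (\<lambda>b. b [^]\<^bsub>G\<^esub> n b) B = \<one>\<^bsub>G\<^esub> \<longrightarrow> (\<forall>b\<in>B. n b = 0))"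

definition has_rank :: "('a, 'b) monoid_scheme \<Rightarrow> nat \<Rightarrow> bool" where
  "has_rank G r \<longleftrightarrow>
     (\<exists>B. int_independent G B \<and> card B = r) \<and> (\<forall>B. int_independent G B \<longrightarrow> card B \<le> r)"

definition is_lattice :: "(real ^ 'n) set \<Rightarrow> bool" where
  "is_lattice L \<longleftrightarrow>
     subgroup L \<lparr>carrier = UNIV, monoid.mult = (+), one = 0\<rparr> \<and> discrete L \<and>
     has_rank \<lparr>carrier = L, monoid.mult = (+), one = 0\<rparr> CARD('n)"

definition log_embedding :: "('s::finite \<Rightarrow> 'k \<Rightarrow> complex) \<Rightarrow> 'k \<Rightarrow> real ^ 's" where
  "log_embedding \<sigma> u = (\<chi> i. ln (Re (\<sigma> i u)))"

definition admissible :: "('s::finite \<Rightarrow> 'k::field_char_0 \<Rightarrow> complex) \<Rightarrow> 'k set \<Rightarrow> bool" where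
  "admissible \<sigma> U \<longleftrightarrow>
     subgroup U (units_of ring_of_integers) \<and> U \<subseteq> totally_positive_units \<sigma> \<and>
     has_rank ((units_of ring_of_integers)\<lparr>carrier := U\<rparr>) CARD('s) \<and>
     is_lattice (log_embedding \<sigma> ` U)"

section \<open>Complex manifolds\<close>

text \<open>
  The model space is \<open>\<complex>\<^sup>s \<times> \<complex>\<^sup>t\<close>. A holomorphic map between open subsets is a map that is
  (Frechet) differentiable at each point with complex-linear derivative.
\<close>

type_synonym ('s, 't) model = "(complex ^ 's) \<times> (complex ^ 't)"

definition cscale :: "complex \<Rightarrow> ('s::finite, 't::finite) model \<Rightarrow> ('s, 't) model" where
  "cscale c = (\<lambda>(w, z). (c *s w, c *s z))"

definition holomorphic_map_on ::
    "(('s::finite, 't::finite) model \<Rightarrow> ('s, 't) model) \<Rightarrow> ('s, 't) model set \<Rightarrow> bool" where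
  "holomorphic_map_on f S \<longleftrightarrow>
     (\<forall>p\<in>S. \<exists>D. (f has_derivative D) (at p) \<and> (\<forall>c v. D (cscale c v) = cscale c (D v)))"

text \<open>A space with a complex structure is a pair of a topology and an atlas; a chart
  is a pair of its domain and its coordinate map.\<close>

type_synonym ('x, 's, 't) cspace = "'x topology \<times> ('x set \<times> ('x \<Rightarrow> ('s, 't) model)) set"

definition complex_manifold :: "('x, 's::finite, 't::finite) cspace \<Rightarrow> bool" where
  "complex_manifold = (\<lambda>(Z, A).
     Hausdorff_space Z \<and> second_countable Z \<and> \<Union>(fst ` A) = topspace Z \<and>
     (\<forall>(D, \<phi>)\<in>A. openin Z D \<and> open (\<phi> ` D) \<and>
        homeomorphic_map (subtopology Z D) (top_of_set (\<phi> ` D)) \<phi>) \<and>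
     (\<forall>(D, \<phi>)\<in>A. \<forall>(D', \<psi>)\<in>A. holomorphic_map_on (\<psi> \<circ> inv_into D \<phi>) (\<phi> ` (D \<inter> D'))))"

definition holomorphic_between ::
    "('x, 's::finite, 't::finite) cspace \<Rightarrow> ('y, 's, 't) cspace \<Rightarrow> ('x \<Rightarrow> 'y) \<Rightarrow> bool" where
  "holomorphic_between = (\<lambda>(Z, A) (Y, B) f. continuous_map Z Y f \<and>
     (\<forall>(D, \<phi>)\<in>A. \<forall>(D', \<psi>)\<in>B.
        holomorphic_map_on (\<psi> \<circ> f \<circ> inv_into D \<phi>) (\<phi> ` (D \<inter> f -` D'))))"

definition biholomorphic ::
    "('x, 's::finite, 't::finite) cspace \<Rightarrow> ('y, 's, 't) cspace \<Rightarrow> bool" where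
  "biholomorphic M N \<longleftrightarrow>
     (\<exists>f g. holomorphic_between M N f \<and> holomorphic_between N M g \<and>
        (\<forall>x\<in>topspace (fst M). g (f x) = x) \<and> (\<forall>y\<in>topspace (fst N). f (g y) = y))"

definition quotient_topology :: "'a topology \<Rightarrow> ('a \<Rightarrow> 'b) \<Rightarrow> 'b topology" where
  "quotient_topology Z q =
     topology (\<lambda>V. V \<subseteq> q ` topspace Z \<and> openin Z {x \<in> topspace Z. q x \<in> V})"

lemma openin_quotient_topology:
  "openin (quotient_topology Z q) V \<longleftrightarrow>
     V \<subseteq> q ` topspace Z \<and> openin Z {x \<in> topspace Z. q x \<in> V}"
proof -
  have "istopology (\<lambda>V. V \<subseteq> q ` topspace Z \<and> openin Z {x \<in> topspace Z. q x \<in> V})"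
    unfolding istopology_def
  proof (intro conjI allI impI)
    fix S T
    assume *: "S \<subseteq> q ` topspace Z \<and> openin Z {x \<in> topspace Z. q x \<in> S}"
              "T \<subseteq> q ` topspace Z \<and> openin Z {x \<in> topspace Z. q x \<in> T}"
    show "S \<inter> T \<subseteq> q ` topspace Z" using * by blast
    have "{x \<in> topspace Z. q x \<in> S \<inter> T} =
            {x \<in> topspace Z. q x \<in> S} \<inter> {x \<in> topspace Z. q x \<in> T}" by blast
    then show "openin Z {x \<in> topspace Z. q x \<in> S \<inter> T}" using * by auto
  next
    fix \<K>
    assume *: "\<forall>K\<in>\<K>. K \<subseteq> q ` topspace Z \<and> openin Z {x \<in> topspace Z. q x \<in> K}"
    show "\<Union>\<K> \<subseteq> q ` topspace Z" using * by blast
    have "{x \<in> topspace Z. q x \<in> \<Union>\<K>} = (\<Union>K\<in>\<K>. {x \<in> topspace Z. q x \<in> K})" by blast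
    then show "openin Z {x \<in> topspace Z. q x \<in> \<Union>\<K>}" using * by auto
  qed
  then show ?thesis
    unfolding quotient_topology_def by (simp add: topology_inverse')
qed

lemma topspace_quotient_topology: "topspace (quotient_topology Z q) = q ` topspace Z"
proof -
  have "{x \<in> topspace Z. q x \<in> q ` topspace Z} = topspace Z" by blast
  then have "openin (quotient_topology Z q) (q ` topspace Z)"
    by (simp add: openin_quotient_topology)
  then show ?thesis
    by (meson openin_quotient_topology openin_subset openin_topspace subset_antisym)
qed

lemma quotient_map_quotient_topology: "quotient_map Z (quotient_topology Z q) q"
  unfolding quotient_map_def
  by (simp add: topspace_quotient_topology openin_quotient_topology)

section \<open>Oeljeklaus--Toma manifolds\<close>

definition ot_domain :: "('s::finite, 't::finite) model set" where
  "ot_domain = {(w, z). \<forall>i. Im (w $ i) > 0}"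

definition ot_group :: "'k::field_char_0 set \<Rightarrow> ('k \<times> 'k) monoid" where
  "ot_group U = \<lparr>carrier = U \<times> {a. algebraic_int a},
     monoid.mult = (\<lambda>(u, a) (v, b). (u * v, a + u * b)), one = (1, 0)\<rparr>"

definition ot_action ::
    "('s::finite \<Rightarrow> 'k::field_char_0 \<Rightarrow> complex) \<Rightarrow> ('t::finite \<Rightarrow> 'k \<Rightarrow> complex) \<Rightarrow>
     'k \<times> 'k \<Rightarrow> ('s, 't) model \<Rightarrow> ('s, 't) model" where
  "ot_action \<sigma> \<tau> = (\<lambda>(u, a) (w, z).
     (\<chi> i. \<sigma> i u * w $ i + \<sigma> i a, \<chi> j. \<tau> j u * z $ j + \<tau> j a))"

definition ot_proj ::
    "('s::finite \<Rightarrow> 'k::field_char_0 \<Rightarrow> complex) \<Rightarrow> 'k set \<Rightarrow> ('t::finite \<Rightarrow> 'k \<Rightarrow> complex) \<Rightarrow>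
     ('s, 't) model \<Rightarrow> ('s, 't) model set" where
  "ot_proj \<sigma> U \<tau> = orbit (ot_group U) (ot_action \<sigma> \<tau>)"

text \<open>The quotient of \<open>ot_domain\<close> by the group: its points are the orbits, and its charts are
  the local inverses of the projection.\<close>

definition ot_manifold ::
    "('s::finite \<Rightarrow> 'k::field_char_0 \<Rightarrow> complex) \<Rightarrow> 'k set \<Rightarrow> ('t::finite \<Rightarrow> 'k \<Rightarrow> complex) \<Rightarrow>
     (('s, 't) model set, 's, 't) cspace" where
  "ot_manifold \<sigma> U \<tau> =
     (quotient_topology (top_of_set ot_domain) (ot_proj \<sigma> U \<tau>),
      {(ot_proj \<sigma> U \<tau> ` W, inv_into W (ot_proj \<sigma> U \<tau>)) | W.
         open W \<and> W \<subseteq> ot_domain \<and> inj_on (ot_proj \<sigma> U \<tau>) W})"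

text \<open>\<open>X(K,U,T)\<close>, the biholomorphism class of \<open>X(K,U,\<tau>)\<close> for \<open>[\<tau>] = T\<close>. A
  class of manifolds has to fix the type of their points; here it is the type of the orbits.\<close>

definition ot_class ::
    "('s::finite \<Rightarrow> 'k::field_char_0 \<Rightarrow> complex) \<Rightarrow> 'k set \<Rightarrow> 't::finite itself \<Rightarrow>
     ('k \<Rightarrow> complex) set \<Rightarrow> (('s, 't) model set, 's, 't) cspace set" where
  "ot_class \<sigma> U _ T = {M. complex_manifold M \<and>
     (\<exists>\<tau> :: 't \<Rightarrow> 'k \<Rightarrow> complex. range \<tau> = T \<and> biholomorphic M (ot_manifold \<sigma> U \<tau>))}"

section \<open>The group acting on the set of types\<close>

definition field_aut :: "('k::field_char_0 \<Rightarrow> 'k) set" where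
  "field_aut = {\<rho> \<in> ring_iso ring_of_type_algebra ring_of_type_algebra.
     \<forall>q::rat. \<rho> (of_rat q) = of_rat q}"

definition aut_preserving :: "'k::field_char_0 set \<Rightarrow> ('k \<Rightarrow> 'k) monoid" where
  "aut_preserving U = \<lparr>carrier = {\<rho> \<in> field_aut. \<rho> ` U = U}, monoid.mult = (\<circ>), one = id\<rparr>"

definition aut_act :: "('k \<Rightarrow> 'k) \<Rightarrow> ('k \<Rightarrow> complex) set \<Rightarrow> ('k \<Rightarrow> complex) set" where
  "aut_act \<rho> T = (\<lambda>\<sigma>. \<sigma> \<circ> \<rho>) ` T"

end

theory Submission
  imports Defs "HOL-Complex_Analysis.Complex_Analysis"
begin

text \<open>
  A biholomorphic map between the quotients lifts to a holomorphic map \<open>F\<close> of \<open>\<H>\<^sup>s \<times> \<complex>\<^sup>t\<close> that is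
  equivariant for an automorphism \<open>\<phi>\<close> of \<open>U \<ltimes> O\<^sub>K\<close>. Translations have powers that are commutators, so
  \<open>\<phi>\<close> preserves \<open>O\<^sub>K\<close> and acts on it by an additive map \<open>\<theta>\<close> that is semilinear over \<open>U\<close>; as \<open>U\<close>
  generates \<open>K\<close>, this forces \<open>\<theta> a = \<rho> a * c\<close> for a field automorphism \<open>\<rho>\<close> with \<open>\<rho> ` U = U\<close>.
  For a real translation vector \<open>v\<close> the differences \<open>F (p + v) - F p\<close> are invariant under \<open>O\<^sub>K\<close> in
  the \<open>\<complex>\<^sup>t\<close> coordinates, hence constant by Liouville's theorem and the density of \<open>O\<^sub>K\<close> in \<open>\<real>\<^sup>s\<close>.
  Therefore \<open>\<tau>' j (\<rho> a * c)\<close> is a complex linear combination of the \<open>\<sigma> i a\<close> and \<open>\<tau> k a\<close>, and by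
  the independence of characters \<open>\<tau>' j \<circ> \<rho>\<close> is one of the \<open>\<tau> k\<close>. Conversely, an automorphism
  permutes the embeddings, and the corresponding permutation of coordinates descends.
\<close>

text \<open>Holomorphy is what tells \<tau> from its conjugates: a complex linear map produces the
  \<open>\<sigma> i\<close> and \<open>\<tau> k\<close> but never
  \<open>cnj \<circ> \<tau> k\<close>, while all \<open>s + 2t\<close> embeddings together are
  independent. O_K is discrete only in the product of all coordinates. Forgetting the complex ones,
  of which there is at least one, makes its image dense in R^s; this controls the real directions,
  which Liouville's theorem does not reach because a half-plane is not C. The presence of a real
  embedding makes U torsion-free and the action free. Lifts exist because the domain is convex and
  the orbit map is a covering; the latter rests on two discreteness facts, one for the logarithms of
  U and one for O_K. The constant \<open>c\<close> cannot be removed, since multiplying the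
  translation part by a unit is an automorphism of the group; it only rescales the linear relation
  by the nonzero number \<open>\<tau>' j c\<close>. Lifts of mutually inverse maps are inverse only
  up to group elements, and \<open>\<rho>\<close> comes out as carrying the type of the target to
  the type of the source.\<close>

no_notation fps_nth (infixl "$" 75)

section \<open>Sums and products of algebraic integers\<close>

text \<open>Integrality of an element means that its powers stay in a finitely generated additive
  subgroup, so additive subgroups get the vocabulary of modules: \<open>int_scale.span E\<close> is
  the subgroup generated by \<open>E\<close>.\<close>

interpretation int_scale: Modules.module "\<lambda>(n::int) (x::'a::field_char_0). of_int n * x"
  by unfold_locales (auto simp: algebra_simps)

text \<open>In the induction step the coefficients of the new generator form an ideal of \<open>\<int>\<close>; an element
  realising a generator of this ideal is added to the generators of the smaller submodule.\<close>

lemma int_submodule_fin_gen: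
  fixes H :: "'a::field_char_0 set"
  assumes "finite E" "int_scale.subspace H" "H \<subseteq> int_scale.span E"
  shows "\<exists>F. finite F \<and> F \<subseteq> H \<and> H = int_scale.span F"
  using assms
proof (induction E arbitrary: H rule: finite_induct)
  case empty
  then have "H = {0}" using int_scale.subspace_0 by auto
  then show ?case by (intro exI[of _ "{}"]) auto
next
  case (insert e E)
  define H' where "H' = H \<inter> int_scale.span E"
  have sub': "int_scale.subspace H'"
    unfolding H'_def using insert.prems by (intro int_scale.subspace_inter) auto
  then obtain F where F: "finite F" "F \<subseteq> H'" "H' = int_scale.span F"
    using insert.IH[of H'] unfolding H'_def by auto
  define I where "I = {c::int. \<exists>v\<in>H. v - of_int c * e \<in> int_scale.span E}"
  have I_ex: "\<exists>c\<in>I. v - of_int c * e \<in> int_scale.span E" if "v \<in> H" for v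
    using that insert.prems int_scale.span_breakdown_eq[of v e E] unfolding I_def by blast
  show ?case
  proof (cases "\<exists>c\<in>I. c \<noteq> 0")
    case False
    then have "H \<subseteq> int_scale.span E"
      using I_ex by fastforce
    then have "H' = H" unfolding H'_def by auto
    then show ?thesis using F by auto
  next
    case True
    have I_minus: "- c \<in> I" if "c \<in> I" for c
    proof -
      from that obtain v where v: "v \<in> H" "v - of_int c * e \<in> int_scale.span E" unfolding I_def by auto
      have "- v \<in> H" using v int_scale.subspace_neg insert.prems by blast
      moreover have "- v - of_int (- c) * e \<in> int_scale.span E"
        using int_scale.span_neg[OF v(2)] by (simp add: algebra_simps)
      ultimately show ?thesis unfolding I_def by blast
    qed
    have "\<exists>n::nat. n > 0 \<and> int n \<in> I"
    proof -
      from True obtain c where c: "c \<in> I" "c \<noteq> 0" by auto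
      then show ?thesis using I_minus[OF c(1)]
        by (cases "c > 0") (auto intro!: exI[of _ "nat \<bar>c\<bar>"])
    qed
    define d where "d = (LEAST n::nat. n > 0 \<and> int n \<in> I)"
    have d: "d > 0" "int d \<in> I"
      using LeastI_ex[OF \<open>\<exists>n::nat. n > 0 \<and> int n \<in> I\<close>] unfolding d_def by auto
    have d_min: "n \<ge> d" if "n > 0" "int n \<in> I" for n
      using that unfolding d_def by (auto intro: Least_le)
    from d obtain h where h: "h \<in> H" "h - of_int (int d) * e \<in> int_scale.span E" unfolding I_def by auto
    have red: "\<exists>k::int. v - of_int k * h \<in> H'" if v: "v \<in> H" for v
    proof -
      obtain c where c: "v - of_int c * e \<in> int_scale.span E" using I_ex[OF v] by auto
      \<comment> \<open>Division with remainder by the least positive element \<open>d\<close> of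
        the ideal: the remainder lies in \<open>I\<close> below \<open>d\<close>, so it is 0 and
        \<open>e\<close> drops out.\<close>
      define k where "k = c div int d"
      have 1: "v - of_int k * h \<in> H"
        using v h insert.prems int_scale.subspace_diff int_scale.subspace_scale by metis
      have "(v - of_int c * e) - of_int k * (h - of_int (int d) * e) \<in> int_scale.span E"
        by (intro int_scale.span_diff int_scale.span_scale c h)
      also have "(v - of_int c * e) - of_int k * (h - of_int (int d) * e)
          = (v - of_int k * h) - of_int (c - k * int d) * e"
        by (simp add: algebra_simps)
      also have "c - k * int d = c mod int d" unfolding k_def by (simp add: minus_div_mult_eq_mod)
      finally have 2: "(v - of_int k * h) - of_int (c mod int d) * e \<in> int_scale.span E" .
      have 3: "c mod int d \<in> I" unfolding I_def mem_Collect_eq by (rule bexI[where x="v - of_int k * h"]) (fact 2, fact 1)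
      have r: "0 \<le> c mod int d" "c mod int d < int d" using d(1) by auto
      have "c mod int d = 0"
      proof (rule ccontr)
        assume "c mod int d \<noteq> 0"
        then have "nat (c mod int d) > 0" using r(1) by linarith
        moreover have "int (nat (c mod int d)) \<in> I" using 3 r(1) by simp
        ultimately have "d \<le> nat (c mod int d)" by (rule d_min)
        then show False using r by linarith
      qed
      then show ?thesis using 1 2 unfolding H'_def by auto
    qed
    have "H = int_scale.span (insert h F)"
    proof
      show "H \<subseteq> int_scale.span (insert h F)"
        using red F int_scale.span_breakdown_eq by blast
      show "int_scale.span (insert h F) \<subseteq> H"
        using F h insert.prems(1) by (intro int_scale.span_minimal) (auto simp: H'_def)
    qed
    then show ?thesis using F h by (intro exI[of _ "insert h F"]) (auto simp: H'_def)
  qed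
qed

lemma int_span_mult:
  assumes "x \<in> int_scale.span A" "y \<in> int_scale.span B"
  shows "x * y \<in> int_scale.span ((\<lambda>(a, b). a * b) ` (A \<times> B))"
proof -
  let ?S = "int_scale.span ((\<lambda>(a, b). a * b) ` (A \<times> B))"
  have 1: "a * y \<in> ?S" if "a \<in> A" for a
    using assms(2)
  proof (induction rule: int_scale.span_induct_alt)
    case base
    then show ?case by (simp add: int_scale.span_zero)
  next
    case (step c b y)
    have "a * (of_int c * b + y) = of_int c * (a * b) + a * y" by (simp add: algebra_simps)
    moreover have "a * b \<in> ?S" using step(1) that by (intro int_scale.span_base) auto
    ultimately show ?case
      using step by (auto intro!: int_scale.span_add int_scale.span_scale)
  qed
  show ?thesis using assms(1)
  proof (induction rule: int_scale.span_induct_alt)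
    case base
    then show ?case by (simp add: int_scale.span_zero)
  next
    case (step c a x)
    have "(of_int c * a + x) * y = of_int c * (a * y) + x * y" by (simp add: algebra_simps)
    then show ?case
      using step 1 by (auto intro!: int_scale.span_add int_scale.span_scale)
  qed
qed

text \<open>The monic equation rewrites \<open>x ^ d\<close> through lower powers with integer
  coefficients; multiplied by \<open>x ^ (n - d)\<close>, it does the same for every higher
  power.\<close>

lemma algebraic_int_powers_span:
  assumes "algebraic_int x"
  shows "\<exists>d. \<forall>n. x ^ n \<in> int_scale.span ((\<lambda>i. x ^ i) ` {..<d})"
proof -
  obtain p where p: "Polynomial.lead_coeff p = 1" "\<forall>i. Polynomial.coeff p i \<in> \<int>" "poly p x = 0"
    using assms by (auto elim: algebraic_int.cases)
  define d where "d = Polynomial.degree p"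
  let ?S = "int_scale.span ((\<lambda>i. x ^ i) ` {..<d})"
  have scale: "c * v \<in> ?S" if "c \<in> \<int>" "v \<in> ?S" for c v
    using that int_scale.span_scale by (auto elim!: Ints_cases)
  have "x ^ n \<in> ?S" for n
  proof (induction n rule: less_induct)
    case (less n)
    show ?case
    proof (cases "n < d")
      case True
      then show ?thesis by (auto intro: int_scale.span_base)
    next
      case False
      have "0 = (\<Sum>i\<le>d. Polynomial.coeff p i * x ^ i)" using p(3) by (simp add: poly_altdef d_def)
      also have "\<dots> = x ^ d + (\<Sum>i<d. Polynomial.coeff p i * x ^ i)"
        using p(1) by (simp add: d_def lessThan_Suc_atMost [symmetric])
      finally have "x ^ d = - (\<Sum>i<d. Polynomial.coeff p i * x ^ i)"
        by (simp add: eq_neg_iff_add_eq_0)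
      then have "x ^ n = - (\<Sum>i<d. Polynomial.coeff p i * x ^ i) * x ^ (n - d)"
        using False by (metis le_add_diff_inverse not_less power_add)
      also have "\<dots> = - (\<Sum>i<d. Polynomial.coeff p i * x ^ (i + (n - d)))"
        by (simp add: sum_distrib_right power_add mult.assoc)
      also have "\<dots> \<in> ?S"
        using False p(2) by (intro int_scale.span_neg int_scale.span_sum scale less.IH) auto
      finally show ?thesis .
    qed
  qed
  then show ?thesis by blast
qed

text \<open>\<open>E\<close> may be unrelated to multiplication by \<open>x\<close>. The subgroup
  generated by the powers is finitely generated by \<open>int_submodule_fin_gen\<close>; its
  generators involve only powers below some \<open>N\<close>, so \<open>x ^ N\<close> is an integer
  combination of lower powers, which is a monic equation.\<close>

lemma algebraic_int_if_powers_span: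
  fixes x :: "'a::field_char_0"
  assumes "finite E" "\<And>n. x ^ n \<in> int_scale.span E"
  shows "algebraic_int x"
proof -
  define H where "H = int_scale.span (range (\<lambda>n. x ^ n))"
  have "H \<subseteq> int_scale.span E"
    unfolding H_def using assms by (intro int_scale.span_minimal) auto
  then obtain F where F: "finite F" "F \<subseteq> H" "H = int_scale.span F"
    using int_submodule_fin_gen[OF assms(1), of H] unfolding H_def by auto
  have bdd: "\<exists>N. v \<in> int_scale.span ((\<lambda>i. x ^ i) ` {..<N})" if "v \<in> H" for v
  proof -
    from that obtain t where t: "finite t" "t \<subseteq> range (\<lambda>n. x ^ n)" "v \<in> int_scale.span t"
      unfolding H_def int_scale.span_explicit by auto
    from finite_subset_image[OF t(1,2)] obtain C where C: "finite C" "t = (\<lambda>n. x ^ n) ` C" by auto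
    obtain N where "C \<subseteq> {..<N}" using C(1) finite_nat_iff_bounded by auto
    then have "t \<subseteq> (\<lambda>i. x ^ i) ` {..<N}" using C(2) by auto
    then show ?thesis using t(3) int_scale.span_mono by blast
  qed
  then obtain Nf where Nf: "\<And>v. v \<in> F \<Longrightarrow> v \<in> int_scale.span ((\<lambda>i. x ^ i) ` {..<Nf v})"
    using F(2) by (metis subsetD)
  \<comment> \<open>The sum serves as a common upper bound of the finitely many
    \<open>Nf v\<close>.\<close>
  define N where "N = (\<Sum>v\<in>F. Nf v)"
  have "F \<subseteq> int_scale.span ((\<lambda>i. x ^ i) ` {..<N})"
  proof
    fix v assume v: "v \<in> F"
    have "Nf v \<le> N" unfolding N_def using F(1) v by (simp add: member_le_sum)
    then have "(\<lambda>i. x ^ i) ` {..<Nf v} \<subseteq> (\<lambda>i. x ^ i) ` {..<N}" by auto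
    then show "v \<in> int_scale.span ((\<lambda>i. x ^ i) ` {..<N})" using Nf[OF v] int_scale.span_mono by blast
  qed
  then have "x ^ N \<in> int_scale.span ((\<lambda>i. x ^ i) ` {..<N})"
    using int_scale.span_minimal[of F "int_scale.span ((\<lambda>i. x ^ i) ` {..<N})"] F(3)
      int_scale.span_base[of "x ^ N" "range (\<lambda>n. x ^ n)"] unfolding H_def by auto
  moreover have "\<exists>q. (\<forall>i. Polynomial.coeff q i \<in> \<int>) \<and> (\<forall>i\<ge>N. Polynomial.coeff q i = 0) \<and> poly q x = v"
    if "v \<in> int_scale.span ((\<lambda>i. x ^ i) ` {..<N})" for v
    using that
  proof (induction rule: int_scale.span_induct_alt)
    case base
    then show ?case by (intro exI[of _ 0]) auto
  next
    case (step c a v)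
    then obtain q i where q: "\<forall>i. Polynomial.coeff q i \<in> \<int>" "\<forall>i\<ge>N. Polynomial.coeff q i = 0" "poly q x = v"
      and i: "i < N" "a = x ^ i" by auto
    show ?case using q i
      by (intro exI[of _ "q + Polynomial.monom (of_int c) i"]) (auto simp: poly_monom)
  qed
  ultimately obtain q where q: "\<forall>i. Polynomial.coeff q i \<in> \<int>" "\<forall>i\<ge>N. Polynomial.coeff q i = 0" "poly q x = x ^ N"
    by blast
  let ?p = "Polynomial.monom 1 N - q"
  have "Polynomial.degree ?p = N"
    by (rule antisym) (use q in \<open>auto intro!: degree_le le_degree\<close>)
  show ?thesis
  proof
    show "Polynomial.lead_coeff ?p = 1" using \<open>Polynomial.degree ?p = N\<close> q by simp
    show "\<forall>i. Polynomial.coeff ?p i \<in> \<int>" using q by auto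
    show "poly ?p x = 0" using q by (simp add: poly_monom)
  qed
qed

text \<open>The finitely many products \<open>x ^ i * y ^ j\<close> of low powers generate a
  subgroup that contains all such products, hence all powers of \<open>x * y\<close> and, by the
  binomial theorem, of \<open>x + y\<close>.\<close>

lemma
  fixes x y :: "'a::field_char_0"
  assumes "algebraic_int x" "algebraic_int y"
  shows algebraic_int_plus: "algebraic_int (x + y)"
    and algebraic_int_times: "algebraic_int (x * y)"
proof -
  obtain d e where d: "\<And>n. x ^ n \<in> int_scale.span ((\<lambda>i. x ^ i) ` {..<d})"
    and e: "\<And>n. y ^ n \<in> int_scale.span ((\<lambda>i. y ^ i) ` {..<e})"
    using algebraic_int_powers_span assms by metis
  define E where "E = (\<lambda>(a, b). a * b) ` (((\<lambda>i. x ^ i) ` {..<d}) \<times> ((\<lambda>i. y ^ i) ` {..<e}))"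
  have E: "finite E" unfolding E_def by auto
  have m: "x ^ i * y ^ j \<in> int_scale.span E" for i j
    unfolding E_def by (rule int_span_mult[OF d e])
  show "algebraic_int (x * y)"
    by (rule algebraic_int_if_powers_span[OF E]) (simp add: power_mult_distrib m)
  have "(x + y) ^ n \<in> int_scale.span E" for n
  proof -
    have "(x + y) ^ n = (\<Sum>k\<le>n. of_int (int (n choose k)) * (x ^ k * y ^ (n - k)))"
      by (simp add: binomial_ring mult.assoc)
    also have "\<dots> \<in> int_scale.span E" by (intro int_scale.span_sum int_scale.span_scale m)
    finally show ?thesis .
  qed
  then show "algebraic_int (x + y)" by (rule algebraic_int_if_powers_span[OF E])
qed

lemma algebraic_int_diff:
  fixes x y :: "'a::field_char_0"
  shows "algebraic_int x \<Longrightarrow> algebraic_int y \<Longrightarrow> algebraic_int (x - y)"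
  using algebraic_int_plus[of x "- y"] by simp

lemma algebraic_int_power:
  fixes x :: "'a::field_char_0"
  shows "algebraic_int x \<Longrightarrow> algebraic_int (x ^ n)"
  by (induction n) (auto intro: algebraic_int_times)

lemma algebraic_int_prod:
  fixes f :: "'b \<Rightarrow> 'a::field_char_0"
  shows "(\<And>i. i \<in> A \<Longrightarrow> algebraic_int (f i)) \<Longrightarrow> algebraic_int (prod f A)"
  by (induction A rule: infinite_finite_induct) (auto intro: algebraic_int_times)

lemma algebraic_int_sum:
  fixes f :: "'b \<Rightarrow> 'a::field_char_0"
  shows "(\<And>i. i \<in> A \<Longrightarrow> algebraic_int (f i)) \<Longrightarrow> algebraic_int (sum f A)"
  by (induction A rule: infinite_finite_induct) (auto intro: algebraic_int_plus)

section \<open>Embeddings of number fields\<close>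

text \<open>Partial embeddings into \<open>\<complex>\<close>, to be extended one generator at a time. As \<open>R\<close> contains \<open>\<rat>\<close>,
  it is a field as soon as its elements are algebraic.\<close>

definition hom_on :: "'k::field_char_0 set \<Rightarrow> ('k \<Rightarrow> complex) \<Rightarrow> bool" where
  "hom_on R f \<longleftrightarrow> \<rat> \<subseteq> R \<and> (\<forall>x\<in>R. \<forall>y\<in>R. x + y \<in> R \<and> x * y \<in> R \<and>
     f (x + y) = f x + f y \<and> f (x * y) = f x * f y) \<and> f 1 = 1"

lemma hom_on_closed:
  assumes "hom_on R f"
  shows "\<rat> \<subseteq> R" "x \<in> R \<Longrightarrow> y \<in> R \<Longrightarrow> x + y \<in> R" "x \<in> R \<Longrightarrow> y \<in> R \<Longrightarrow> x * y \<in> R"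
    "0 \<in> R" "1 \<in> R" "x \<in> R \<Longrightarrow> - x \<in> R" "x \<in> R \<Longrightarrow> y \<in> R \<Longrightarrow> x - y \<in> R"
    "(\<And>i. i \<in> A \<Longrightarrow> g i \<in> R) \<Longrightarrow> sum g A \<in> R"
    "x \<in> R \<Longrightarrow> x ^ n \<in> R"
proof -
  show a: "\<rat> \<subseteq> R" and b: "\<And>x y. x \<in> R \<Longrightarrow> y \<in> R \<Longrightarrow> x + y \<in> R"
    and c: "\<And>x y. x \<in> R \<Longrightarrow> y \<in> R \<Longrightarrow> x * y \<in> R"
    using assms unfolding hom_on_def by auto
  show z: "0 \<in> R" "1 \<in> R" using a by auto
  have "- 1 \<in> R" using a by (metis Rats_1 Rats_minus_iff subsetD)
  then show d: "\<And>x. x \<in> R \<Longrightarrow> - x \<in> R" using c by (metis mult_minus1)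
  show "\<And>x y. x \<in> R \<Longrightarrow> y \<in> R \<Longrightarrow> x - y \<in> R" using b d by (metis diff_conv_add_uminus)
  show "(\<And>i. i \<in> A \<Longrightarrow> g i \<in> R) \<Longrightarrow> sum g A \<in> R"
    by (induction A rule: infinite_finite_induct) (use z b in auto)
  show "x \<in> R \<Longrightarrow> x ^ n \<in> R" by (induction n) (use z c in auto)
qed

lemma hom_on_simps:
  assumes "hom_on R f"
  shows "x \<in> R \<Longrightarrow> y \<in> R \<Longrightarrow> f (x + y) = f x + f y" "x \<in> R \<Longrightarrow> y \<in> R \<Longrightarrow> f (x * y) = f x * f y"
    "f 1 = 1" "f 0 = 0" "x \<in> R \<Longrightarrow> y \<in> R \<Longrightarrow> f (x - y) = f x - f y"
    "(\<And>i. i \<in> A \<Longrightarrow> g i \<in> R) \<Longrightarrow> f (sum g A) = (\<Sum>i\<in>A. f (g i))"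
proof -
  note cl = hom_on_closed[OF assms]
  show p: "x \<in> R \<Longrightarrow> y \<in> R \<Longrightarrow> f (x + y) = f x + f y" "x \<in> R \<Longrightarrow> y \<in> R \<Longrightarrow> f (x * y) = f x * f y" for x y
    using assms unfolding hom_on_def by blast+
  show "f 1 = 1" using assms unfolding hom_on_def by blast
  show z: "f 0 = 0" using p(1)[of 0 0] cl by auto
  show "x \<in> R \<Longrightarrow> y \<in> R \<Longrightarrow> f (x - y) = f x - f y"
    using p(1)[of "x - y" y] cl(7) by (simp add: algebra_simps)
  show "(\<And>i. i \<in> A \<Longrightarrow> g i \<in> R) \<Longrightarrow> f (sum g A) = (\<Sum>i\<in>A. f (g i))"
    by (induction A rule: infinite_finite_induct) (auto simp: z p cl)
qed

lemma hom_on_of_int: "hom_on R f \<Longrightarrow> f (of_int n) = of_int n"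
proof -
  assume f: "hom_on R f"
  note cl = hom_on_closed[OF f] and s = hom_on_simps[OF f]
  have nat: "f (of_nat n) = of_nat n" for n
    using cl(1) by (induction n) (auto simp: s subset_iff)
  show ?thesis
  proof (cases n)
    case (nonneg m)
    then show ?thesis using nat by simp
  next
    case (neg m)
    have "f (0 - of_nat (Suc m)) = f 0 - f (of_nat (Suc m))"
      using cl(1) by (intro s) (auto simp: subset_iff)
    then show ?thesis unfolding neg of_int_minus of_int_of_nat_eq nat s(4) by simp
  qed
qed

lemma hom_on_of_rat: "hom_on R f \<Longrightarrow> f (of_rat q) = of_rat q"
proof -
  assume f: "hom_on R f"
  note cl = hom_on_closed[OF f] and s = hom_on_simps[OF f]
  obtain a b where q: "q = of_int a / of_int b" "b > 0" by (metis Fract_of_int_quotient quotient_of_div quotient_of_denom_pos surj_pair)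
  have "of_rat q * of_int b = (of_int a :: 'a)" using q by (simp add: of_rat_divide)
  then have "f (of_rat q) * f (of_int b) = f (of_int a)"
    using cl(1) s(2)[of "of_rat q" "of_int b"] by (auto simp: subset_iff)
  then have "f (of_rat q) * of_int b = of_int a" by (simp add: hom_on_of_int[OF f])
  moreover have "of_rat q * of_int b = (of_int a :: complex)" using q by (simp add: of_rat_divide)
  ultimately show ?thesis using q(2) by (metis mult_right_cancel of_int_eq_0_iff less_irrefl)
qed

section \<open>Minimal polynomials and the extension of a partial embedding by one element\<close>

lemma map_poly_monic:
  assumes "Polynomial.lead_coeff p = 1" "f 0 = 0" "f 1 = 1"
  shows "Polynomial.degree (map_poly f p) = Polynomial.degree p"
    "Polynomial.lead_coeff (map_poly f p) = (1::'b::zero_neq_one)"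
proof -
  have "Polynomial.coeff (map_poly f p) (Polynomial.degree p) = 1" using assms by (simp add: coeff_map_poly)
  then have "Polynomial.degree p \<le> Polynomial.degree (map_poly f p)" by (intro le_degree) simp
  then show "Polynomial.degree (map_poly f p) = Polynomial.degree p"
    using degree_le[of "Polynomial.degree p" "map_poly f p"] assms(2) by (simp add: coeff_map_poly coeff_eq_0)
  then show "Polynomial.lead_coeff (map_poly f p) = 1"
    using \<open>Polynomial.coeff (map_poly f p) (Polynomial.degree p) = 1\<close> by simp
qed

text \<open>A set of polynomials, because the coefficient ring is a subset \<open>R\<close> of the
  field that grows with every extension. As \<open>f\<close> is a homomorphism on \<open>R\<close>,
  it is inside this set that \<open>map_poly f\<close> respects sums and products.\<close>

definition polys_over :: "'k::field_char_0 set \<Rightarrow> 'k poly set" where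
  "polys_over R = {p. \<forall>i. Polynomial.coeff p i \<in> R}"

lemma polys_over_closed:
  assumes "hom_on R f" "p \<in> polys_over R" "q \<in> polys_over R"
  shows "p + q \<in> polys_over R" "p - q \<in> polys_over R" "p * q \<in> polys_over R"
    "c \<in> R \<Longrightarrow> Polynomial.monom c n \<in> polys_over R"
    "map_poly f (p + q) = map_poly f p + map_poly f q"
    "map_poly f (p - q) = map_poly f p - map_poly f q"
    "map_poly f (p * q) = map_poly f p * map_poly f q"
proof -
  note cl = hom_on_closed[OF assms(1)] and s = hom_on_simps[OF assms(1)]
  have pq: "Polynomial.coeff p i \<in> R" "Polynomial.coeff q i \<in> R" for i
    using assms(2,3) unfolding polys_over_def by auto
  show "p + q \<in> polys_over R" "p - q \<in> polys_over R" "p * q \<in> polys_over R"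
    "c \<in> R \<Longrightarrow> Polynomial.monom c n \<in> polys_over R"
    using pq cl(2,3,4,7) by (auto simp: polys_over_def coeff_mult intro!: cl(8))
  show "map_poly f (p + q) = map_poly f p + map_poly f q"
    "map_poly f (p - q) = map_poly f p - map_poly f q"
    using pq by (auto simp: poly_eq_iff coeff_map_poly s(4) intro: s(1,5))
  have "f (\<Sum>i\<le>n. Polynomial.coeff p i * Polynomial.coeff q (n - i)) =
      (\<Sum>i\<le>n. f (Polynomial.coeff p i) * f (Polynomial.coeff q (n - i)))" for n
    using pq cl(3) s(2) by (subst s(6)) auto
  then show "map_poly f (p * q) = map_poly f p * map_poly f q"
    by (auto simp: poly_eq_iff coeff_map_poly s(4) coeff_mult)
qed

lemma poly_polys_over: "hom_on R f \<Longrightarrow> p \<in> polys_over R \<Longrightarrow> x \<in> R \<Longrightarrow> poly p x \<in> R"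
  unfolding poly_altdef polys_over_def
  by (intro hom_on_closed(8)) (auto intro!: hom_on_closed(3,9))

text \<open>A rational polynomial of least degree vanishing at \<open>x\<close> has nonzero constant
  term, since otherwise a factor X could be cancelled. Solving its equation for the constant term
  writes \<open>inverse x\<close> as a rational polynomial in \<open>x\<close>.\<close>

lemma hom_on_inverse_closed:
  assumes f: "hom_on R f" and x: "x \<in> R" "algebraic x"
  shows "inverse x \<in> R"
proof (cases "x = 0")
  case False
  note cl = hom_on_closed[OF f]
  let ?P = "\<lambda>p. p \<in> polys_over \<rat> \<and> p \<noteq> 0 \<and> poly p x = 0"
  obtain p0 where "?P p0"
    using x(2) unfolding algebraic_altdef polys_over_def by auto
  then obtain p where p: "?P p" and min: "\<And>q. ?P q \<Longrightarrow> Polynomial.degree p \<le> Polynomial.degree q"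
    using ex_has_least_nat[of ?P p0 Polynomial.degree] by auto
  obtain c q where pq: "p = pCons c q" by (cases p)
  have c: "c \<in> \<rat>" and q: "q \<in> polys_over \<rat>"
  proof -
    show "c \<in> \<rat>" using p pq unfolding polys_over_def by (metis coeff_pCons_0 mem_Collect_eq)
    have "Polynomial.coeff q i \<in> \<rat>" for i
      using p pq unfolding polys_over_def by (metis coeff_pCons_Suc mem_Collect_eq)
    then show "q \<in> polys_over \<rat>" unfolding polys_over_def by auto
  qed
  have "c \<noteq> 0"
  proof
    assume "c = 0"
    then have "?P q" using p pq False q by auto
    then show False using min[of q] p pq \<open>c = 0\<close> by auto
  qed
  have "c + x * poly q x = 0" using p pq by simp
  then have "inverse x = - (poly q x * inverse c)"
    using False \<open>c \<noteq> 0\<close> by (simp add: field_simps eq_neg_iff_add_eq_0)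
  moreover have "q \<in> polys_over R" using q cl(1) unfolding polys_over_def by auto
  ultimately show ?thesis
    using poly_polys_over[OF f _ x(1), of q] cl(1,3,6) c Rats_inverse[OF c] by (auto simp: subset_iff)
qed (use hom_on_closed[OF f] in auto)

text \<open>Monic, so that \<open>map_poly f\<close> preserves the degree and division with
  remainder stays inside \<open>polys_over R\<close>.\<close>

definition is_min_poly :: "'k::field_char_0 set \<Rightarrow> 'k \<Rightarrow> 'k poly \<Rightarrow> bool" where
  "is_min_poly R x m \<longleftrightarrow> m \<in> polys_over R \<and> Polynomial.lead_coeff m = 1 \<and> poly m x = 0 \<and>
     (\<forall>q\<in>polys_over R. q \<noteq> 0 \<longrightarrow> poly q x = 0 \<longrightarrow> Polynomial.degree m \<le> Polynomial.degree q)"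

lemma ex_min_poly:
  assumes f: "hom_on R f" and alg: "\<And>y::'k::field_char_0. algebraic y"
  shows "\<exists>m. is_min_poly R (x::'k) m"
proof -
  note cl = hom_on_closed[OF f]
  let ?P = "\<lambda>p. p \<in> polys_over R \<and> p \<noteq> 0 \<and> poly p x = 0"
  obtain p0 where "?P p0"
    using alg[of x] cl(1) unfolding algebraic_altdef polys_over_def by auto
  then obtain p where p: "?P p" and min: "\<And>q. ?P q \<Longrightarrow> Polynomial.degree p \<le> Polynomial.degree q"
    using ex_has_least_nat[of ?P p0 Polynomial.degree] by auto
  let ?c = "Polynomial.lead_coeff p"
  have "?c \<in> R" "?c \<noteq> 0" using p unfolding polys_over_def by auto
  then have "inverse ?c \<in> R" using hom_on_inverse_closed[OF f _ alg] by auto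
  then have "is_min_poly R x (Polynomial.smult (inverse ?c) p)"
    using p min \<open>?c \<noteq> 0\<close> cl(3) unfolding is_min_poly_def by (auto simp: polys_over_def)
  then show ?thesis by blast
qed

lemma min_poly_degree_pos: "is_min_poly R x m \<Longrightarrow> Polynomial.degree m > 0"
  unfolding is_min_poly_def by (metis degree_0_id gr0I poly_const_conv zero_neq_one)

text \<open>This makes the extension sending \<open>x\<close> to \<open>z\<close> well defined.
  Division by the monic \<open>m\<close>, one leading term at a time, keeps the coefficients in
  \<open>R\<close> and the value at \<open>x\<close> equal to 0; minimality of \<open>m\<close>
  forces the process to end in 0, so \<open>m\<close> divides \<open>p\<close> over
  \<open>R\<close>, and \<open>map_poly f\<close> transports this.\<close>

lemma min_poly_root_hom:
  assumes f: "hom_on R f" and m: "is_min_poly R x m" and z: "poly (map_poly f m) z = 0"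
    and p: "p \<in> polys_over R" "poly p x = 0"
  shows "poly (map_poly f p) z = 0"
  using p
proof (induction "Polynomial.degree p" arbitrary: p rule: less_induct)
  case (less p)
  note cl = hom_on_closed[OF f]
  show ?case
  proof (cases "p = 0")
    case False
    have mR: "m \<in> polys_over R" and lm: "Polynomial.lead_coeff m = 1" and m0: "poly m x = 0"
      and dle: "Polynomial.degree m \<le> Polynomial.degree p"
      using m less.prems False unfolding is_min_poly_def by auto
    define t where "t = Polynomial.monom (Polynomial.lead_coeff p) (Polynomial.degree p - Polynomial.degree m)"
    have tR: "t \<in> polys_over R"
      unfolding t_def using less.prems by (intro polys_over_closed(4)[OF f mR mR]) (auto simp: polys_over_def)
    define q where "q = p - t * m"
    have tm: "t * m \<in> polys_over R" by (rule polys_over_closed[OF f tR mR])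
    have qR: "q \<in> polys_over R" unfolding q_def by (rule polys_over_closed[OF f less.prems(1) tm])
    have q0: "poly q x = 0" unfolding q_def using less.prems m0 by simp
    have "t \<noteq> 0" unfolding t_def using False by (simp add: monom_eq_0_iff)
    have "m \<noteq> 0" using lm by auto
    have lp: "Polynomial.lead_coeff p \<noteq> 0" using False by simp
    have dt: "Polynomial.degree t = Polynomial.degree p - Polynomial.degree m"
      unfolding t_def by (rule degree_monom_eq[OF lp])
    have deg_tm: "Polynomial.degree (t * m) = Polynomial.degree p"
      using \<open>t \<noteq> 0\<close> \<open>m \<noteq> 0\<close> dle False by (simp add: degree_mult_eq dt)
    have "Polynomial.lead_coeff (t * m) = Polynomial.lead_coeff p"
      unfolding lead_coeff_mult lm dt by (simp add: t_def)
    then have cq: "Polynomial.coeff q (Polynomial.degree p) = 0" unfolding q_def using deg_tm by simp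
    have "Polynomial.degree q \<le> Polynomial.degree p"
      unfolding q_def using deg_tm degree_diff_le[of p "Polynomial.degree p" "t * m"] by simp
    have "poly (map_poly f q) z = 0"
    proof (cases "q = 0")
      case False
      then have "Polynomial.degree q < Polynomial.degree p"
        using cq \<open>Polynomial.degree q \<le> Polynomial.degree p\<close> by (metis le_neq_implies_less leading_coeff_neq_0)
      then show ?thesis using less.hyps qR q0 by blast
    qed auto
    moreover have "map_poly f q = map_poly f p - map_poly f t * map_poly f m"
      unfolding q_def by (simp add: polys_over_closed[OF f] less.prems tR mR tm)
    ultimately show ?thesis using z by simp
  qed auto
qed

text \<open>The larger ring consists of the values at \<open>x\<close> of polynomials over
  \<open>R\<close>. The new map evaluates at \<open>z\<close> the image of any polynomial
  representing the element; by \<open>min_poly_root_hom\<close> the choice is harmless.\<close>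

lemma hom_on_extend:
  assumes f: "hom_on R f" and m: "is_min_poly R x m" and z: "poly (map_poly f m) z = 0"
  shows "\<exists>R' f'. hom_on R' f' \<and> R \<subseteq> R' \<and> x \<in> R' \<and> f' x = z \<and> (\<forall>y\<in>R. f' y = f y)"
proof -
  note cl = hom_on_closed[OF f] and s = hom_on_simps[OF f]
  define R' where "R' = (\<lambda>p. poly p x) ` polys_over R"
  define ev where "ev = (\<lambda>p. poly (map_poly f p) z)"
  define f' where "f' = (\<lambda>y. ev (SOME p. p \<in> polys_over R \<and> poly p x = y))"
  have f'_eq: "f' (poly p x) = ev p" if p: "p \<in> polys_over R" for p
  proof -
    let ?q = "SOME q. q \<in> polys_over R \<and> poly q x = poly p x"
    have q: "?q \<in> polys_over R" "poly ?q x = poly p x"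
      using someI[of "\<lambda>q. q \<in> polys_over R \<and> poly q x = poly p x" p] p by auto
    have "ev (?q - p) = 0" unfolding ev_def
      by (rule min_poly_root_hom[OF f m z]) (use q p polys_over_closed(2)[OF f q(1) p] in auto)
    then show ?thesis unfolding f'_def ev_def polys_over_closed(6)[OF f q(1) p] by simp
  qed
  have const: "[:c:] \<in> polys_over R" if "c \<in> R" for c
    using that cl unfolding polys_over_def by (auto simp: coeff_pCons split: nat.splits)
  have X: "[:0, 1:] \<in> polys_over R"
    using cl unfolding polys_over_def by (auto simp: coeff_pCons split: nat.splits)
  have agree: "y \<in> R' \<and> f' y = f y" if "y \<in> R" for y
    using f'_eq[OF const[OF that]] const[OF that] unfolding R'_def ev_def
    by (force simp: map_poly_pCons s)
  have "x \<in> R'" "f' x = z" using f'_eq[OF X] X unfolding R'_def ev_def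
    by (force simp: map_poly_pCons s)+
  moreover have "hom_on R' f'"
    unfolding hom_on_def
  proof (intro conjI ballI)
    show "\<rat> \<subseteq> R'" using agree cl by blast
    show "f' 1 = 1" using agree cl s by auto
    fix a b assume "a \<in> R'" "b \<in> R'"
    then obtain p q where pq: "p \<in> polys_over R" "q \<in> polys_over R" "a = poly p x" "b = poly q x"
      unfolding R'_def by auto
    note pc = polys_over_closed[OF f pq(1,2)]
    have e: "a + b = poly (p + q) x" "a * b = poly (p * q) x" using pq by auto
    show "a + b \<in> R'" "a * b \<in> R'" unfolding e R'_def using pc by (auto simp del: poly_add poly_mult)
    have "f' (a + b) = ev (p + q)" "f' (a * b) = ev (p * q)" "f' a = ev p" "f' b = ev q"
      unfolding e unfolding pq(3,4) by (rule f'_eq, fact)+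
    then show "f' (a + b) = f' a + f' b" "f' (a * b) = f' a * f' b"
      using pc by (simp_all add: ev_def)
  qed
  ultimately show ?thesis using agree by (intro exI[of _ R'] exI[of _ f']) auto
qed

text \<open>Each new generator needs a root of its transported minimal polynomial; that polynomial
  still has positive degree, and the complex numbers are algebraically closed.\<close>

lemma hom_on_extend_finite:
  assumes alg: "\<And>y::'k::field_char_0. algebraic y" and "finite B" and f: "hom_on R (f :: 'k \<Rightarrow> complex)"
  shows "\<exists>R' f'. hom_on R' f' \<and> R \<union> B \<subseteq> R' \<and> (\<forall>y\<in>R. f' y = f y)"
  using assms(2)
proof (induction B rule: finite_induct)
  case (insert b B)
  then obtain R1 f1 where 1: "hom_on R1 f1" "R \<union> B \<subseteq> R1" "\<forall>y\<in>R. f1 y = f y" by auto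
  obtain m where m: "is_min_poly R1 b m" using ex_min_poly[OF 1(1) alg] by blast
  have "Polynomial.degree (map_poly f1 m) = Polynomial.degree m"
    using m hom_on_simps(3,4)[OF 1(1)] unfolding is_min_poly_def by (intro map_poly_monic) auto
  then have "\<not> constant (poly (map_poly f1 m))"
    using min_poly_degree_pos[OF m] by (simp add: constant_degree)
  then obtain z where "poly (map_poly f1 m) z = 0" using Fundamental_Theorem_Algebra.fundamental_theorem_of_algebra by blast
  from hom_on_extend[OF 1(1) m this] obtain R2 f2 where
    2: "hom_on R2 f2" "R1 \<subseteq> R2" "b \<in> R2" "\<forall>y\<in>R1. f2 y = f1 y" by blast
  have "R \<union> insert b B \<subseteq> R2" "\<forall>y\<in>R. f2 y = f y" using 1 2 by auto
  then show ?case using 2(1) by blast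
qed (use f in auto)

section \<open>Algebraicity and the existence of embeddings\<close>

interpretation rat_scale: Vector_Spaces.vector_space "\<lambda>(q::rat) (x::'a::field_char_0). of_rat q * x"
  by unfold_locales (auto simp: algebra_simps of_rat_add of_rat_mult)

text \<open>There are \<open>card B + 1\<close> exponents up to \<open>card B\<close>. Either two of
  the powers of \<open>x\<close> coincide, or they form a set larger than the spanning set
  \<open>B\<close> and are dependent over the rationals; both cases give a polynomial
  relation.\<close>

lemma number_field_algebraic:
  assumes "number_field TYPE('k::field_char_0)"
  shows "algebraic (x::'k)"
proof -
  obtain B :: "'k set" where B: "finite B" "rat_scale.span B = UNIV"
    using assms unfolding number_field_def by blast
  show ?thesis
  proof (cases "inj_on (\<lambda>i. x ^ i) {..card B}")
    case False
    then obtain i j where ij: "x ^ i = x ^ j" "i < j"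
      unfolding inj_on_def by (metis linorder_neqE_nat)
    let ?p = "Polynomial.monom 1 j - Polynomial.monom (1::'k) i"
    have "Polynomial.coeff ?p j = 1" using ij by simp
    then have "?p \<noteq> 0" by (metis coeff_0 zero_neq_one)
    moreover have "poly ?p x = 0" using ij by (simp add: poly_monom)
    ultimately show ?thesis unfolding algebraic_def
      by (intro exI[of _ ?p]) (auto simp: coeff_monom)
  next
    case True
    let ?E = "(\<lambda>i. x ^ i) ` {..card B}"
    have card: "card ?E = card B + 1" using card_image[OF True] by simp
    have "\<not> rat_scale.independent ?E"
    proof
      assume "rat_scale.independent ?E"
      then have "card ?E \<le> card B"
        using rat_scale.independent_span_bound[OF B(1), of ?E] B(2) by auto
      then show False using card by simp
    qed
    then obtain u v where u: "v \<in> ?E" "u v \<noteq> 0" "(\<Sum>v\<in>?E. of_rat (u v) * v) = 0"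
      unfolding rat_scale.independent_explicit_finite_subsets rat_scale.dependent_finite[OF finite_imageI[OF finite_atMost]]
      by (metis)
    then obtain k where k: "k \<le> card B" "u (x ^ k) \<noteq> 0" by auto
    define p where "p = (\<Sum>i\<le>card B. Polynomial.monom (of_rat (u (x ^ i))::'k) i)"
    have c: "Polynomial.coeff p i = (if i \<le> card B then of_rat (u (x ^ i)) else 0)" for i
      unfolding p_def by (simp add: coeff_sum coeff_monom)
    have "poly p x = (\<Sum>i\<le>card B. of_rat (u (x ^ i)) * x ^ i)"
      unfolding p_def by (simp add: poly_sum poly_monom)
    also have "\<dots> = (\<Sum>v\<in>?E. of_rat (u v) * v)" by (simp add: sum.reindex[OF True])
    finally have "poly p x = 0" using u by simp
    moreover have "p \<noteq> 0"
    proof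
      assume "p = 0"
      then have "Polynomial.coeff p k = 0" by simp
      then show False using c[of k] k by simp
    qed
    ultimately show ?thesis unfolding algebraic_altdef using c by (intro exI[of _ p]) auto
  qed
qed

lemma hom_on_Rats: "\<exists>f. hom_on (\<rat> :: 'k::field_char_0 set) f"
proof -
  define f where "f = (\<lambda>x::'k. of_rat (THE q. x = of_rat q) :: complex)"
  have [simp]: "f (of_rat q) = of_rat q" for q unfolding f_def by simp
  have "hom_on \<rat> f" unfolding hom_on_def
  proof (intro conjI ballI)
    show "f 1 = 1" using \<open>\<And>q. f (of_rat q) = of_rat q\<close>[of 1] by simp
    fix x y :: 'k assume "x \<in> \<rat>" "y \<in> \<rat>"
    then obtain p q where "x = of_rat p" "y = of_rat q" by (auto elim!: Rats_cases)
    then show "f (x + y) = f x + f y" "f (x * y) = f x * f y" "x + y \<in> \<rat>" "x * y \<in> \<rat>"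
      by (simp_all flip: of_rat_add of_rat_mult)
  qed auto
  then show ?thesis by blast
qed

lemma ring_hom_type_iff:
  "f \<in> ring_hom ring_of_type_algebra ring_of_type_algebra \<longleftrightarrow>
     (\<forall>x y. f (x + y) = f x + f y) \<and> (\<forall>x y. f (x * y) = f x * f y) \<and> f 1 = 1"
  unfolding ring_hom_def ring_of_type_algebra_def by auto

lemma ring_hom_type_iff_hom_on:
  "f \<in> ring_hom ring_of_type_algebra ring_of_type_algebra \<longleftrightarrow> hom_on UNIV f"
  unfolding ring_hom_type_iff hom_on_def by auto

text \<open>After prescribing the value at \<open>a\<close>, the map is extended over a finite
  rational spanning set; the resulting domain is a rational subspace containing this set, hence the
  whole field.\<close>

lemma ex_embedding_root:
  assumes nf: "number_field TYPE('k::field_char_0)"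
    and f: "hom_on \<rat> f" and m: "is_min_poly \<rat> (a::'k) m" and z: "poly (map_poly f m) z = 0"
  shows "\<exists>\<sigma> :: 'k \<Rightarrow> complex. hom_on UNIV \<sigma> \<and> \<sigma> a = z"
proof -
  obtain B :: "'k set" where B: "finite B" "rat_scale.span B = UNIV"
    using nf unfolding number_field_def by blast
  obtain R1 f1 where 1: "hom_on R1 f1" "a \<in> R1" "f1 a = z"
    using hom_on_extend[OF f m z] by blast
  obtain R2 f2 where 2: "hom_on R2 f2" "R1 \<union> B \<subseteq> R2" "\<forall>y\<in>R1. f2 y = f1 y"
    using hom_on_extend_finite[OF number_field_algebraic[OF nf] B(1) 1(1)] by blast
  note cl = hom_on_closed[OF 2(1)]
  have "rat_scale.subspace R2"
    using cl(1-4) by (intro rat_scale.subspaceI) (auto simp: subset_iff)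
  then have "R2 = UNIV" using B 2(2) rat_scale.span_minimal[of B R2] by auto
  then show ?thesis using 1 2 by auto
qed

text \<open>The product of the complex roots of the minimal polynomial is a nonzero rational algebraic
  integer, so some root has absolute value at least 1. This makes the ring of integers discrete.\<close>

lemma ex_embedding_norm_ge_1:
  assumes nf: "number_field TYPE('k::field_char_0)" and a: "algebraic_int (a::'k)" "a \<noteq> 0"
  shows "\<exists>\<sigma> :: 'k \<Rightarrow> complex. hom_on UNIV \<sigma> \<and> norm (\<sigma> a) \<ge> 1"
proof (rule ccontr)
  assume neg: "\<not> ?thesis"
  obtain f :: "'k \<Rightarrow> complex" where f: "hom_on \<rat> f" using hom_on_Rats by blast
  obtain m where m: "is_min_poly \<rat> a m" using ex_min_poly[OF f number_field_algebraic[OF nf]] by blast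
  define M where "M = map_poly f m"
  \<comment> \<open>Every root of \<open>M\<close> is the value at \<open>a\<close> of an embedding
    of the whole field, so the negated claim bounds all of them.\<close>
  have small: "norm z < 1" if "poly M z = 0" for z
    using ex_embedding_root[OF nf f m] that neg unfolding M_def by force
  obtain p where p: "Polynomial.lead_coeff p = 1" "\<forall>i. Polynomial.coeff p i \<in> \<int>" "poly p a = 0"
    using a by (auto elim: algebraic_int.cases)
  \<comment> \<open>The minimal polynomial is only known to be rational. Integrality of its roots
    comes from the integral equation of \<open>a\<close>, which every root inherits.\<close>
  have integral: "algebraic_int z" if z: "poly M z = 0" for z
  proof
    have "p \<in> polys_over \<rat>" using p(2) Ints_subset_Rats unfolding polys_over_def by auto
    then show "poly (map_poly f p) z = 0"
      using min_poly_root_hom[OF f m] z p(3) unfolding M_def by blast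
    have f1: "f 1 = 1" "f 0 = 0" using hom_on_simps[OF f] by auto
    then show "Polynomial.lead_coeff (map_poly f p) = 1"
      using p(1) by (intro map_poly_monic) auto
    show "\<forall>i. Polynomial.coeff (map_poly f p) i \<in> \<int>"
      using p(2) f1 hom_on_of_int[OF f] by (simp add: coeff_map_poly) (metis Ints_cases Ints_of_int)
  qed
  have f1: "f 1 = 1" "f 0 = 0" using hom_on_simps[OF f] by auto
  have mm: "m \<in> polys_over \<rat>" "Polynomial.lead_coeff m = 1" "poly m a = 0"
    using m unfolding is_min_poly_def by auto
  have M1: "Polynomial.lead_coeff M = 1" unfolding M_def
    using mm f1 by (intro map_poly_monic) auto
  have degM: "Polynomial.degree M > 0" unfolding M_def
    using mm f1 min_poly_degree_pos[OF m] by (simp add: map_poly_monic(1))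
  have "M = (\<Prod>z | poly M z = 0. [:-z, 1:] ^ Polynomial.order z M)"
    using complex_poly_decompose[of M] M1 by simp
  then have M0: "poly M 0 = (\<Prod>z | poly M z = 0. (- z) ^ Polynomial.order z M)"
    by (metis (no_types, lifting) M_def poly_prod poly_power poly_pCons poly_0 mult_zero_left add.right_neutral prod.cong)
  have "Polynomial.coeff m 0 \<in> \<rat>" using mm unfolding polys_over_def by auto
  then have rat: "poly M 0 \<in> \<rat>" unfolding M_def poly_0_coeff_0 coeff_map_poly[of f, OF f1(2)]
    by (metis Rats_cases Rats_of_rat f hom_on_of_rat)
  have "algebraic_int (poly M 0)" unfolding M0
    by (intro algebraic_int_prod algebraic_int_power algebraic_int_minus integral) auto
  then have int: "poly M 0 \<in> \<int>" using rational_algebraic_int_is_int rat by blast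
  have "norm (poly M 0) < 1"
  proof -
    have fin: "finite {z. poly M z = 0}" using M1 by (intro poly_roots_finite) auto
    obtain z where z: "poly M z = 0"
      using degM Fundamental_Theorem_Algebra.fundamental_theorem_of_algebra[of M] by (auto simp: constant_degree)
    have le: "norm ((- z) ^ Polynomial.order z M) \<le> 1" if "poly M z = 0" for z
      using small[OF that] by (simp add: norm_power power_le_one)
    \<comment> \<open>Roots have positive multiplicity, so one factor of the product is strictly
      below 1 while the others are at most 1.\<close>
    have lt: "norm ((- z) ^ Polynomial.order z M) < 1"
      using small[OF z] z M1 by (auto simp: norm_power order_root intro!: power_Suc_less_one power_less_one_iff[THEN iffD2])
    have "norm (poly M 0) = norm ((- z) ^ Polynomial.order z M) * (\<Prod>z \<in> {z. poly M z = 0} - {z}. norm ((- z) ^ Polynomial.order z M))"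
      unfolding M0 prod_norm [symmetric] using fin z by (subst prod.remove[of _ z]) auto
    also have "\<dots> \<le> norm ((- z) ^ Polynomial.order z M) * 1"
      by (intro mult_left_mono prod_le_1) (auto intro: le)
    finally show ?thesis using lt by simp
  qed
  then have "poly M 0 = 0" using int by (auto elim!: Ints_cases simp flip: of_int_abs)
  then have "Polynomial.coeff m 0 = 0"
    unfolding M_def poly_0_coeff_0 coeff_map_poly[of f, OF f1(2)]
    using mm(1) hom_on_of_rat[OF f] unfolding polys_over_def by (metis (mono_tags, lifting) Rats_cases mem_Collect_eq of_rat_0 of_rat_eq_0_iff)
  \<comment> \<open>With constant term 0, cancelling X leaves a polynomial of smaller degree that
    still vanishes at the nonzero \<open>a\<close>, against minimality.\<close>
  then obtain q where q: "m = pCons 0 q" by (metis coeff_pCons_0 pCons_cases)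
  have "q \<noteq> 0" "poly q a = 0" "q \<in> polys_over \<rat>"
    using q mm a by (auto simp: polys_over_def) (metis coeff_pCons_Suc)
  then have "Polynomial.degree m \<le> Polynomial.degree q" using m unfolding is_min_poly_def by blast
  then show False using q \<open>q \<noteq> 0\<close> by simp
qed

section \<open>Properly discontinuous actions\<close>

text \<open>The last axiom merges two properties. For \<open>p = p'\<close> it yields, together with
  freeness, a neighbourhood disjoint from its other translates, hence a covering; for points of
  different orbits it yields neighbourhoods no translates of which meet, hence a Hausdorff
  quotient.\<close>

locale pd_action = Group.group G for G :: "('g, 'm) monoid_scheme" (structure) +
  fixes act :: "'g \<Rightarrow> 'a::euclidean_space \<Rightarrow> 'a" and \<Omega> :: "'a set"
  assumes act_closed: "g \<in> carrier G \<Longrightarrow> p \<in> \<Omega> \<Longrightarrow> act g p \<in> \<Omega>"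
    and act_one: "p \<in> \<Omega> \<Longrightarrow> act \<one> p = p"
    and act_mult: "g \<in> carrier G \<Longrightarrow> h \<in> carrier G \<Longrightarrow> p \<in> \<Omega> \<Longrightarrow> act (g \<otimes> h) p = act g (act h p)"
    and act_cont: "g \<in> carrier G \<Longrightarrow> continuous_on \<Omega> (act g)"
    and act_free: "g \<in> carrier G \<Longrightarrow> p \<in> \<Omega> \<Longrightarrow> act g p = p \<Longrightarrow> g = \<one>"
    and open_domain: "open \<Omega>"
    and act_pd: "p \<in> \<Omega> \<Longrightarrow> p' \<in> \<Omega> \<Longrightarrow> \<exists>V V'. open V \<and> open V' \<and> p \<in> V \<and> p' \<in> V' \<and> V \<subseteq> \<Omega> \<and> V' \<subseteq> \<Omega> \<and>
       (\<forall>g\<in>carrier G. act g ` V \<inter> V' \<noteq> {} \<longrightarrow> act g p = p')"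
begin

abbreviation proj :: "'a \<Rightarrow> 'a set" where "proj \<equiv> orbit G act"

abbreviation orbit_space :: "'a set topology" where
  "orbit_space \<equiv> quotient_topology (top_of_set \<Omega>) proj"

lemma act_inv: "g \<in> carrier G \<Longrightarrow> p \<in> \<Omega> \<Longrightarrow> act (inv g) (act g p) = p"
  "g \<in> carrier G \<Longrightarrow> p \<in> \<Omega> \<Longrightarrow> act g (act (inv g) p) = p"
  by (simp_all flip: act_mult add: act_one)

lemma act_eq_imp_eq:
  assumes "g \<in> carrier G" "h \<in> carrier G" "p \<in> \<Omega>" "act g p = act h p"
  shows "g = h"
proof -
  have "act (inv h \<otimes> g) p = p" using assms by (simp add: act_mult act_inv)
  then have "inv h \<otimes> g = \<one>" using assms by (intro act_free[of _ p]) auto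
  then have "h \<otimes> (inv h \<otimes> g) = h" using assms by simp
  then show ?thesis using assms(1,2) by (simp flip: m_assoc)
qed

lemma proj_act: "g \<in> carrier G \<Longrightarrow> p \<in> \<Omega> \<Longrightarrow> proj (act g p) = proj p"
proof -
  assume g: "g \<in> carrier G" and p: "p \<in> \<Omega>"
  show ?thesis
  proof
    show "proj (act g p) \<subseteq> proj p"
      unfolding orbit_def using g p by (auto simp flip: act_mult)
    show "proj p \<subseteq> proj (act g p)"
    proof
      fix x assume "x \<in> proj p"
      then obtain h where h: "h \<in> carrier G" "x = act h p" unfolding orbit_def by auto
      have "x = act (h \<otimes> inv g) (act g p)"
        using g h p by (simp add: act_mult act_inv act_closed)
      then show "x \<in> proj (act g p)" unfolding orbit_def using g h by auto
    qed
  qed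
qed

lemma proj_eq_iff:
  assumes "p \<in> \<Omega>" "p' \<in> \<Omega>"
  shows "proj p = proj p' \<longleftrightarrow> (\<exists>g\<in>carrier G. p' = act g p)"
proof
  assume "proj p = proj p'"
  moreover have "p' \<in> proj p'" unfolding orbit_def using act_one[OF assms(2)] by (force intro: exI[of _ "\<one>"])
  ultimately show "\<exists>g\<in>carrier G. p' = act g p" unfolding orbit_def by auto
qed (use proj_act assms in auto)

lemma act_image_eq:
  assumes "g \<in> carrier G" "V \<subseteq> \<Omega>"
  shows "act g ` V = {x \<in> \<Omega>. act (inv g) x \<in> V}"
proof (intro equalityI subsetI)
  fix x assume "x \<in> act g ` V"
  then show "x \<in> {x \<in> \<Omega>. act (inv g) x \<in> V}" using assms by (auto simp: act_inv act_closed subset_iff)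
next
  fix x assume x: "x \<in> {x \<in> \<Omega>. act (inv g) x \<in> V}"
  then have "x = act g (act (inv g) x)" using assms by (simp add: act_inv)
  then show "x \<in> act g ` V" using x by blast
qed

lemma act_image_open:
  assumes "g \<in> carrier G" "V \<subseteq> \<Omega>" "open V"
  shows "open (act g ` V)"
proof -
  have "open (\<Omega> \<inter> act (inv g) -` V)"
    using continuous_open_preimage[OF act_cont open_domain assms(3)] assms(1) by auto
  moreover have "{x \<in> \<Omega>. act (inv g) x \<in> V} = \<Omega> \<inter> act (inv g) -` V" by auto
  ultimately show ?thesis unfolding act_image_eq[OF assms(1,2)] by simp
qed

lemma saturation_eq:
  assumes "V \<subseteq> \<Omega>"
  shows "{x \<in> \<Omega>. proj x \<in> proj ` V} = (\<Union>g\<in>carrier G. act g ` V)"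
proof (intro equalityI subsetI)
  fix x assume "x \<in> {x \<in> \<Omega>. proj x \<in> proj ` V}"
  then obtain v where v: "x \<in> \<Omega>" "v \<in> V" "proj v = proj x" by auto
  then show "x \<in> (\<Union>g\<in>carrier G. act g ` V)" using proj_eq_iff[of v x] assms by auto
next
  fix x assume "x \<in> (\<Union>g\<in>carrier G. act g ` V)"
  then show "x \<in> {x \<in> \<Omega>. proj x \<in> proj ` V}" using assms proj_act act_closed by auto
qed

lemma openin_orbit_space_iff:
  "openin orbit_space V \<longleftrightarrow> V \<subseteq> proj ` \<Omega> \<and> open {x \<in> \<Omega>. proj x \<in> V}"
  unfolding openin_quotient_topology using open_domain
  by (auto simp: openin_open_eq)

lemma openin_proj_image:
  assumes "V \<subseteq> \<Omega>" "open V"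
  shows "openin orbit_space (proj ` V)"
  unfolding openin_orbit_space_iff saturation_eq[OF assms(1)]
  using assms act_image_open by auto

lemma topspace_orbit_space: "topspace orbit_space = proj ` \<Omega>"
  by (simp add: topspace_quotient_topology)

lemma continuous_map_proj: "continuous_map (top_of_set \<Omega>) orbit_space proj"
  by (rule quotient_imp_continuous_map[OF quotient_map_quotient_topology])

lemma Hausdorff_orbit_space: "Hausdorff_space orbit_space"
  unfolding Hausdorff_space_def topspace_orbit_space
proof (intro allI impI)
  fix a b assume "a \<in> proj ` \<Omega> \<and> b \<in> proj ` \<Omega> \<and> a \<noteq> b"
  then obtain p p' where p: "p \<in> \<Omega>" "p' \<in> \<Omega>" "a = proj p" "b = proj p'" "proj p \<noteq> proj p'" by auto
  obtain V V' where V: "open V" "open V'" "p \<in> V" "p' \<in> V'" "V \<subseteq> \<Omega>" "V' \<subseteq> \<Omega>"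
    "\<forall>g\<in>carrier G. act g ` V \<inter> V' \<noteq> {} \<longrightarrow> act g p = p'" using act_pd[OF p(1,2)] by metis
  have "disjnt (proj ` V) (proj ` V')"
  proof (rule ccontr)
    assume "\<not> disjnt (proj ` V) (proj ` V')"
    then obtain x y where xy: "x \<in> V" "y \<in> V'" "proj x = proj y" unfolding disjnt_def by auto
    then obtain g where g: "g \<in> carrier G" "y = act g x" using proj_eq_iff[of x y] V by auto
    then have "act g ` V \<inter> V' \<noteq> {}" using xy by auto
    then have "act g p = p'" using V(7) g by blast
    then show False using p proj_act[OF g(1) p(1)] by simp
  qed
  then show "\<exists>U V. openin orbit_space U \<and> openin orbit_space V \<and> a \<in> U \<and> b \<in> V \<and> disjnt U V"
    using openin_proj_image V p by (intro exI[of _ "proj ` V"] exI[of _ "proj ` V'"]) auto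
qed

lemma second_countable_orbit_space: "second_countable orbit_space"
proof (rule second_countable_open_map_image)
  show "continuous_map (top_of_set \<Omega>) orbit_space proj" by (rule continuous_map_proj)
  show "open_map (top_of_set \<Omega>) orbit_space proj"
    unfolding open_map_def using openin_proj_image open_domain by (auto simp: openin_open_eq)
  show "proj ` topspace (top_of_set \<Omega>) = topspace orbit_space" by (simp add: topspace_orbit_space)
  have "second_countable (euclidean :: 'a topology)"
  proof -
    obtain \<B> :: "'a set set" where \<B>: "countable \<B>" "\<And>C. C \<in> \<B> \<Longrightarrow> open C"
      "\<And>S. open S \<Longrightarrow> \<exists>U. U \<subseteq> \<B> \<and> S = \<Union>U" using univ_second_countable by blast
    have "\<exists>V\<in>\<B>. x \<in> V \<and> V \<subseteq> U" if "open U" "x \<in> U" for U x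
      using \<B>(3)[OF that(1)] that(2) by blast
    then show ?thesis unfolding second_countable_def using \<B>(1,2) by (intro exI[of _ \<B>]) auto
  qed
  then show "second_countable (top_of_set \<Omega>)" by (rule second_countable_subtopology)
qed

text \<open>A group element moving a point of the neighbourhood back into it must fix
  \<open>p\<close> by \<open>act_pd\<close>, and freeness makes it trivial.\<close>

lemma ex_slice:
  assumes "p \<in> \<Omega>"
  obtains W where "open W" "p \<in> W" "W \<subseteq> \<Omega>" "inj_on proj W"
    "\<And>g x. g \<in> carrier G \<Longrightarrow> x \<in> W \<Longrightarrow> act g x \<in> W \<Longrightarrow> g = \<one>"
proof -
  obtain V V' where V: "open V" "open V'" "p \<in> V" "p \<in> V'" "V \<subseteq> \<Omega>" "V' \<subseteq> \<Omega>"
    "\<forall>g\<in>carrier G. act g ` V \<inter> V' \<noteq> {} \<longrightarrow> act g p = p" using act_pd[OF assms assms] by metis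
  have s: "g = \<one>" if "g \<in> carrier G" "x \<in> V \<inter> V'" "act g x \<in> V \<inter> V'" for g x
  proof -
    have "act g ` V \<inter> V' \<noteq> {}" using that by auto
    then show ?thesis using V(7) that act_free[OF _ assms] by blast
  qed
  show thesis
  proof (rule that[of "V \<inter> V'"])
    show "inj_on proj (V \<inter> V')"
    proof (rule inj_onI)
      fix x y assume xy: "x \<in> V \<inter> V'" "y \<in> V \<inter> V'" "proj x = proj y"
      then obtain g where g: "g \<in> carrier G" "y = act g x" using proj_eq_iff[of x y] V by auto
      then have "g = \<one>" using s[of g x] xy by auto
      then show "x = y" using g act_one xy V by auto
    qed
  qed (use V s in auto)
qed

lemma homeomorphic_map_inv_proj:
  assumes "open W" "W \<subseteq> \<Omega>" "inj_on proj W"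
  shows "homeomorphic_map (subtopology orbit_space (proj ` W)) (top_of_set W) (inv_into W proj)"
  unfolding homeomorphic_map_maps
proof
  have ts: "topspace (subtopology orbit_space (proj ` W)) = proj ` W"
    using assms by (auto simp: topspace_orbit_space)
  show "homeomorphic_maps (subtopology orbit_space (proj ` W)) (top_of_set W) (inv_into W proj) proj"
    unfolding homeomorphic_maps_def ts
  proof (intro conjI ballI)
    show "continuous_map (top_of_set W) (subtopology orbit_space (proj ` W)) proj"
      by (rule continuous_map_into_subtopology[OF continuous_map_from_subtopology_mono[OF continuous_map_proj assms(2)]])
        auto
    show "continuous_map (subtopology orbit_space (proj ` W)) (top_of_set W) (inv_into W proj)"
      unfolding continuous_map_def ts
    proof (intro conjI allI impI)
      show "inv_into W proj \<in> proj ` W \<rightarrow> topspace (top_of_set W)" by (auto intro: inv_into_into)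
      fix O' assume "openin (top_of_set W) O'"
      then have O: "open O'" "O' \<subseteq> W" using assms(1) by (auto simp: openin_open_eq)
      have "{x \<in> proj ` W. inv_into W proj x \<in> O'} = proj ` O'"
        using O assms(3) by (auto simp: inv_into_f_f subset_iff)
      moreover have "openin (subtopology orbit_space (proj ` W)) (proj ` O')"
      proof -
        have "openin orbit_space (proj ` O')" using O assms by (intro openin_proj_image) auto
        moreover have "proj ` O' = proj ` O' \<inter> proj ` W" using O by auto
        ultimately show ?thesis unfolding openin_subtopology by blast
      qed
      ultimately show "openin (subtopology orbit_space (proj ` W)) {x \<in> proj ` W. inv_into W proj x \<in> O'}" by simp
    qed
    fix x assume "x \<in> proj ` W" then show "proj (inv_into W proj x) = x" by (rule f_inv_into_f)
  next
    fix y assume "y \<in> topspace (top_of_set W)"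
    then show "inv_into W proj (proj y) = y" using assms by (simp add: inv_into_f_f)
  qed
qed

text \<open>The covering space to which the lifting theorem of the library is applied is the pullback
  of \<open>proj\<close> along \<open>h\<close>: in contrast to \<open>proj\<close> itself, it is a map between subsets of normed spaces.\<close>

lemma ex_lift:
  fixes h :: "'b::euclidean_space \<Rightarrow> 'a set"
  assumes h: "continuous_map (top_of_set S) orbit_space h"
    and S: "simply_connected S" "locally path_connected S"
  obtains F where "continuous_on S F" "F \<in> S \<rightarrow> \<Omega>" "\<And>p. p \<in> S \<Longrightarrow> proj (F p) = h p"
proof -
  define E where "E = {(y, p). y \<in> S \<and> p \<in> \<Omega> \<and> h y = proj p}"
  have hS: "h y \<in> proj ` \<Omega>" if "y \<in> S" for y
    using continuous_map_image_subset_topspace[OF h] that by (auto simp: topspace_orbit_space)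
  have cov: "covering_space E fst S"
  proof
    show "continuous_on E fst" by (rule continuous_on_fst[OF continuous_on_id])
    show "fst ` E = S"
    proof (intro equalityI subsetI)
      fix y assume y: "y \<in> S"
      then obtain p where "p \<in> \<Omega>" "h y = proj p" using hS by blast
      then have "(y, p) \<in> E" using y unfolding E_def by simp
      then show "y \<in> fst ` E" by (metis fst_conv imageI)
    qed (auto simp: E_def)
  next
    fix x assume x: "x \<in> S"
    then obtain p where p: "p \<in> \<Omega>" "h x = proj p" using hS by blast
    obtain W where W: "open W" "p \<in> W" "W \<subseteq> \<Omega>" "inj_on proj W"
      "\<And>g x. g \<in> carrier G \<Longrightarrow> x \<in> W \<Longrightarrow> act g x \<in> W \<Longrightarrow> g = \<one>" using ex_slice[OF p(1)] by blast
    define T where "T = {y \<in> S. h y \<in> proj ` W}"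
    have pre: "openin (top_of_set S) {y \<in> S. h y \<in> proj ` O'}" if "open O'" "O' \<subseteq> W" for O'
      using openin_continuous_map_preimage[OF h openin_proj_image[OF _ that(1)]] that(2) W(3) by auto
    have T: "openin (top_of_set S) T" unfolding T_def using pre W(1) by simp
    have xT: "x \<in> T" unfolding T_def using x p W by auto
    \<comment> \<open>The lift of \<open>h\<close> over \<open>T\<close> with values in the slice;
      the graphs of its translates by group elements are the sheets over \<open>T\<close>.\<close>
    define s where "s = (\<lambda>y. inv_into W proj (h y))"
    have s: "s y \<in> W" "proj (s y) = h y" if "y \<in> T" for y
      using that inv_into_into[of "h y" proj W] f_inv_into_f[of "h y" proj W] unfolding T_def s_def by auto
    have s_unique: "w = s y" if "w \<in> W" "y \<in> T" "proj w = h y" for w y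
      using that s[OF that(2)] W(4) by (metis inj_onD)
    have cont_s: "continuous_on T s"
      unfolding continuous_on_open_invariant
    proof (intro allI impI)
      fix B :: "'a set" assume "open B"
      have "openin (top_of_set S) {y \<in> S. h y \<in> proj ` (B \<inter> W)}" using pre[of "B \<inter> W"] \<open>open B\<close> W by auto
      moreover have "{y \<in> S. h y \<in> proj ` (B \<inter> W)} = s -` B \<inter> T"
      proof (intro equalityI subsetI)
        fix y assume "y \<in> {y \<in> S. h y \<in> proj ` (B \<inter> W)}"
        then obtain w where w: "y \<in> S" "w \<in> B" "w \<in> W" "h y = proj w" by auto
        then have "y \<in> T" unfolding T_def by auto
        then show "y \<in> s -` B \<inter> T" using s_unique[of w y] w by auto
      next
        fix y assume "y \<in> s -` B \<inter> T"
        then have "y \<in> T" "s y \<in> B" by auto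
        then have "s y \<in> B \<inter> W" "h y = proj (s y)" "y \<in> S" using s[of y] T_def by auto
        then show "y \<in> {y \<in> S. h y \<in> proj ` (B \<inter> W)}" by blast
      qed
      ultimately have "openin (top_of_set S) (s -` B \<inter> T)" by simp
      then obtain A where A: "open A" "s -` B \<inter> T = S \<inter> A" unfolding openin_open by blast
      moreover have "T \<subseteq> S" unfolding T_def by blast
      ultimately have "A \<inter> T = s -` B \<inter> T" by auto
      then show "\<exists>A. open A \<and> A \<inter> T = s -` B \<inter> T" using A(1) by blast
    qed
    define sheet where "sheet = (\<lambda>g. (\<lambda>y. (y, act g (s y))) ` T)"
    \<comment> \<open>Two descriptions of a sheet: as a graph it is homeomorphic to
      \<open>T\<close>, and as the part of \<open>E\<close> in a product it is open in
      \<open>E\<close>.\<close>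
    have sheet_eq: "sheet g = E \<inter> (T \<times> act g ` W)" if g: "g \<in> carrier G" for g
    proof (intro equalityI subsetI)
      fix z assume "z \<in> sheet g"
      then obtain y where y: "y \<in> T" "z = (y, act g (s y))" unfolding sheet_def by auto
      then have "proj (act g (s y)) = h y" "act g (s y) \<in> \<Omega>" using proj_act[OF g] s[of y] W(3) act_closed[OF g] by auto
      then show "z \<in> E \<inter> (T \<times> act g ` W)" using y s[of y] unfolding E_def T_def by auto
    next
      fix z assume "z \<in> E \<inter> (T \<times> act g ` W)"
      then obtain y w where y: "z = (y, act g w)" "y \<in> T" "w \<in> W" "h y = proj (act g w)" unfolding E_def by auto
      then have "w = s y" using proj_act[OF g] W(3) by (intro s_unique) auto
      then show "z \<in> sheet g" using y unfolding sheet_def by auto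
    qed
    show "\<exists>T. x \<in> T \<and> openin (top_of_set S) T \<and>
        (\<exists>v. \<Union>v = E \<inter> fst -` T \<and> (\<forall>u\<in>v. openin (top_of_set E) u) \<and>
          pairwise disjnt v \<and> (\<forall>u\<in>v. \<exists>q. homeomorphism u T fst q))"
    proof (intro exI[of _ T] exI[of _ "sheet ` carrier G"] conjI ballI)
      show "\<Union> (sheet ` carrier G) = E \<inter> fst -` T"
      proof (intro equalityI subsetI)
        fix z assume "z \<in> E \<inter> fst -` T"
        then obtain y p' where y: "z = (y, p')" "y \<in> T" "p' \<in> \<Omega>" "h y = proj p'" "z \<in> E" unfolding E_def by auto
        then obtain g where g: "g \<in> carrier G" "p' = act g (s y)"
          using proj_eq_iff[of "s y" p'] s[of y] W(3) by auto
        then show "z \<in> \<Union> (sheet ` carrier G)" using y unfolding sheet_def by auto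
      qed (use sheet_eq in auto)
      fix u assume "u \<in> sheet ` carrier G"
      then obtain g where g: "g \<in> carrier G" "u = sheet g" by auto
      obtain T' where T': "open T'" "T = S \<inter> T'" using T unfolding openin_open by auto
      have "sheet g = E \<inter> (T' \<times> act g ` W)" unfolding sheet_eq[OF g(1)] using T' by (auto simp: E_def)
      then show "openin (top_of_set E) u"
        unfolding openin_open g(2) using open_Times[OF T'(1) act_image_open[OF g(1) W(3,1)]] by blast
      have "continuous_on T (\<lambda>y. (y, act g (s y)))"
        using s W(3) by (intro continuous_intros continuous_on_compose2[OF act_cont[OF g(1)] cont_s]) auto
      then have "homeomorphism u T fst (\<lambda>y. (y, act g (s y)))"
        unfolding homeomorphism_def g(2) sheet_def by (auto intro!: continuous_intros simp: image_image)
      then show "\<exists>q. homeomorphism u T fst q" by blast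
    next
      show "pairwise disjnt (sheet ` carrier G)"
      proof (intro pairwiseI)
        fix a b assume ab: "a \<in> sheet ` carrier G" "b \<in> sheet ` carrier G" "a \<noteq> b"
        then obtain g k where gk: "g \<in> carrier G" "k \<in> carrier G" "a = sheet g" "b = sheet k" by auto
        show "disjnt a b"
        proof (rule ccontr)
          assume "\<not> disjnt a b"
          then obtain y where y: "y \<in> T" "act g (s y) = act k (s y)"
            unfolding disjnt_def gk sheet_def by auto
          then have "g = k" using act_eq_imp_eq[OF gk(1,2)] s[of y] W(3) by blast
          then show False using ab gk by simp
        qed
      qed
    next
      show "x \<in> T" by (fact xT)
      show "openin (top_of_set S) T" by (fact T)
    qed
  qed
  \<comment> \<open>Lifting the identity of \<open>S\<close> gives a section of the pullback, and
    its second component is the lift of \<open>h\<close>.\<close>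
  obtain L where L: "continuous_on S L" "L \<in> S \<rightarrow> E" "\<And>y. y \<in> S \<Longrightarrow> fst (L y) = y"
    using covering_space_lift[OF cov S continuous_on_id] by auto
  show thesis
  proof (rule that[of "\<lambda>y. snd (L y)"])
    show "continuous_on S (\<lambda>y. snd (L y))" by (intro continuous_intros L)
    show "(\<lambda>y. snd (L y)) \<in> S \<rightarrow> \<Omega>" using L(2) unfolding E_def by force
    show "proj (snd (L y)) = h y" if "y \<in> S" for y using L(2,3) that unfolding E_def by force
  qed
qed

text \<open>For each group element the set of points where it carries \<open>F\<close> to
  \<open>F'\<close> is open by proper discontinuity. By freeness these sets are disjoint, and they
  cover \<open>S\<close>; connectedness leaves only one.\<close>

lemma lifts_differ_by_deck:
  fixes F F' :: "'b::euclidean_space \<Rightarrow> 'a"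
  assumes S: "connected S" and F: "continuous_on S F" "F \<in> S \<rightarrow> \<Omega>" and F': "continuous_on S F'" "F' \<in> S \<rightarrow> \<Omega>"
    and eq: "\<And>p. p \<in> S \<Longrightarrow> proj (F p) = proj (F' p)"
  obtains g where "g \<in> carrier G" "\<And>p. p \<in> S \<Longrightarrow> F' p = act g (F p)"
proof (cases "S = {}")
  case False
  then obtain p0 where p0: "p0 \<in> S" by auto
  define A where "A = (\<lambda>g. {p \<in> S. F' p = act g (F p)})"
  have A_open: "openin (top_of_set S) (A g)" if g: "g \<in> carrier G" for g
  proof (subst openin_subopen, intro ballI)
    fix p assume "p \<in> A g"
    then have p: "p \<in> S" "F' p = act g (F p)" unfolding A_def by auto
    obtain V V' where V: "open V" "open V'" "F p \<in> V" "F' p \<in> V'" "V \<subseteq> \<Omega>" "V' \<subseteq> \<Omega>"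
      "\<forall>k\<in>carrier G. act k ` V \<inter> V' \<noteq> {} \<longrightarrow> act k (F p) = F' p"
      using act_pd[of "F p" "F' p"] p F F' by (metis Pi_mem)
    have "openin (top_of_set S) ((S \<inter> F -` V) \<inter> (S \<inter> F' -` V'))"
      by (intro openin_Int continuous_openin_preimage_gen F F' V)
    moreover have "(S \<inter> F -` V) \<inter> (S \<inter> F' -` V') \<subseteq> A g"
    proof
      fix x assume "x \<in> (S \<inter> F -` V) \<inter> (S \<inter> F' -` V')"
      then have x: "x \<in> S" "F x \<in> V" "F' x \<in> V'" by auto
      then obtain k where k: "k \<in> carrier G" "F' x = act k (F x)"
        using proj_eq_iff[of "F x" "F' x"] eq[of x] V by auto
      then have "act k ` V \<inter> V' \<noteq> {}" using x by auto
      then have "act k (F p) = act g (F p)" using V(7) k p by auto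
      then have "k = g" using act_eq_imp_eq[OF k(1) g] V by auto
      then show "x \<in> A g" unfolding A_def using x k by auto
    qed
    moreover have "p \<in> (S \<inter> F -` V) \<inter> (S \<inter> F' -` V')" using p V by auto
    ultimately show "\<exists>T. openin (top_of_set S) T \<and> p \<in> T \<and> T \<subseteq> A g" by blast
  qed
  obtain g where g: "g \<in> carrier G" "F' p0 = act g (F p0)"
    using proj_eq_iff[of "F p0" "F' p0"] eq[OF p0] F F' p0 by auto
  have "S - A g = (\<Union>k\<in>carrier G - {g}. A k)"
  proof (intro equalityI subsetI)
    fix x assume x: "x \<in> S - A g"
    then obtain k where k: "k \<in> carrier G" "F' x = act k (F x)"
      using proj_eq_iff[of "F x" "F' x"] eq[of x] F F' by auto
    then show "x \<in> (\<Union>k\<in>carrier G - {g}. A k)" using x unfolding A_def by auto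
  next
    fix x assume "x \<in> (\<Union>k\<in>carrier G - {g}. A k)"
    then obtain k where k: "k \<in> carrier G" "k \<noteq> g" "x \<in> S" "F' x = act k (F x)" unfolding A_def by auto
    have "F x \<in> \<Omega>" using F k by auto
    then have "act k (F x) \<noteq> act g (F x)" using act_eq_imp_eq[OF k(1) g(1)] k(2) by blast
    then show "x \<in> S - A g" unfolding A_def using k by auto
  qed
  then have "openin (top_of_set S) (S - A g)" using A_open by auto
  then have "closedin (top_of_set S) (A g)" unfolding closedin_def A_def by auto
  then have "A g = {} \<or> A g = S" using S A_open[OF g(1)] unfolding connected_clopen by auto
  then have "A g = S" using p0 g unfolding A_def by auto
  then show thesis using that[OF g(1)] unfolding A_def by auto
next
  case True
  then show thesis using that[of "\<one>"] by auto
qed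

end

text \<open>\<open>F\<close> and its composite with the action of \<open>g\<close> lift the same
  map, so they differ by an element \<open>\<phi> g\<close>; freeness makes \<open>\<phi>\<close> a
  homomorphism. The composites of \<open>F\<close> and \<open>F'\<close> are not identities but act
  as fixed elements \<open>k\<close> and \<open>l\<close>: cancelling \<open>k\<close> gives
  injectivity, and \<open>l\<close> enters the preimages below.\<close>

lemma equivariance_iso:
  assumes A: "pd_action G act \<Omega>" and B: "pd_action H act' \<Omega>'"
    and conn: "connected \<Omega>" "connected \<Omega>'" "\<Omega> \<noteq> {}"
    and F: "continuous_on \<Omega> F" "F \<in> \<Omega> \<rightarrow> \<Omega>'" and F': "continuous_on \<Omega>' F'" "F' \<in> \<Omega>' \<rightarrow> \<Omega>"
    and FF: "\<And>p p'. p \<in> \<Omega> \<Longrightarrow> p' \<in> \<Omega> \<Longrightarrow> orbit G act p = orbit G act p' \<Longrightarrow> orbit H act' (F p) = orbit H act' (F p')"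
    and FF': "\<And>p p'. p \<in> \<Omega>' \<Longrightarrow> p' \<in> \<Omega>' \<Longrightarrow> orbit H act' p = orbit H act' p' \<Longrightarrow> orbit G act (F' p) = orbit G act (F' p')"
    and inv: "\<And>p. p \<in> \<Omega> \<Longrightarrow> orbit G act (F' (F p)) = orbit G act p"
    and inv': "\<And>p. p \<in> \<Omega>' \<Longrightarrow> orbit H act' (F (F' p)) = orbit H act' p"
  obtains \<phi> where "\<phi> \<in> iso G H" "\<And>g p. g \<in> carrier G \<Longrightarrow> p \<in> \<Omega> \<Longrightarrow> F (act g p) = act' (\<phi> g) (F p)"
proof -
  interpret A: pd_action G act \<Omega> by fact
  interpret B: pd_action H act' \<Omega>' by fact
  have "\<exists>h\<in>carrier H. \<forall>p\<in>\<Omega>. F (act g p) = act' h (F p)" if g: "g \<in> carrier G" for g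
  proof (rule B.lifts_differ_by_deck[OF conn(1) F, of "\<lambda>p. F (act g p)"])
    show "continuous_on \<Omega> (\<lambda>p. F (act g p))"
      by (rule continuous_on_compose2[OF F(1) A.act_cont[OF g]]) (use A.act_closed[OF g] in auto)
    show "(\<lambda>p. F (act g p)) \<in> \<Omega> \<rightarrow> \<Omega>'" using F(2) A.act_closed[OF g] by auto
    show "orbit H act' (F p) = orbit H act' (F (act g p))" if "p \<in> \<Omega>" for p
      by (rule FF) (use that A.act_closed[OF g] A.proj_act[OF g] in auto)
  qed blast
  then obtain \<phi> where \<phi>: "\<And>g. g \<in> carrier G \<Longrightarrow> \<phi> g \<in> carrier H"
    "\<And>g p. g \<in> carrier G \<Longrightarrow> p \<in> \<Omega> \<Longrightarrow> F (act g p) = act' (\<phi> g) (F p)" by metis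
  have "\<exists>h\<in>carrier G. \<forall>p\<in>\<Omega>'. F' (act' g p) = act h (F' p)" if g: "g \<in> carrier H" for g
  proof (rule A.lifts_differ_by_deck[OF conn(2) F', of "\<lambda>p. F' (act' g p)"])
    show "continuous_on \<Omega>' (\<lambda>p. F' (act' g p))"
      by (rule continuous_on_compose2[OF F'(1) B.act_cont[OF g]]) (use B.act_closed[OF g] in auto)
    show "(\<lambda>p. F' (act' g p)) \<in> \<Omega>' \<rightarrow> \<Omega>" using F'(2) B.act_closed[OF g] by auto
    show "orbit G act (F' p) = orbit G act (F' (act' g p))" if "p \<in> \<Omega>'" for p
      by (rule FF') (use that B.act_closed[OF g] B.proj_act[OF g] in auto)
  qed blast
  then obtain \<psi> where \<psi>: "\<And>g. g \<in> carrier H \<Longrightarrow> \<psi> g \<in> carrier G"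
    "\<And>g p. g \<in> carrier H \<Longrightarrow> p \<in> \<Omega>' \<Longrightarrow> F' (act' g p) = act (\<psi> g) (F' p)" by metis
  obtain k where k: "k \<in> carrier G" "\<And>p. p \<in> \<Omega> \<Longrightarrow> F' (F p) = act k p"
  proof (rule A.lifts_differ_by_deck[OF conn(1) continuous_on_id, of "\<lambda>p. F' (F p)"])
    show "continuous_on \<Omega> (\<lambda>p. F' (F p))" by (rule continuous_on_compose2[OF F'(1) F(1)]) (use F in auto)
  qed (use F F' inv in auto)
  obtain l where l: "l \<in> carrier H" "\<And>p. p \<in> \<Omega>' \<Longrightarrow> F (F' p) = act' l p"
  proof (rule B.lifts_differ_by_deck[OF conn(2) continuous_on_id, of "\<lambda>p. F (F' p)"])
    show "continuous_on \<Omega>' (\<lambda>p. F (F' p))" by (rule continuous_on_compose2[OF F(1) F'(1)]) (use F' in auto)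
  qed (use F F' inv' in auto)
  obtain p0 where p0: "p0 \<in> \<Omega>" using conn by auto
  have Fp0: "F p0 \<in> \<Omega>'" using F p0 by auto
  have hom: "\<phi> (g \<otimes>\<^bsub>G\<^esub> h) = \<phi> g \<otimes>\<^bsub>H\<^esub> \<phi> h" if gh: "g \<in> carrier G" "h \<in> carrier G" for g h
  proof (rule B.act_eq_imp_eq[OF _ _ Fp0])
    show "act' (\<phi> (g \<otimes>\<^bsub>G\<^esub> h)) (F p0) = act' (\<phi> g \<otimes>\<^bsub>H\<^esub> \<phi> h) (F p0)"
      using gh p0 Fp0 by (simp add: A.act_mult A.act_closed B.act_mult \<phi> flip: \<phi>(2))
  qed (use gh \<phi> in auto)
  have inj: "inj_on \<phi> (carrier G)"
  proof (rule inj_onI)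
    fix g h assume gh: "g \<in> carrier G" "h \<in> carrier G" "\<phi> g = \<phi> h"
    have "F' (F (act g p0)) = F' (F (act h p0))" using gh p0 by (simp add: \<phi>(2))
    then have "act k (act g p0) = act k (act h p0)" using k p0 gh A.act_closed by simp
    then have "act g p0 = act h p0" using A.act_inv(1)[OF k(1)] gh p0 A.act_closed by metis
    then show "g = h" using A.act_eq_imp_eq gh p0 by blast
  qed
  have surj: "\<phi> ` carrier G = carrier H"
  proof
    show "carrier H \<subseteq> \<phi> ` carrier G"
    proof
      fix g assume g: "g \<in> carrier H"
      \<comment> \<open>Conjugation by \<open>l\<close> compensates for
        \<open>F (F' p) = act' l p\<close>: comparing the two ways to move \<open>F (F' p)\<close>
        gives \<open>\<phi> (\<psi> g')\<close> times \<open>l\<close> equal to \<open>g\<close>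
        times \<open>l\<close>.\<close>
      define g' where "g' = inv\<^bsub>H\<^esub> l \<otimes>\<^bsub>H\<^esub> (g \<otimes>\<^bsub>H\<^esub> l)"
      have g': "g' \<in> carrier H" unfolding g'_def using g l by auto
      have lg: "l \<otimes>\<^bsub>H\<^esub> g' = g \<otimes>\<^bsub>H\<^esub> l" unfolding g'_def using g l by (simp flip: B.m_assoc)
      let ?p = "F p0"
      have 1: "F (F' (act' g' ?p)) = act' (g \<otimes>\<^bsub>H\<^esub> l) ?p"
        using l g' Fp0 B.act_closed by (simp add: B.act_mult flip: lg)
      have "F (F' (act' g' ?p)) = F (act (\<psi> g') (F' ?p))" using \<psi>(2)[OF g' Fp0] by simp
      also have "\<dots> = act' (\<phi> (\<psi> g')) (F (F' ?p))" using \<phi>(2)[OF \<psi>(1)[OF g']] F' Fp0 by auto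
      also have "\<dots> = act' (\<phi> (\<psi> g') \<otimes>\<^bsub>H\<^esub> l) ?p" using l Fp0 \<phi> \<psi> g' by (simp add: B.act_mult)
      finally have "\<phi> (\<psi> g') \<otimes>\<^bsub>H\<^esub> l = g \<otimes>\<^bsub>H\<^esub> l"
        using 1 B.act_eq_imp_eq[OF _ _ Fp0, of "\<phi> (\<psi> g') \<otimes>\<^bsub>H\<^esub> l" "g \<otimes>\<^bsub>H\<^esub> l"] g l \<phi> \<psi> g' by auto
      then have "\<phi> (\<psi> g') = g" using g l \<phi> \<psi> g' by auto
      then show "g \<in> \<phi> ` carrier G" using \<psi>(1)[OF g'] by blast
    qed
  qed (use \<phi> in auto)
  have "\<phi> \<in> iso G H" using hom inj surj \<phi>(1) by (auto simp: iso_def hom_def bij_betw_def)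
  then show thesis using that \<phi>(2) by blast
qed

lemma hom_on_UNIV_simps:
  assumes "hom_on UNIV f"
  shows "f (x + y) = f x + f y" "f (x * y) = f x * f y" "f 1 = 1" "f 0 = 0" "f (x - y) = f x - f y"
    "f (- x) = - f x" "f (sum g A) = (\<Sum>i\<in>A. f (g i))" "f (of_int n) = of_int n" "f (of_nat m) = of_nat m"
    "f x = 0 \<longleftrightarrow> x = 0" "f x = f y \<longleftrightarrow> x = y" "f (inverse x) = inverse (f x)" "f (x ^ m) = f x ^ m"
    "f (of_rat q) = of_rat q"
proof -
  note s = hom_on_simps[OF assms]
  show 1: "f (x + y) = f x + f y" "f (x * y) = f x * f y" "f 1 = 1" "f 0 = 0" "f (x - y) = f x - f y" for x y
    using s by auto
  show "f (sum g A) = (\<Sum>i\<in>A. f (g i))" using s by auto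
  show "f (- x) = - f x" using 1(5)[of 0 x] 1(4) by simp
  show i: "f (of_int n) = of_int n" for n using hom_on_of_int[OF assms] by auto
  show "f (of_nat m) = of_nat m" using i[of "int m"] by simp
  show z: "f x = 0 \<longleftrightarrow> x = 0" for x
  proof
    assume "f x = 0"
    then have "f (x * inverse x) = 0" by (simp add: 1)
    then show "x = 0" using 1 by (cases "x = 0") auto
  qed (simp add: 1)
  show "f x = f y \<longleftrightarrow> x = y" using z[of "x - y"] 1(5) by simp
  show "f (inverse x) = inverse (f x)"
  proof (cases "x = 0")
    case False
    then have "f x * f (inverse x) = 1" using 1(2)[of x "inverse x"] 1(3) by simp
    then show ?thesis by (metis inverse_unique)
  qed (simp add: 1)
  show "f (x ^ m) = f x ^ m" by (induction m) (simp_all add: 1)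
  show "f (of_rat q) = of_rat q" using hom_on_of_rat[OF assms] .
qed

section \<open>Complex manifolds\<close>

definition holo_at :: "(('s::finite, 't::finite) model \<Rightarrow> ('s, 't) model) \<Rightarrow> ('s, 't) model \<Rightarrow> bool" where
  "holo_at f p \<longleftrightarrow> (\<exists>D. (f has_derivative D) (at p) \<and> (\<forall>c v. D (cscale c v) = cscale c (D v)))"

lemma holomorphic_map_on_iff: "holomorphic_map_on f S \<longleftrightarrow> (\<forall>p\<in>S. holo_at f p)"
  unfolding holomorphic_map_on_def holo_at_def ..

lemma holo_at_cong:
  assumes "holo_at f p" "open N" "p \<in> N" "\<And>x. x \<in> N \<Longrightarrow> f x = g x"
  shows "holo_at g p"
proof -
  obtain D where D: "(f has_derivative D) (at p)" "\<And>c v. D (cscale c v) = cscale c (D v)"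
    using assms(1) unfolding holo_at_def by blast
  have "(g has_derivative D) (at p)"
    by (rule has_derivative_transform_within_open[OF D(1) assms(2,3,4)])
  then show ?thesis unfolding holo_at_def using D(2) by blast
qed

lemma holo_at_compose:
  assumes "holo_at f p" "holo_at g (f p)"
  shows "holo_at (g \<circ> f) p"
proof -
  obtain D E where D: "(f has_derivative D) (at p)" "\<And>c v. D (cscale c v) = cscale c (D v)"
    and E: "(g has_derivative E) (at (f p))" "\<And>c v. E (cscale c v) = cscale c (E v)"
    using assms unfolding holo_at_def by blast
  have "((g \<circ> f) has_derivative (E \<circ> D)) (at p)" by (rule diff_chain_at[OF D(1) E(1)])
  then show ?thesis unfolding holo_at_def using D E by (intro exI[of _ "E \<circ> D"]) auto
qed

lemma complex_manifold_chart:
  assumes "complex_manifold (Z, A)" "(D, \<phi>) \<in> A"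
  shows "openin Z D" "open (\<phi> ` D)" "homeomorphic_map (subtopology Z D) (top_of_set (\<phi> ` D)) \<phi>"
    "inj_on \<phi> D" "D \<subseteq> topspace Z"
proof -
  show 1: "openin Z D" "open (\<phi> ` D)" "homeomorphic_map (subtopology Z D) (top_of_set (\<phi> ` D)) \<phi>"
    using assms unfolding complex_manifold_def by auto
  show "D \<subseteq> topspace Z" using openin_subset[OF 1(1)] .
  then show "inj_on \<phi> D" using 1(3) unfolding homeomorphic_map_def by (simp add: Int_absorb1)
qed

lemma openin_chart_image:
  assumes "complex_manifold (Z, A)" "(D, \<phi>) \<in> A" "openin Z V" "V \<subseteq> D"
  shows "open (\<phi> ` V)"
proof -
  note c = complex_manifold_chart[OF assms(1,2)]
  have "openin (subtopology Z D) V" using assms(3,4) by (metis inf.absorb_iff1 openin_subtopology)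
  then have "openin (top_of_set (\<phi> ` D)) (\<phi> ` V)"
    using c(3) homeomorphic_imp_open_map unfolding open_map_def by blast
  then show ?thesis using c(2) openin_open_trans by blast
qed

lemma biholomorphic_sym: "biholomorphic M N \<Longrightarrow> biholomorphic N M"
  unfolding biholomorphic_def by blast

text \<open>Around each point the composite is factored through a chart of \<open>N\<close>. The
  factorisation is valid only on the part of the chart domain that \<open>f\<close> maps into the
  middle chart; continuity makes this part open, which suffices as holomorphy is local.\<close>

lemma holomorphic_between_compose:
  assumes M: "complex_manifold M" and N: "complex_manifold N"
    and f: "holomorphic_between M N f" and g: "holomorphic_between N P g"
  shows "holomorphic_between M P (g \<circ> f)"
proof -
  obtain Z1 A1 Z2 A2 Z3 A3 where MNP: "M = (Z1, A1)" "N = (Z2, A2)" "P = (Z3, A3)" by (metis surj_pair)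
  have cf: "continuous_map Z1 Z2 f" and hf: "\<And>D \<phi> D' \<psi>. (D, \<phi>) \<in> A1 \<Longrightarrow> (D', \<psi>) \<in> A2 \<Longrightarrow>
      holomorphic_map_on (\<psi> \<circ> f \<circ> inv_into D \<phi>) (\<phi> ` (D \<inter> f -` D'))"
    using f unfolding MNP holomorphic_between_def by auto
  have cg: "continuous_map Z2 Z3 g" and hg: "\<And>D \<phi> D' \<psi>. (D, \<phi>) \<in> A2 \<Longrightarrow> (D', \<psi>) \<in> A3 \<Longrightarrow>
      holomorphic_map_on (\<psi> \<circ> g \<circ> inv_into D \<phi>) (\<phi> ` (D \<inter> g -` D'))"
    using g unfolding MNP holomorphic_between_def by auto
  have "holomorphic_map_on (\<xi> \<circ> (g \<circ> f) \<circ> inv_into D \<phi>) (\<phi> ` (D \<inter> (g \<circ> f) -` D''))"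
    if D: "(D, \<phi>) \<in> A1" and D'': "(D'', \<xi>) \<in> A3" for D \<phi> D'' \<xi>
    unfolding holomorphic_map_on_iff
  proof
    fix p assume "p \<in> \<phi> ` (D \<inter> (g \<circ> f) -` D'')"
    then obtain x where x: "x \<in> D" "g (f x) \<in> D''" "p = \<phi> x" by auto
    note cD = complex_manifold_chart[OF M[unfolded MNP(1)] D]
    have "f x \<in> topspace Z2" using continuous_map_image_subset_topspace[OF cf] x cD(5) by auto
    then obtain D' \<psi> where D': "(D', \<psi>) \<in> A2" "f x \<in> D'"
      using N unfolding MNP complex_manifold_def by force
    note cD' = complex_manifold_chart[OF N[unfolded MNP(2)] D'(1)]
    have inv: "inv_into D \<phi> (\<phi> y) = y" if "y \<in> D" for y using cD(4) that by simp
    have inv': "inv_into D' \<psi> (\<psi> y) = y" if "y \<in> D'" for y using cD'(4) that by simp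
    have "holo_at (\<psi> \<circ> f \<circ> inv_into D \<phi>) p"
      using hf[OF D D'(1)] x D' unfolding holomorphic_map_on_iff by auto
    moreover have "holo_at (\<xi> \<circ> g \<circ> inv_into D' \<psi>) ((\<psi> \<circ> f \<circ> inv_into D \<phi>) p)"
      using hg[OF D'(1) D''] x D' unfolding holomorphic_map_on_iff by (auto simp: inv)
    ultimately have "holo_at ((\<xi> \<circ> g \<circ> inv_into D' \<psi>) \<circ> (\<psi> \<circ> f \<circ> inv_into D \<phi>)) p"
      by (rule holo_at_compose)
    then show "holo_at (\<xi> \<circ> (g \<circ> f) \<circ> inv_into D \<phi>) p"
    proof (rule holo_at_cong)
      let ?V = "{y \<in> topspace Z1. f y \<in> D'} \<inter> D"
      have "openin Z1 ?V"
        using openin_continuous_map_preimage[OF cf cD'(1)] cD(1) by auto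
      then show "open (\<phi> ` ?V)" by (rule openin_chart_image[OF M[unfolded MNP(1)] D]) auto
      show "p \<in> \<phi> ` ?V" using x D' cD(5) by auto
      fix q assume "q \<in> \<phi> ` ?V"
      then show "((\<xi> \<circ> g \<circ> inv_into D' \<psi>) \<circ> (\<psi> \<circ> f \<circ> inv_into D \<phi>)) q = (\<xi> \<circ> (g \<circ> f) \<circ> inv_into D \<phi>) q"
        by (auto simp: inv inv')
    qed
  qed
  then show ?thesis
    unfolding MNP holomorphic_between_def using continuous_map_compose[OF cf cg] by auto
qed

lemma holomorphic_between_topspace:
  assumes "holomorphic_between M N f" "x \<in> topspace (fst M)"
  shows "f x \<in> topspace (fst N)"
proof -
  have "continuous_map (fst M) (fst N) f"
    using assms(1) unfolding holomorphic_between_def by (simp add: case_prod_unfold)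
  then show ?thesis using assms(2) continuous_map_image_subset_topspace by blast
qed

lemma biholomorphic_trans:
  assumes "complex_manifold M" "complex_manifold N" "complex_manifold P"
    and "biholomorphic M N" "biholomorphic N P"
  shows "biholomorphic M P"
proof -
  obtain f g where f: "holomorphic_between M N f" "holomorphic_between N M g"
    "\<forall>x\<in>topspace (fst M). g (f x) = x" "\<forall>y\<in>topspace (fst N). f (g y) = y"
    using assms(4) unfolding biholomorphic_def by blast
  obtain f' g' where f': "holomorphic_between N P f'" "holomorphic_between P N g'"
    "\<forall>x\<in>topspace (fst N). g' (f' x) = x" "\<forall>y\<in>topspace (fst P). f' (g' y) = y"
    using assms(5) unfolding biholomorphic_def by blast
  have im: "f x \<in> topspace (fst N)" if "x \<in> topspace (fst M)" for x
    using holomorphic_between_topspace[OF f(1) that] .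
  have im': "g' x \<in> topspace (fst N)" if "x \<in> topspace (fst P)" for x
    using holomorphic_between_topspace[OF f'(2) that] .
  show ?thesis unfolding biholomorphic_def
  proof (intro exI conjI)
    show "holomorphic_between M P (f' \<circ> f)" by (rule holomorphic_between_compose[OF assms(1,2) f(1) f'(1)])
    show "holomorphic_between P M (g \<circ> g')" by (rule holomorphic_between_compose[OF assms(3,2) f'(2) f(2)])
    show "\<forall>x\<in>topspace (fst M). (g \<circ> g') ((f' \<circ> f) x) = x" using f f' im by simp
    show "\<forall>y\<in>topspace (fst P). (f' \<circ> f) ((g \<circ> g') y) = y" using f f' im' by simp
  qed
qed

section \<open>Oeljeklaus--Toma data\<close>

text \<open>The Minkowski embedding of the field, with one embedding from each conjugate pair; the
  real coordinates are kept as complex numbers so that it acts by translation on the model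
  space.\<close>

definition emb_vec :: "('s::finite \<Rightarrow> 'k \<Rightarrow> complex) \<Rightarrow> ('t::finite \<Rightarrow> 'k \<Rightarrow> complex) \<Rightarrow> 'k \<Rightarrow> ('s, 't) model" where
  "emb_vec \<sigma> \<tau> a = (\<chi> i. \<sigma> i a, \<chi> j. \<tau> j a)"

text \<open>Membership of \<open>range \<tau>\<close> in the set of types, restated for the tuple
  alone: every conjugate pair contributes exactly one member, listed exactly once.\<close>

locale ot_data =
  fixes \<sigma> :: "'s::finite \<Rightarrow> 'k::field_char_0 \<Rightarrow> complex" and \<tau> :: "'t::finite \<Rightarrow> 'k \<Rightarrow> complex"
    and U :: "'k set"
  assumes nf: "number_field TYPE('k)"
    and bij_\<sigma>: "bij_betw \<sigma> UNIV real_embeddings"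
    and range_\<tau>: "range \<tau> \<subseteq> nonreal_embeddings"
    and inj_\<tau>: "inj \<tau>"
    and conj_cases: "f \<in> nonreal_embeddings \<Longrightarrow> f \<in> range \<tau> \<or> conj_embedding f \<in> range \<tau>"
    and conj_notin: "conj_embedding (\<tau> j) \<notin> range \<tau>"
    and adm: "admissible \<sigma> U"
begin

lemma \<sigma>_hom: "hom_on UNIV (\<sigma> i)"
  using bij_\<sigma> unfolding bij_betw_def real_embeddings_def ring_hom_type_iff_hom_on by auto

lemma \<sigma>_real: "\<sigma> i x \<in> \<real>"
  using bij_\<sigma> unfolding bij_betw_def real_embeddings_def by auto

lemma Im_\<sigma> [simp]: "Im (\<sigma> i x) = 0"
  using \<sigma>_real complex_is_Real_iff by blast

lemma \<tau>_hom: "hom_on UNIV (\<tau> j)"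
  using range_\<tau> unfolding nonreal_embeddings_def ring_hom_type_iff_hom_on by auto

lemmas \<sigma>_simps = hom_on_UNIV_simps[OF \<sigma>_hom]
lemmas \<tau>_simps = hom_on_UNIV_simps[OF \<tau>_hom]

lemma embedding_cases:
  assumes "hom_on UNIV f"
  obtains i where "f = \<sigma> i" | j where "f = \<tau> j" | j where "f = cnj \<circ> \<tau> j"
proof (cases "range f \<subseteq> \<real>")
  case True
  then have "f \<in> real_embeddings" using assms unfolding real_embeddings_def ring_hom_type_iff_hom_on by simp
  then show ?thesis using bij_\<sigma> that(1) unfolding bij_betw_def by auto
next
  case False
  then have "f \<in> nonreal_embeddings" using assms unfolding nonreal_embeddings_def ring_hom_type_iff_hom_on by simp
  then consider j where "f = \<tau> j" | j where "conj_embedding f = \<tau> j" using conj_cases by blast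
  then show ?thesis
  proof cases
    case 2
    then have "f = cnj \<circ> \<tau> j" unfolding conj_embedding_def fun_eq_iff by (metis comp_apply complex_cnj_cnj)
    then show ?thesis by (rule that(3))
  qed (rule that(2))
qed

lemma monoid_integers: "Group.monoid (ring_of_integers :: 'k ring)"
  by unfold_locales (auto simp: ring_of_integers_def ring_of_type_algebra_def algebraic_int_times mult.assoc)

lemma Units_integers: "Units (ring_of_integers :: 'k ring) = {u. algebraic_int u \<and> u \<noteq> 0 \<and> algebraic_int (inverse u)}"
proof -
  have "(\<exists>v. algebraic_int v \<and> v * u = 1 \<and> u * v = 1) \<longleftrightarrow> u \<noteq> 0 \<and> algebraic_int (inverse u)" for u :: 'k
    by (metis inverse_unique left_inverse mult.commute mult_zero_left right_inverse zero_neq_one)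
  then show ?thesis
    unfolding Units_def by (auto simp: ring_of_integers_def ring_of_type_algebra_def)
qed

lemma U_one: "1 \<in> U" and U_mult: "u \<in> U \<Longrightarrow> v \<in> U \<Longrightarrow> u * v \<in> U"
  and U_inverse: "u \<in> U \<Longrightarrow> inverse u \<in> U"
  and U_integral: "u \<in> U \<Longrightarrow> algebraic_int u" and U_nonzero: "u \<in> U \<Longrightarrow> u \<noteq> 0"
  and U_pos: "u \<in> U \<Longrightarrow> Re (\<sigma> i u) > 0"
proof -
  have sub: "subgroup U (units_of (ring_of_integers :: 'k ring))" using adm unfolding admissible_def by auto
  have one: "\<one>\<^bsub>units_of (ring_of_integers :: 'k ring)\<^esub> = 1"
    and mult: "\<And>x y. x \<otimes>\<^bsub>units_of (ring_of_integers :: 'k ring)\<^esub> y = x * y"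
    by (simp_all add: units_of_def ring_of_integers_def ring_of_type_algebra_def)
  interpret G: Group.group "units_of (ring_of_integers :: 'k ring)"
    using Group.monoid.units_group[OF monoid_integers] .
  show "1 \<in> U" using subgroup.one_closed[OF sub] one by simp
  show "u \<in> U \<Longrightarrow> v \<in> U \<Longrightarrow> u * v \<in> U" using subgroup.m_closed[OF sub] mult by simp
  have "u \<in> Units ring_of_integers" if "u \<in> U" for u
    using subgroup.subset[OF sub] that by (auto simp: units_of_carrier)
  then show int: "u \<in> U \<Longrightarrow> algebraic_int u" and nz: "u \<in> U \<Longrightarrow> u \<noteq> 0" for u
    by (auto simp: Units_integers)
  show "inverse u \<in> U" if u: "u \<in> U"
  proof -
    let ?v = "inv\<^bsub>units_of ring_of_integers\<^esub> u"
    have "?v \<in> U" using subgroup.m_inv_closed[OF sub u] .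
    moreover have "u * ?v = 1"
      using G.r_inv[of u] subgroup.subset[OF sub] u by (simp add: one mult subset_iff)
    ultimately show ?thesis using inverse_unique by metis
  qed
  show "u \<in> U \<Longrightarrow> Re (\<sigma> i u) > 0" using adm unfolding admissible_def totally_positive_units_def by auto
qed

lemma group_ot: "Group.group (ot_group U)"
proof (rule groupI)
  fix x assume "x \<in> carrier (ot_group U)"
  then obtain u a where x: "x = (u, a)" "u \<in> U" "algebraic_int a" by (auto simp: ot_group_def)
  have "(inverse u, - (inverse u * a)) \<in> carrier (ot_group U)"
    using x algebraic_int_times[OF U_integral[OF U_inverse[OF x(2)]] x(3)] by (simp add: ot_group_def U_inverse)
  moreover have "(inverse u, - (inverse u * a)) \<otimes>\<^bsub>ot_group U\<^esub> x = \<one>\<^bsub>ot_group U\<^esub>"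
    using x U_nonzero[OF x(2)] by (simp add: ot_group_def)
  ultimately show "\<exists>y\<in>carrier (ot_group U). y \<otimes>\<^bsub>ot_group U\<^esub> x = \<one>\<^bsub>ot_group U\<^esub>" by blast
qed (auto simp: ot_group_def U_one U_mult algebra_simps intro!: algebraic_int_plus algebraic_int_times intro: U_integral)

text \<open>Discreteness of O_K. Conjugate embeddings have equal absolute values, so every embedding
  of \<open>a\<close> would lie inside the unit disc, which \<open>ex_embedding_norm_ge_1\<close>
  excludes for nonzero \<open>a\<close>.\<close>

lemma algebraic_int_eq_0_if_norm_emb_vec_less:
  assumes a: "algebraic_int a" and small: "norm (emb_vec \<sigma> \<tau> a) < 1"
  shows "a = 0"
proof (rule ccontr)
  assume "a \<noteq> 0"
  then obtain f :: "'k \<Rightarrow> complex" where f: "hom_on UNIV f" "norm (f a) \<ge> 1"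
    using ex_embedding_norm_ge_1[OF nf a] by blast
  have 1: "norm (\<sigma> i a) < 1" for i
    using small norm_fst_le[of "fst (emb_vec \<sigma> \<tau> a)" "snd (emb_vec \<sigma> \<tau> a)"] Finite_Cartesian_Product.norm_nth_le[of "fst (emb_vec \<sigma> \<tau> a)" i]
    by (simp add: emb_vec_def)
  have 2: "norm (\<tau> j a) < 1" for j
    using small norm_snd_le[of "snd (emb_vec \<sigma> \<tau> a)" "fst (emb_vec \<sigma> \<tau> a)"] Finite_Cartesian_Product.norm_nth_le[of "snd (emb_vec \<sigma> \<tau> a)" j]
    by (simp add: emb_vec_def)
  show False using f(2) 1 2
    by (rule_tac embedding_cases[OF f(1)]) (auto simp: not_le[symmetric])
qed

section \<open>The action: holomorphy, freeness and proper discontinuity\<close>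

lemma ot_action_eq: "ot_action \<sigma> \<tau> (u, a) p =
    (\<chi> i. \<sigma> i u * fst p $ i, \<chi> j. \<tau> j u * snd p $ j) + emb_vec \<sigma> \<tau> a"
  unfolding ot_action_def emb_vec_def by (cases p) (simp add: vec_eq_iff)

lemma linear_coord_scale: "bounded_linear (\<lambda>p :: ('s, 't) model. (\<chi> i. a i * fst p $ i, \<chi> j. b j * snd p $ j) :: ('s, 't) model)"
  by (subst linear_conv_bounded_linear[symmetric], rule linearI) (auto simp: vec_eq_iff algebra_simps)

lemma ot_action_has_derivative:
  "(ot_action \<sigma> \<tau> (u, a) has_derivative (\<lambda>p. (\<chi> i. \<sigma> i u * fst p $ i, \<chi> j. \<tau> j u * snd p $ j))) (at p within S)"
proof -
  have "((\<lambda>p. (\<chi> i. \<sigma> i u * fst p $ i, \<chi> j. \<tau> j u * snd p $ j) + emb_vec \<sigma> \<tau> a)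
     has_derivative (\<lambda>p. (\<chi> i. \<sigma> i u * fst p $ i, \<chi> j. \<tau> j u * snd p $ j))) (at p within S)"
    by (rule has_derivative_add_const[OF bounded_linear_imp_has_derivative[OF linear_coord_scale]])
  then show ?thesis by (simp add: ot_action_eq[abs_def])
qed

lemma holo_at_ot_action: "holo_at (ot_action \<sigma> \<tau> g) p"
  unfolding holo_at_def by (cases g, rule exI, rule conjI, simp, rule ot_action_has_derivative)
    (auto simp: cscale_def vec_eq_iff case_prod_unfold)

lemma ot_action_mult: "ot_action \<sigma> \<tau> (u * v, a + u * b) p = ot_action \<sigma> \<tau> (u, a) (ot_action \<sigma> \<tau> (v, b) p)"
  unfolding ot_action_def by (cases p) (simp add: vec_eq_iff \<sigma>_simps \<tau>_simps algebra_simps)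

lemma ot_action_one: "ot_action \<sigma> \<tau> (1, 0) p = p"
  unfolding ot_action_def by (cases p) (simp add: vec_eq_iff \<sigma>_simps \<tau>_simps)

lemma ot_action_domain:
  assumes "u \<in> U" "p \<in> ot_domain"
  shows "ot_action \<sigma> \<tau> (u, a) p \<in> ot_domain"
  using assms U_pos[of u] unfolding ot_action_def ot_domain_def by (cases p) simp

text \<open>One half-plane coordinate decides. Its imaginary part is positive and gets multiplied by
  \<open>\<sigma> i u\<close>, so a fixed point forces \<open>\<sigma> i u = 1\<close>; then the
  translation by \<open>\<sigma> i a\<close> must vanish too, and embeddings are injective.\<close>

lemma ot_action_free:
  assumes "u \<in> U" "p \<in> ot_domain" "ot_action \<sigma> \<tau> (u, a) p = p"
  shows "u = 1 \<and> a = 0"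
proof -
  obtain w z where p: "p = (w, z)" by (cases p)
  fix i :: 's
  have e: "\<sigma> i u * w $ i + \<sigma> i a = w $ i" and w: "Im (w $ i) > 0"
    using assms unfolding p ot_action_def ot_domain_def by (auto simp: vec_eq_iff)
  have "Re (\<sigma> i u) * Im (w $ i) = Im (w $ i)" using arg_cong[OF e, of Im] by simp
  then have "\<sigma> i u = 1" using w by (simp add: complex_eq_iff)
  then have u: "u = 1" using \<sigma>_simps(11)[of i u 1] by (simp add: \<sigma>_simps(3))
  then have "\<sigma> i a = 0" using e by (simp add: \<sigma>_simps)
  then show ?thesis using u by (simp add: \<sigma>_simps)
qed

text \<open>Only isolation of 0 in the image lattice is used: logarithms turn quotients into
  differences, which makes the separation uniform. A unit with zero logarithm is 1 under a real
  embedding, hence 1.\<close>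

lemma U_discrete:
  obtains \<epsilon> where "\<epsilon> > 0" "\<And>u v. u \<in> U \<Longrightarrow> v \<in> U \<Longrightarrow> dist (log_embedding \<sigma> u) (log_embedding \<sigma> v) < \<epsilon> \<Longrightarrow> u = v"
proof -
  let ?L = "log_embedding \<sigma> ` U"
  have "discrete ?L" using adm unfolding admissible_def is_lattice_def by auto
  have l1: "log_embedding \<sigma> 1 = 0" by (simp add: log_embedding_def vec_eq_iff \<sigma>_simps)
  then have "0 \<in> ?L" using U_one by force
  then obtain T where T: "open T" "T \<inter> ?L = {0}"
    using \<open>discrete ?L\<close> unfolding discrete_def isolated_in_def by blast
  then obtain \<epsilon> where \<epsilon>: "\<epsilon> > 0" "ball 0 \<epsilon> \<subseteq> T" using open_contains_ball by (metis Int_iff insertI1)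
  show thesis
  proof (rule that[OF \<epsilon>(1)])
    fix u v assume uv: "u \<in> U" "v \<in> U" "dist (log_embedding \<sigma> u) (log_embedding \<sigma> v) < \<epsilon>"
    let ?w = "u * inverse v"
    have w: "?w \<in> U" using uv U_mult U_inverse by auto
    have re: "Re (\<sigma> i ?w) = Re (\<sigma> i u) / Re (\<sigma> i v)" for i
    proof -
      have "\<sigma> i x = of_real (Re (\<sigma> i x))" for x using \<sigma>_real by (simp add: complex_eq_iff)
      then have "\<sigma> i ?w = of_real (Re (\<sigma> i u) / Re (\<sigma> i v))"
        by (metis \<sigma>_simps(2,12) divide_inverse of_real_inverse of_real_mult)
      then show ?thesis by simp
    qed
    have "log_embedding \<sigma> ?w = log_embedding \<sigma> u - log_embedding \<sigma> v"
      using U_pos[OF uv(1)] U_pos[OF uv(2)] by (simp add: log_embedding_def vec_eq_iff re ln_div less_imp_neq[THEN not_sym])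
    then have "log_embedding \<sigma> ?w \<in> T" using \<epsilon>(2) uv(3) by (auto simp: dist_norm)
    then have "log_embedding \<sigma> ?w \<in> T \<inter> ?L" using w by blast
    then have "log_embedding \<sigma> ?w = 0" using T by auto
    then have ln0: "ln (Re (\<sigma> i ?w)) = 0" for i by (simp add: log_embedding_def vec_eq_iff)
    have "Re (\<sigma> i ?w) = 1" for i using ln0[of i] U_pos[OF w, of i] by (metis exp_ln exp_zero)
    \<comment> \<open>Here \<open>undefined\<close> is just some index of the nonempty type
      \<open>'s\<close>.\<close>
    then have "\<sigma> undefined ?w = 1" by (simp add: complex_eq_iff)
    then have "?w = 1" using \<sigma>_simps(11)[of undefined ?w 1] by (simp add: \<sigma>_simps(3))
    then show "u = v" using U_nonzero[OF uv(2)] by (simp add: field_simps)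
  qed
qed

lemma open_ot_domain: "open (ot_domain :: ('s, 't) model set)"
proof -
  have "ot_domain = (\<Inter>i. {p :: ('s, 't) model. 0 < Im (fst p $ i)})" unfolding ot_domain_def by auto
  also have "open \<dots>"
  proof (intro open_INT ballI open_Collect_less continuous_on_const finite)
    fix i :: 's
    have "linear (\<lambda>p :: ('s, 't) model. Im (fst p $ i))" by (rule linearI) auto
    then show "continuous_on UNIV (\<lambda>p :: ('s, 't) model. Im (fst p $ i))" by (rule linear_continuous_on[OF linear_conv_bounded_linear[THEN iffD1]])
  qed
  finally show ?thesis .
qed

lemma convex_ot_domain: "convex (ot_domain :: ('s, 't) model set)"
proof (rule convexI)
  fix p q :: "('s, 't) model" and u v :: real
  assume pq: "p \<in> ot_domain" "q \<in> ot_domain" and uv: "0 \<le> u" "0 \<le> v" "u + v = 1"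
  have "0 < u * Im (fst p $ i) + v * Im (fst q $ i)" for i
  proof -
    have "0 < Im (fst p $ i)" "0 < Im (fst q $ i)" using pq unfolding ot_domain_def by auto
    then show ?thesis using uv by (cases "u = 0") (auto intro!: add_pos_nonneg)
  qed
  then show "u *\<^sub>R p + v *\<^sub>R q \<in> ot_domain" unfolding ot_domain_def by (simp add: case_prod_unfold)
qed

end

lemma LIMSEQ_if_dist_less_inverse:
  fixes f :: "nat \<Rightarrow> 'a::metric_space"
  assumes "\<And>n. dist (f n) l < inverse (real (Suc n))"
  shows "f \<longlonglongrightarrow> l"
  unfolding tendsto_dist_iff[of f]
  by (rule Lim_null_comparison[OF _ LIMSEQ_inverse_real_of_nat]) (simp del: of_nat_Suc add: always_eventually less_imp_le[OF assms])

context ot_data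
begin

text \<open>Otherwise there are points \<open>x n\<close> tending to \<open>p\<close> whose images
  under group elements tend to \<open>p'\<close>, although none of these elements sends
  \<open>p\<close> to \<open>p'\<close>. Discreteness of the logarithms makes the units
  \<open>u n\<close> eventually constant, then discreteness of O_K does the same for the
  \<open>a n\<close>, and continuity gives a contradiction.\<close>

lemma ot_action_pd:
  assumes p: "p \<in> ot_domain" "p' \<in> ot_domain"
  shows "\<exists>V V'. open V \<and> open V' \<and> p \<in> V \<and> p' \<in> V' \<and> V \<subseteq> ot_domain \<and> V' \<subseteq> ot_domain \<and>
       (\<forall>g\<in>carrier (ot_group U). ot_action \<sigma> \<tau> g ` V \<inter> V' \<noteq> {} \<longrightarrow> ot_action \<sigma> \<tau> g p = p')"
proof (rule ccontr)
  assume neg: "\<not> ?thesis"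
  have "\<exists>u a x. u \<in> U \<and> algebraic_int a \<and> x \<in> ot_domain \<and> ot_action \<sigma> \<tau> (u, a) x \<in> ot_domain \<and>
      dist x p < inverse (real (Suc n)) \<and> dist (ot_action \<sigma> \<tau> (u, a) x) p' < inverse (real (Suc n)) \<and>
      ot_action \<sigma> \<tau> (u, a) p \<noteq> p'" for n
  proof -
    define V where "V = (\<lambda>p :: ('s, 't) model. ball p (inverse (real (Suc n))) \<inter> ot_domain)"
    have V: "open (V q)" "q \<in> ot_domain \<Longrightarrow> q \<in> V q" "V q \<subseteq> ot_domain" for q
      unfolding V_def using open_ot_domain by auto
    have "\<not> (\<forall>g\<in>carrier (ot_group U). ot_action \<sigma> \<tau> g ` V p \<inter> V p' \<noteq> {} \<longrightarrow> ot_action \<sigma> \<tau> g p = p')"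
      using neg V p by metis
    then obtain g x where g: "g \<in> carrier (ot_group U)" "x \<in> V p" "ot_action \<sigma> \<tau> g x \<in> V p'" "ot_action \<sigma> \<tau> g p \<noteq> p'"
      by blast
    then obtain u a where "g = (u, a)" "u \<in> U" "algebraic_int a" by (auto simp: ot_group_def)
    then show ?thesis using g unfolding V_def
      by (intro exI[of _ u] exI[of _ a] exI[of _ x]) (simp add: dist_commute)
  qed
  then obtain u a x where ux: "\<And>n. u n \<in> U" "\<And>n. algebraic_int (a n)" "\<And>n. x n \<in> ot_domain"
     "\<And>n. ot_action \<sigma> \<tau> (u n, a n) (x n) \<in> ot_domain" "\<And>n. dist (x n) p < inverse (real (Suc n))"
     "\<And>n. dist (ot_action \<sigma> \<tau> (u n, a n) (x n)) p' < inverse (real (Suc n))"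
     "\<And>n. ot_action \<sigma> \<tau> (u n, a n) p \<noteq> p'"
    by metis
  define y where "y = (\<lambda>n. ot_action \<sigma> \<tau> (u n, a n) (x n))"
  have x: "x \<longlonglongrightarrow> p" by (rule LIMSEQ_if_dist_less_inverse[OF ux(5)])
  have y: "y \<longlonglongrightarrow> p'" unfolding y_def by (rule LIMSEQ_if_dist_less_inverse[OF ux(6)])
  have pos: "Im (fst q $ i) > 0" if "q \<in> ot_domain" for q :: "('s, 't) model" and i
    using that unfolding ot_domain_def by auto
  \<comment> \<open>Translations are real in the half-plane coordinates, so imaginary parts see only
    the unit, and their limits control it.\<close>
  have Re_u: "Re (\<sigma> i (u n)) = Im (fst (y n) $ i) / Im (fst (x n) $ i)" for i n
    using pos[OF ux(3), of n i] unfolding y_def ot_action_eq by (simp add: emb_vec_def)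
  define l where "l = (\<chi> i. ln (Im (fst p' $ i) / Im (fst p $ i)))"
  have log: "(\<lambda>n. log_embedding \<sigma> (u n)) \<longlonglongrightarrow> l"
  proof (rule vec_tendstoI)
    fix i
    have "(\<lambda>n. Im (fst (y n) $ i) / Im (fst (x n) $ i)) \<longlonglongrightarrow> Im (fst p' $ i) / Im (fst p $ i)"
      using pos[OF p(1), of i] by (intro tendsto_intros x y) auto
    then have "(\<lambda>n. ln (Im (fst (y n) $ i) / Im (fst (x n) $ i))) \<longlonglongrightarrow> ln (Im (fst p' $ i) / Im (fst p $ i))"
      using pos[OF p(1), of i] pos[OF p(2), of i] by (intro tendsto_ln) auto
    then show "(\<lambda>n. log_embedding \<sigma> (u n) $ i) \<longlonglongrightarrow> l $ i"
      unfolding log_embedding_def l_def by (simp add: Re_u)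
  qed
  obtain \<epsilon> where \<epsilon>: "\<epsilon> > 0" "\<And>u v. u \<in> U \<Longrightarrow> v \<in> U \<Longrightarrow> dist (log_embedding \<sigma> u) (log_embedding \<sigma> v) < \<epsilon> \<Longrightarrow> u = v"
    using U_discrete by blast
  obtain N where "\<And>m n. m \<ge> N \<Longrightarrow> n \<ge> N \<Longrightarrow> dist (log_embedding \<sigma> (u m)) (log_embedding \<sigma> (u n)) < \<epsilon>"
    using metric_CauchyD[OF LIMSEQ_imp_Cauchy[OF log] \<epsilon>(1)] by blast
  then have uN: "u n = u N" if "n \<ge> N" for n using \<epsilon>(2)[OF ux(1) ux(1)] that by blast
  define A where "A = (\<lambda>q :: ('s, 't) model. (\<chi> i. \<sigma> i (u N) * fst q $ i, \<chi> j. \<tau> j (u N) * snd q $ j) :: ('s, 't) model)"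
  \<comment> \<open>Once the unit is frozen, the translation part is a difference of convergent
    sequences.\<close>
  have ya: "emb_vec \<sigma> \<tau> (a n) = y n - A (x n)" if "n \<ge> N" for n
    unfolding y_def ot_action_eq A_def uN[OF that] by simp
  have "(\<lambda>n. y n - A (x n)) \<longlonglongrightarrow> p' - A p"
    unfolding A_def by (intro tendsto_intros x y bounded_linear.tendsto[OF linear_coord_scale])
  then have "Cauchy (\<lambda>n. y n - A (x n))" by (rule LIMSEQ_imp_Cauchy)
  then obtain M where M: "\<And>m n. m \<ge> M \<Longrightarrow> n \<ge> M \<Longrightarrow> dist (y m - A (x m)) (y n - A (x n)) < 1"
    using metric_CauchyD[of "\<lambda>n. y n - A (x n)" 1] by auto
  define K where "K = max M N"
  have aK: "a n = a K" if "n \<ge> K" for n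
  proof -
    have "norm (emb_vec \<sigma> \<tau> (a n) - emb_vec \<sigma> \<tau> (a K)) < 1"
      using M[of n K] ya[of n] ya[of K] that unfolding K_def by (simp add: dist_norm)
    moreover have "emb_vec \<sigma> \<tau> (a n) - emb_vec \<sigma> \<tau> (a K) = emb_vec \<sigma> \<tau> (a n - a K)"
      by (simp add: emb_vec_def vec_eq_iff \<sigma>_simps \<tau>_simps)
    ultimately show ?thesis
      using algebraic_int_eq_0_if_norm_emb_vec_less[of "a n - a K"] algebraic_int_diff[OF ux(2) ux(2), of n K] by simp
  qed
  have yK: "y n = ot_action \<sigma> \<tau> (u K, a K) (x n)" if "n \<ge> K" for n
    using aK[OF that] uN[of n] uN[of K] that unfolding y_def K_def by simp
  have "isCont (ot_action \<sigma> \<tau> (u K, a K)) p"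
    using has_derivative_continuous[OF ot_action_has_derivative] by blast
  then have "(\<lambda>n. ot_action \<sigma> \<tau> (u K, a K) (x n)) \<longlonglongrightarrow> ot_action \<sigma> \<tau> (u K, a K) p"
    using x by (rule isCont_tendsto_compose)
  moreover have "\<forall>\<^sub>F n in sequentially. ot_action \<sigma> \<tau> (u K, a K) (x n) = y n"
    using yK by (auto simp: eventually_sequentially intro!: exI[of _ K])
  ultimately have "y \<longlonglongrightarrow> ot_action \<sigma> \<tau> (u K, a K) p" by (rule Lim_transform_eventually)
  then show False using ux(7)[of K] LIMSEQ_unique y by blast
qed

lemma pd_action_ot: "pd_action (ot_group U) (ot_action \<sigma> \<tau>) ot_domain"
proof (intro pd_action.intro pd_action_axioms.intro group_ot)
  fix g h p assume g: "g \<in> carrier (ot_group U)" and h: "h \<in> carrier (ot_group U)" and p: "(p :: ('s, 't) model) \<in> ot_domain"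
  show "ot_action \<sigma> \<tau> (g \<otimes>\<^bsub>ot_group U\<^esub> h) p = ot_action \<sigma> \<tau> g (ot_action \<sigma> \<tau> h p)"
    by (cases g, cases h) (simp add: ot_group_def ot_action_mult)
next
  fix g p assume g: "g \<in> carrier (ot_group U)" and p: "(p :: ('s, 't) model) \<in> ot_domain"
  show "ot_action \<sigma> \<tau> g p \<in> ot_domain" using g p ot_action_domain[of "fst g" p "snd g"] by (auto simp: ot_group_def)
  assume "ot_action \<sigma> \<tau> g p = p"
  then show "g = \<one>\<^bsub>ot_group U\<^esub>" using g p ot_action_free[of "fst g" p "snd g"] by (auto simp: ot_group_def prod_eq_iff)
next
  fix g assume "g \<in> carrier (ot_group U)"
  show "continuous_on (ot_domain :: ('s, 't) model set) (ot_action \<sigma> \<tau> g)"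
    using ot_action_has_derivative[of "fst g" "snd g"] unfolding continuous_on_eq_continuous_within
    by (auto intro!: has_derivative_continuous)
next
  fix p p' :: "('s, 't) model" assume "p \<in> ot_domain" "p' \<in> ot_domain"
  then show "\<exists>V V'. open V \<and> open V' \<and> p \<in> V \<and> p' \<in> V' \<and> V \<subseteq> ot_domain \<and> V' \<subseteq> ot_domain \<and>
       (\<forall>g\<in>carrier (ot_group U). ot_action \<sigma> \<tau> g ` V \<inter> V' \<noteq> {} \<longrightarrow> ot_action \<sigma> \<tau> g p = p')"
    by (rule ot_action_pd)
next
  fix p :: "('s, 't) model"
  show "ot_action \<sigma> \<tau> \<one>\<^bsub>ot_group U\<^esub> p = p" by (simp add: ot_group_def ot_action_one)
qed (rule open_ot_domain)

end

sublocale ot_data \<subseteq> ot: pd_action "ot_group U" "ot_action \<sigma> \<tau>" ot_domain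
  by (rule pd_action_ot)

section \<open>The quotient as a complex manifold\<close>

context ot_data
begin

lemma ot_proj_eq: "ot_proj \<sigma> U \<tau> = ot.proj" by (simp add: ot_proj_def)

definition charts :: "(('s, 't) model set set \<times> (('s, 't) model set \<Rightarrow> ('s, 't) model)) set" where
  "charts = {(ot.proj ` W, inv_into W ot.proj) | W. open W \<and> W \<subseteq> ot_domain \<and> inj_on ot.proj W}"

lemma ot_manifold_eq: "ot_manifold \<sigma> U \<tau> = (ot.orbit_space, charts)"
  unfolding ot_manifold_def charts_def ot_proj_eq ..

lemma topspace_ot_manifold: "topspace (fst (ot_manifold \<sigma> U \<tau>)) = ot_proj \<sigma> U \<tau> ` ot_domain"
  by (simp add: ot_manifold_eq ot_proj_eq ot.topspace_orbit_space)

lemma chart_image: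
  assumes "inj_on ot.proj W"
  shows "inv_into W ot.proj ` (ot.proj ` W) = W"
    "x \<in> W \<Longrightarrow> inv_into (ot.proj ` W) (inv_into W ot.proj) x = ot.proj x"
proof -
  show 1: "inv_into W ot.proj ` (ot.proj ` W) = W" using assms by force
  assume x: "x \<in> W"
  have "inj_on (inv_into W ot.proj) (ot.proj ` W)" by (rule inj_on_inv_into) simp
  moreover have "inv_into W ot.proj (ot.proj x) = x" using assms x by simp
  ultimately show "inv_into (ot.proj ` W) (inv_into W ot.proj) x = ot.proj x"
    using x by (metis imageI inv_into_f_f)
qed

text \<open>Charts invert the projection on different slices, so near a point two of them differ by
  the one group element that carries the point into the other slice. This makes transition maps
  holomorphic.\<close>

lemma local_lift:
  assumes W': "open W'" "W' \<subseteq> ot_domain" "inj_on ot.proj W'" and x: "x \<in> ot_domain" "ot.proj x \<in> ot.proj ` W'"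
  obtains g N where "g \<in> carrier (ot_group U)" "open N" "x \<in> N" "N \<subseteq> ot_domain"
    "\<And>y. y \<in> N \<Longrightarrow> inv_into W' ot.proj (ot.proj y) = ot_action \<sigma> \<tau> g y"
proof -
  obtain x' where x': "x' \<in> W'" "ot.proj x = ot.proj x'" using x(2) by auto
  then obtain g where g: "g \<in> carrier (ot_group U)" "x' = ot_action \<sigma> \<tau> g x"
    using ot.proj_eq_iff[of x x'] x W' by blast
  define N where "N = ot_domain \<inter> ot_action \<sigma> \<tau> g -` W'"
  show thesis
  proof (rule that[OF g(1), of N])
    show "open N" unfolding N_def by (rule continuous_open_preimage[OF ot.act_cont[OF g(1)] open_ot_domain W'(1)])
    show "x \<in> N" unfolding N_def using x x' g by auto
    show "N \<subseteq> ot_domain" unfolding N_def by auto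
    fix y assume y: "y \<in> N"
    then have "ot.proj y = ot.proj (ot_action \<sigma> \<tau> g y)" using ot.proj_act[OF g(1)] unfolding N_def by auto
    then show "inv_into W' ot.proj (ot.proj y) = ot_action \<sigma> \<tau> g y"
      using y W'(3) unfolding N_def by auto
  qed
qed

lemma complex_manifold_ot: "complex_manifold (ot_manifold \<sigma> U \<tau>)"
  unfolding ot_manifold_eq complex_manifold_def case_prod_conv
proof (intro conjI ballI)
  show "Hausdorff_space ot.orbit_space" by (rule ot.Hausdorff_orbit_space)
  show "second_countable ot.orbit_space" by (rule ot.second_countable_orbit_space)
  show "\<Union> (fst ` charts) = topspace ot.orbit_space"
    unfolding ot.topspace_orbit_space
  proof (intro equalityI subsetI)
    fix z assume "z \<in> ot.proj ` ot_domain"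
    then obtain p where p: "p \<in> ot_domain" "z = ot.proj p" by auto
    show "z \<in> \<Union> (fst ` charts)"
    proof (rule ot.ex_slice[OF p(1)])
      fix W assume "open W" "p \<in> W" "W \<subseteq> ot_domain" "inj_on ot.proj W"
      then have "(ot.proj ` W, inv_into W ot.proj) \<in> charts" "z \<in> ot.proj ` W" unfolding charts_def using p by auto
      then show ?thesis by force
    qed
  qed (auto simp: charts_def)
next
  fix c assume "c \<in> charts"
  then obtain W where c: "c = (ot.proj ` W, inv_into W ot.proj)" and W: "open W" "W \<subseteq> ot_domain" "inj_on ot.proj W"
    unfolding charts_def by auto
  show "case c of (D, \<phi>) \<Rightarrow> openin ot.orbit_space D \<and> open (\<phi> ` D) \<and>
      homeomorphic_map (subtopology ot.orbit_space D) (top_of_set (\<phi> ` D)) \<phi>"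
    using ot.openin_proj_image[OF W(2,1)] W(1) ot.homeomorphic_map_inv_proj[OF W]
    unfolding c by (simp add: chart_image[OF W(3)])
  have "holomorphic_map_on (inv_into W' ot.proj \<circ> inv_into (ot.proj ` W) (inv_into W ot.proj))
      (inv_into W ot.proj ` (ot.proj ` W \<inter> ot.proj ` W'))"
    if W': "open W'" "W' \<subseteq> ot_domain" "inj_on ot.proj W'" for W'
    unfolding holomorphic_map_on_iff
  proof
    fix x assume "x \<in> inv_into W ot.proj ` (ot.proj ` W \<inter> ot.proj ` W')"
    then obtain v where v: "v \<in> W" "ot.proj v \<in> ot.proj ` W'" "x = inv_into W ot.proj (ot.proj v)" by blast
    have "inv_into W ot.proj (ot.proj v) = v" using W(3) v(1) by simp
    then have x: "x \<in> W" "ot.proj x \<in> ot.proj ` W'" using v by auto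
    then obtain g N where g: "g \<in> carrier (ot_group U)" "open N" "x \<in> N" "N \<subseteq> ot_domain"
      "\<And>y. y \<in> N \<Longrightarrow> inv_into W' ot.proj (ot.proj y) = ot_action \<sigma> \<tau> g y"
      using local_lift[OF W', of x] W(2) by blast
    show "holo_at (inv_into W' ot.proj \<circ> inv_into (ot.proj ` W) (inv_into W ot.proj)) x"
      by (rule holo_at_cong[OF holo_at_ot_action[of g], of "W \<inter> N"])
        (use g x W in \<open>auto simp: chart_image(2)[OF W(3)]\<close>)
  qed
  then have "\<forall>c'\<in>charts. holomorphic_map_on (snd c' \<circ> inv_into (ot.proj ` W) (inv_into W ot.proj))
      (inv_into W ot.proj ` (ot.proj ` W \<inter> fst c'))" unfolding charts_def by auto
  then show "case c of (D, \<phi>) \<Rightarrow> \<forall>(D', \<psi>)\<in>charts. holomorphic_map_on (\<psi> \<circ> inv_into D \<phi>) (\<phi> ` (D \<inter> D'))"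
    unfolding c by (auto simp: case_prod_unfold)
qed

end

section \<open>Descent and lifting of holomorphic maps\<close>

lemma holomorphic_between_descend:
  fixes \<sigma> :: "'s::finite \<Rightarrow> 'k::field_char_0 \<Rightarrow> complex" and \<tau> \<tau>' :: "'t::finite \<Rightarrow> 'k \<Rightarrow> complex"
  assumes A: "ot_data \<sigma> \<tau> U" and B: "ot_data \<sigma> \<tau>' U"
    and F: "\<And>p. p \<in> ot_domain \<Longrightarrow> F p \<in> ot_domain" "\<And>p. p \<in> ot_domain \<Longrightarrow> holo_at F p"
    and FF: "\<And>p p'. p \<in> ot_domain \<Longrightarrow> p' \<in> ot_domain \<Longrightarrow> ot_proj \<sigma> U \<tau> p = ot_proj \<sigma> U \<tau> p' \<Longrightarrow>
        ot_proj \<sigma> U \<tau>' (F p) = ot_proj \<sigma> U \<tau>' (F p')"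
  obtains f where "holomorphic_between (ot_manifold \<sigma> U \<tau>) (ot_manifold \<sigma> U \<tau>') f"
    "\<And>p. p \<in> ot_domain \<Longrightarrow> f (ot_proj \<sigma> U \<tau> p) = ot_proj \<sigma> U \<tau>' (F p)"
proof -
  interpret A: ot_data \<sigma> \<tau> U by fact
  interpret B: ot_data \<sigma> \<tau>' U by fact
  note FF = FF[unfolded A.ot_proj_eq B.ot_proj_eq]
  \<comment> \<open>A representative of the orbit is chosen arbitrarily; the assumption on
    \<open>F\<close> makes the result independent of it.\<close>
  define f where "f = (\<lambda>x. B.ot.proj (F (inv_into ot_domain A.ot.proj x)))"
  have f: "f (A.ot.proj p) = B.ot.proj (F p)" if p: "p \<in> ot_domain" for p
  proof -
    have "inv_into ot_domain A.ot.proj (A.ot.proj p) \<in> ot_domain"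
      "A.ot.proj (inv_into ot_domain A.ot.proj (A.ot.proj p)) = A.ot.proj p"
      using p by (simp_all add: inv_into_into f_inv_into_f)
    then show ?thesis unfolding f_def using FF p by blast
  qed
  have contF: "continuous_on ot_domain F"
    using F(2) unfolding holo_at_def
    by (meson continuous_at_imp_continuous_on has_derivative_continuous)
  have "continuous_map (top_of_set ot_domain) B.ot.orbit_space (B.ot.proj \<circ> F)"
    by (rule continuous_map_compose[OF _ B.ot.continuous_map_proj]) (use contF F(1) in auto)
  then have "continuous_map (top_of_set ot_domain) B.ot.orbit_space (f \<circ> A.ot.proj)"
    by (rule continuous_map_eq) (simp add: f)
  then have cont: "continuous_map A.ot.orbit_space B.ot.orbit_space f"
    using continuous_compose_quotient_map[OF quotient_map_quotient_topology] by blast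
  have "holomorphic_map_on (inv_into W' B.ot.proj \<circ> f \<circ> inv_into (A.ot.proj ` W) (inv_into W A.ot.proj))
      (inv_into W A.ot.proj ` (A.ot.proj ` W \<inter> f -` (B.ot.proj ` W')))"
    if W: "open W" "W \<subseteq> ot_domain" "inj_on A.ot.proj W" and W': "open W'" "W' \<subseteq> ot_domain" "inj_on B.ot.proj W'" for W W'
    unfolding holomorphic_map_on_iff
  proof
    fix x assume "x \<in> inv_into W A.ot.proj ` (A.ot.proj ` W \<inter> f -` (B.ot.proj ` W'))"
    then obtain v where v: "v \<in> W" "f (A.ot.proj v) \<in> B.ot.proj ` W'" "x = inv_into W A.ot.proj (A.ot.proj v)" by blast
    have "inv_into W A.ot.proj (A.ot.proj v) = v" using W(3) v(1) by simp
    then have x: "x \<in> W" "f (A.ot.proj x) \<in> B.ot.proj ` W'" using v by auto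
    have xd: "x \<in> ot_domain" using x W by auto
    have "B.ot.proj (F x) \<in> B.ot.proj ` W'" using x f[OF xd] by simp
    then obtain g N where g: "g \<in> carrier (ot_group U)" "open N" "F x \<in> N" "N \<subseteq> ot_domain"
      "\<And>y. y \<in> N \<Longrightarrow> inv_into W' B.ot.proj (B.ot.proj y) = ot_action \<sigma> \<tau>' g y"
      using B.local_lift[OF W' F(1)[OF xd]] by blast
    \<comment> \<open>In charts the descended map is \<open>F\<close> followed by the group element
      that moves its value into the slice \<open>W'\<close>.\<close>
    show "holo_at (inv_into W' B.ot.proj \<circ> f \<circ> inv_into (A.ot.proj ` W) (inv_into W A.ot.proj)) x"
    proof (rule holo_at_cong[OF holo_at_compose[OF F(2)[OF xd] B.holo_at_ot_action[of g]]])
      show "open (W \<inter> (ot_domain \<inter> F -` N))"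
        by (intro open_Int W continuous_open_preimage[OF contF A.open_ot_domain g(2)])
      show "x \<in> W \<inter> (ot_domain \<inter> F -` N)" using x xd g by auto
      fix y assume y: "y \<in> W \<inter> (ot_domain \<inter> F -` N)"
      then show "(ot_action \<sigma> \<tau>' g \<circ> F) y = (inv_into W' B.ot.proj \<circ> f \<circ> inv_into (A.ot.proj ` W) (inv_into W A.ot.proj)) y"
        using g(5)[of "F y"] f[of y] by (simp add: A.chart_image(2)[OF W(3)])
    qed
  qed
  then have "holomorphic_between (ot_manifold \<sigma> U \<tau>) (ot_manifold \<sigma> U \<tau>') f"
    unfolding A.ot_manifold_eq B.ot_manifold_eq holomorphic_between_def A.charts_def B.charts_def
    using cont by auto
  then show thesis using that f unfolding A.ot_proj_eq B.ot_proj_eq by blast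
qed

text \<open>A continuous lift exists because the convex domain is simply connected. Holomorphy is
  local: between slices around \<open>p\<close> and \<open>F p\<close> the lift coincides with the
  expression of \<open>f\<close> in the corresponding charts.\<close>

lemma holomorphic_between_lift:
  fixes \<sigma> :: "'s::finite \<Rightarrow> 'k::field_char_0 \<Rightarrow> complex" and \<tau> \<tau>' :: "'t::finite \<Rightarrow> 'k \<Rightarrow> complex"
  assumes A: "ot_data \<sigma> \<tau> U" and B: "ot_data \<sigma> \<tau>' U"
    and f: "holomorphic_between (ot_manifold \<sigma> U \<tau>) (ot_manifold \<sigma> U \<tau>') f"
  obtains F where "\<And>p. p \<in> ot_domain \<Longrightarrow> F p \<in> ot_domain" "\<And>p. p \<in> ot_domain \<Longrightarrow> holo_at F p"
    "continuous_on ot_domain F"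
    "\<And>p. p \<in> ot_domain \<Longrightarrow> ot_proj \<sigma> U \<tau>' (F p) = f (ot_proj \<sigma> U \<tau> p)"
proof -
  interpret A: ot_data \<sigma> \<tau> U by fact
  interpret B: ot_data \<sigma> \<tau>' U by fact
  have cont: "continuous_map A.ot.orbit_space B.ot.orbit_space f"
    and hol: "\<And>W W'. open W \<Longrightarrow> W \<subseteq> ot_domain \<Longrightarrow> inj_on A.ot.proj W \<Longrightarrow> open W' \<Longrightarrow> W' \<subseteq> ot_domain \<Longrightarrow> inj_on B.ot.proj W' \<Longrightarrow>
     holomorphic_map_on (inv_into W' B.ot.proj \<circ> f \<circ> inv_into (A.ot.proj ` W) (inv_into W A.ot.proj))
      (inv_into W A.ot.proj ` (A.ot.proj ` W \<inter> f -` (B.ot.proj ` W')))"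
    using f unfolding A.ot_manifold_eq B.ot_manifold_eq holomorphic_between_def A.charts_def B.charts_def
    by (simp, simp, blast)
  have sc: "simply_connected (ot_domain :: ('s, 't) model set)" "locally path_connected (ot_domain :: ('s, 't) model set)"
    by (rule convex_imp_simply_connected[OF A.convex_ot_domain], rule convex_imp_locally_path_connected[OF A.convex_ot_domain])
  obtain F where F: "continuous_on ot_domain F" "F \<in> ot_domain \<rightarrow> ot_domain"
    "\<And>p. p \<in> ot_domain \<Longrightarrow> B.ot.proj (F p) = f (A.ot.proj p)"
    using B.ot.ex_lift[OF continuous_map_compose[OF A.ot.continuous_map_proj cont] sc] by auto
  have "holo_at F p" if p: "p \<in> ot_domain" for p
  proof -
    obtain W where W: "open W" "p \<in> W" "W \<subseteq> ot_domain" "inj_on A.ot.proj W" by (rule A.ot.ex_slice[OF p])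
    have Fp: "F p \<in> ot_domain" using F p by auto
    obtain W' where W': "open W'" "F p \<in> W'" "W' \<subseteq> ot_domain" "inj_on B.ot.proj W'" by (rule B.ot.ex_slice[OF Fp])
    have "A.ot.proj p \<in> A.ot.proj ` W \<inter> f -` (B.ot.proj ` W')" using W(2) W'(2) F(3)[OF p] by (metis IntI imageI vimageI)
    then have "p \<in> inv_into W A.ot.proj ` (A.ot.proj ` W \<inter> f -` (B.ot.proj ` W'))"
      using W by (metis imageI inv_into_f_f)
    then have h: "holo_at (inv_into W' B.ot.proj \<circ> f \<circ> inv_into (A.ot.proj ` W) (inv_into W A.ot.proj)) p"
      using hol[OF W(1,3,4) W'(1,3,4)] unfolding holomorphic_map_on_iff by blast
    show ?thesis
    proof (rule holo_at_cong[OF h])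
      show "open (W \<inter> (ot_domain \<inter> F -` W'))"
        by (intro open_Int W continuous_open_preimage[OF F(1) A.open_ot_domain W'(1)])
      show "p \<in> W \<inter> (ot_domain \<inter> F -` W')" using p W W' by auto
      fix y assume y: "y \<in> W \<inter> (ot_domain \<inter> F -` W')"
      then show "(inv_into W' B.ot.proj \<circ> f \<circ> inv_into (A.ot.proj ` W) (inv_into W A.ot.proj)) y = F y"
        using W' F(3)[of y] by (simp add: A.chart_image(2)[OF W(4)]) (metis inv_into_f_f)
    qed
  qed
  then show thesis using that[of F] F unfolding A.ot_proj_eq B.ot_proj_eq by auto
qed

section \<open>The lattice of integers\<close>

text \<open>Evaluating the relation at \<open>y * x\<close> and subtracting \<open>E k y\<close>
  times the relation at \<open>x\<close> removes the term of \<open>k\<close>; choosing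
  \<open>y\<close> where \<open>E k\<close> and \<open>E j\<close> differ keeps the term of
  \<open>j\<close> visible.\<close>

lemma Dedekind_independent:
  fixes E :: "'i \<Rightarrow> 'k::field_char_0 \<Rightarrow> complex"
  assumes "finite I" "inj_on E I" "\<And>i. i \<in> I \<Longrightarrow> hom_on UNIV (E i)" "\<And>x. (\<Sum>i\<in>I. c i * E i x) = 0" "i \<in> I"
  shows "c i = 0"
  using assms
proof (induction I arbitrary: c i rule: finite_induct)
  case (insert k I)
  note hom = insert.prems(2)
  have s: "c k * E k x + (\<Sum>i\<in>I. c i * E i x) = 0" for x using insert.prems(3)[of x] insert.hyps by simp
  have zero: "c j = 0" if j: "j \<in> I" for j
  proof -
    have "E k \<noteq> E j" using insert.prems(1) insert.hyps j by (auto simp: inj_on_def)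
    then obtain y where y: "E k y \<noteq> E j y" by auto
    have "c j * (E j y - E k y) = 0"
    proof (rule insert.IH[of "\<lambda>i. c i * (E i y - E k y)"])
      show "inj_on E I" using insert.prems(1) by auto
      show "hom_on UNIV (E i)" if "i \<in> I" for i using hom that by auto
      fix x
      have "(\<Sum>i\<in>I. c i * (E i y - E k y) * E i x) = (\<Sum>i\<in>I. c i * E i (y * x)) - E k y * (\<Sum>i\<in>I. c i * E i x)"
        unfolding sum_distrib_left sum_subtractf[symmetric]
        by (rule sum.cong) (use hom in \<open>auto simp: hom_on_UNIV_simps(2) algebra_simps\<close>)
      also have "(\<Sum>i\<in>I. c i * E i (y * x)) = - (c k * E k y * E k x)"
        using s[of "y * x"] hom by (simp add: hom_on_UNIV_simps(2) eq_neg_iff_add_eq_0 algebra_simps)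
      also have "(\<Sum>i\<in>I. c i * E i x) = - (c k * E k x)"
        using s[of x] by (simp add: eq_neg_iff_add_eq_0 algebra_simps)
      finally show "(\<Sum>i\<in>I. c i * (E i y - E k y) * E i x) = 0" by simp
    qed (fact j)
    then show ?thesis using y by simp
  qed
  have "c k * E k 1 = 0" using s[of 1] zero by simp
  then have "c k = 0" using hom[of k] by (simp add: hom_on_UNIV_simps(3))
  then show ?case using zero insert.prems by auto
qed auto

lemma ex_denominator:
  fixes x :: "'k::field_char_0"
  assumes "algebraic x"
  obtains N :: nat where "N > 0" "algebraic_int (of_nat N * x)"
proof -
  obtain p where p: "\<forall>i. Polynomial.coeff p i \<in> \<int>" "p \<noteq> 0" "poly p x = 0"
    using assms unfolding algebraic_def by blast
  let ?n = "Polynomial.degree p" and ?c = "Polynomial.lead_coeff p"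
  have n: "?n > 0" using p(2,3) by (metis degree_0_id gr0I poly_const_conv pCons_0_0)
  \<comment> \<open>With c the leading coefficient and n the degree, this is \<open>p\<close>
    multiplied by \<open>c ^ (n - 1)\<close> and rewritten as a polynomial in \<open>c * x\<close>,
    which makes it monic.\<close>
  define q where "q = Polynomial.monom 1 ?n + (\<Sum>i<?n. Polynomial.monom (Polynomial.coeff p i * ?c ^ (?n - 1 - i)) i)"
  have cq: "Polynomial.coeff q i = (if i = ?n then 1 else if i < ?n then Polynomial.coeff p i * ?c ^ (?n - 1 - i) else 0)" for i
    unfolding q_def by (simp add: coeff_sum coeff_monom)
  have dq: "Polynomial.degree q = ?n"
  proof (rule antisym)
    show "Polynomial.degree q \<le> ?n" by (rule degree_le) (simp add: cq)
    show "?n \<le> Polynomial.degree q" by (rule le_degree) (simp add: cq)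
  qed
  have "poly q (?c * x) = (?c * x) ^ ?n + (\<Sum>i<?n. Polynomial.coeff p i * ?c ^ (?n - 1 - i) * (?c * x) ^ i)"
    unfolding q_def by (simp add: poly_monom poly_sum)
  also have "(\<Sum>i<?n. Polynomial.coeff p i * ?c ^ (?n - 1 - i) * (?c * x) ^ i) = ?c ^ (?n - 1) * (\<Sum>i<?n. Polynomial.coeff p i * x ^ i)"
    unfolding sum_distrib_left
  proof (rule sum.cong)
    fix i assume "i \<in> {..<?n}"
    then have "?c ^ (?n - 1) = ?c ^ (?n - 1 - i) * ?c ^ i" by (simp flip: power_add)
    then show "Polynomial.coeff p i * ?c ^ (?n - 1 - i) * (?c * x) ^ i = ?c ^ (?n - 1) * (Polynomial.coeff p i * x ^ i)"
      by (simp add: power_mult_distrib)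
  qed simp
  also have "(?c * x) ^ ?n = ?c ^ (?n - 1) * (?c * x ^ ?n)"
    unfolding power_mult_distrib power_minus_mult[OF n, of ?c, symmetric] by (simp only: mult.assoc)
  also have "?c ^ (?n - 1) * (?c * x ^ ?n) + ?c ^ (?n - 1) * (\<Sum>i<?n. Polynomial.coeff p i * x ^ i) = ?c ^ (?n - 1) * poly p x"
  proof -
    have "poly p x = ?c * x ^ ?n + (\<Sum>i<?n. Polynomial.coeff p i * x ^ i)"
      by (simp add: poly_altdef lessThan_Suc_atMost[symmetric])
    then show ?thesis by (simp only: distrib_left)
  qed
  finally have "poly q (?c * x) = 0" using p(3) by simp
  moreover have "\<forall>i. Polynomial.coeff q i \<in> \<int>" using p(1) by (auto simp: cq)
  ultimately have int: "algebraic_int (?c * x)" using dq cq by (intro algebraic_int.intros[of q]) auto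
  obtain m where m: "?c = of_int m" using p(1) by (auto elim: Ints_cases)
  then have "m \<noteq> 0" using p(2) by auto
  have "algebraic_int (of_nat (nat \<bar>m\<bar>) * x)"
  proof (cases "m > 0")
    case True
    then show ?thesis using int m by simp
  next
    case False
    then have "of_nat (nat \<bar>m\<bar>) * x = - (?c * x)" using m by simp
    then show ?thesis using int by simp
  qed
  then show thesis using that[of "nat \<bar>m\<bar>"] \<open>m \<noteq> 0\<close> by simp
qed

text \<open>The real subspace \<open>\<real>\<^sup>s \<times> \<complex>\<^sup>t\<close>, in which the ring of integers is a lattice.\<close>

definition real_part :: "('s::finite, 't::finite) model set" where
  "real_part = {v. \<forall>i. Im (fst v $ i) = 0}"

lemma subspace_real_part: "subspace (real_part :: ('s::finite, 't::finite) model set)"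
  by (rule subspaceI) (auto simp: real_part_def)

lemma real_part_domain: "p \<in> ot_domain \<Longrightarrow> v \<in> real_part \<Longrightarrow> p + v \<in> ot_domain"
  by (simp add: ot_domain_def real_part_def case_prod_unfold)

context ot_data
begin

text \<open>One index type for all embeddings, so that the independence of characters covers the
  conjugates of the \<open>\<tau> j\<close> as well.\<close>

definition all_emb :: "'s + 't + 't \<Rightarrow> 'k \<Rightarrow> complex" where
  "all_emb = case_sum \<sigma> (case_sum \<tau> (\<lambda>j. cnj \<circ> \<tau> j))"

lemma all_emb_hom: "hom_on UNIV (all_emb i)"
proof -
  have "hom_on UNIV (cnj \<circ> \<tau> j)" for j
    using \<tau>_simps[of j] unfolding hom_on_def by simp
  then show ?thesis unfolding all_emb_def using \<sigma>_hom \<tau>_hom by (auto split: sum.split)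
qed

lemma \<tau>_not_real: "\<not> range (\<tau> j) \<subseteq> \<real>" "\<not> range (cnj \<circ> \<tau> j) \<subseteq> \<real>"
proof -
  show 1: "\<not> range (\<tau> j) \<subseteq> \<real>" using range_\<tau> unfolding nonreal_embeddings_def by auto
  then obtain x where "\<tau> j x \<notin> \<real>" by auto
  then have "(cnj \<circ> \<tau> j) x \<notin> \<real>" by (metis comp_apply complex_cnj_cnj complex_cnj_complex_of_real Reals_cases Reals_of_real)
  then show "\<not> range (cnj \<circ> \<tau> j) \<subseteq> \<real>" by blast
qed

lemma inj_all_emb: "inj all_emb"
proof -
  have 1: "\<sigma> i \<noteq> \<tau> j" "\<sigma> i \<noteq> cnj \<circ> \<tau> j" for i j
    using \<tau>_not_real[of j] \<sigma>_real[of i] by (metis image_subset_iff)+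
  have 2: "\<tau> j \<noteq> cnj \<circ> \<tau> k" for j k
    using conj_notin[of k] unfolding conj_embedding_def by (metis rangeI)
  have 3: "cnj \<circ> \<tau> j = cnj \<circ> \<tau> k \<longleftrightarrow> j = k" for j k
  proof
    assume "cnj \<circ> \<tau> j = cnj \<circ> \<tau> k"
    then have "\<tau> j = \<tau> k" by (auto simp: fun_eq_iff)
    then show "j = k" using inj_\<tau> by (auto dest: injD)
  qed auto
  have 4: "\<sigma> i = \<sigma> k \<longleftrightarrow> i = k" for i k
    using bij_\<sigma> unfolding bij_betw_def by (auto dest: injD)
  have 5: "\<tau> i = \<tau> k \<longleftrightarrow> i = k" for i k using inj_\<tau> by (auto dest: injD)
  show ?thesis
  proof (rule injI)
    fix x y assume "all_emb x = all_emb y"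
    then show "x = y" using 1 1[symmetric] 2 2[symmetric] 3 4 5 unfolding all_emb_def
      by (auto split: sum.splits)
  qed
qed

lemma all_emb_independent:
  assumes "\<And>x. (\<Sum>i\<in>UNIV. a i * \<sigma> i x) + (\<Sum>j\<in>UNIV. b j * \<tau> j x) + (\<Sum>j\<in>UNIV. c j * cnj (\<tau> j x)) = 0"
  shows "a i = 0" "b j = 0" "c j = 0"
proof -
  define d where "d = case_sum a (case_sum b c)"
  have u: "(UNIV :: ('s + 't + 't) set) = Inl ` UNIV \<union> (Inr ` Inl ` UNIV \<union> Inr ` Inr ` UNIV)"
    by (auto simp: UNIV_sum)
  have "(\<Sum>i\<in>UNIV. d i * all_emb i x) = 0" for x
  proof -
    have "(\<Sum>i\<in>UNIV. d i * all_emb i x) = (\<Sum>i\<in>UNIV. a i * \<sigma> i x) + ((\<Sum>j\<in>UNIV. b j * \<tau> j x) + (\<Sum>j\<in>UNIV. c j * cnj (\<tau> j x)))"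
      unfolding u by (subst sum.union_disjoint, simp, simp, fastforce, subst sum.union_disjoint, simp, simp, fastforce)
        (simp add: sum.reindex inj_on_def d_def all_emb_def)
    then show ?thesis using assms[of x] by (simp add: add.assoc)
  qed
  then have "d i = 0" for i
    using Dedekind_independent[of UNIV all_emb d i] all_emb_hom inj_all_emb by auto
  from this[of "Inl i"] this[of "Inr (Inl j)"] this[of "Inr (Inr j)"]
  show "a i = 0" "b j = 0" "c j = 0" unfolding d_def by auto
qed

lemma emb_vec_simps:
  "emb_vec \<sigma> \<tau> (a + b) = emb_vec \<sigma> \<tau> a + emb_vec \<sigma> \<tau> b" "emb_vec \<sigma> \<tau> (a - b) = emb_vec \<sigma> \<tau> a - emb_vec \<sigma> \<tau> b"
  "emb_vec \<sigma> \<tau> (of_rat q * a) = of_rat q *\<^sub>R emb_vec \<sigma> \<tau> a"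
  "emb_vec \<sigma> \<tau> (of_int n * a) = of_int n *\<^sub>R emb_vec \<sigma> \<tau> a"
  "emb_vec \<sigma> \<tau> (sum f A) = (\<Sum>i\<in>A. emb_vec \<sigma> \<tau> (f i))" "emb_vec \<sigma> \<tau> a \<in> real_part"
proof -
  have r: "(of_rat q :: complex) = of_real (of_rat q)" for q
    by (cases q) (simp add: of_rat_rat)
  show "emb_vec \<sigma> \<tau> (of_rat q * a) = of_rat q *\<^sub>R emb_vec \<sigma> \<tau> a"
    unfolding emb_vec_def by (simp add: vec_eq_iff \<sigma>_simps \<tau>_simps r scaleR_conv_of_real[where 'a=complex])
  show "emb_vec \<sigma> \<tau> (of_int n * a) = of_int n *\<^sub>R emb_vec \<sigma> \<tau> a"
    unfolding emb_vec_def by (simp add: vec_eq_iff \<sigma>_simps \<tau>_simps scaleR_conv_of_real[where 'a=complex])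
  show 1: "emb_vec \<sigma> \<tau> (a + b) = emb_vec \<sigma> \<tau> a + emb_vec \<sigma> \<tau> b" for a b
    unfolding emb_vec_def by (simp add: vec_eq_iff \<sigma>_simps \<tau>_simps)
  show "emb_vec \<sigma> \<tau> (a - b) = emb_vec \<sigma> \<tau> a - emb_vec \<sigma> \<tau> b"
    unfolding emb_vec_def by (simp add: vec_eq_iff \<sigma>_simps \<tau>_simps)
  have 0: "emb_vec \<sigma> \<tau> 0 = 0" unfolding emb_vec_def by (simp add: prod_eq_iff vec_eq_iff \<sigma>_simps \<tau>_simps)
  show "emb_vec \<sigma> \<tau> (sum f A) = (\<Sum>i\<in>A. emb_vec \<sigma> \<tau> (f i))"
    by (induction A rule: infinite_finite_induct) (auto simp: 0 1)
  show "emb_vec \<sigma> \<tau> a \<in> real_part" unfolding emb_vec_def real_part_def by simp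
qed

text \<open>A vector orthogonal to the image of the field is a linear relation between the embeddings.\<close>

lemma real_part_subset_span:
  assumes B: "rat_scale.span B = (UNIV :: 'k set)"
  shows "real_part \<subseteq> span (emb_vec \<sigma> \<tau> ` B)"
proof
  fix x :: "('s, 't) model" assume x: "x \<in> real_part"
  let ?S = "span (emb_vec \<sigma> \<tau> ` B)"
  obtain s o' where so: "s \<in> ?S" "\<And>w. w \<in> ?S \<Longrightarrow> orthogonal o' w" "x = s + o'"
    using orthogonal_subspace_decomp_exists[of "emb_vec \<sigma> \<tau> ` B" x] by blast
  \<comment> \<open>This keeps the orthogonal component in \<open>real_part\<close>, so its first
    coordinates are real and enter the relation as real coefficients.\<close>
  have "?S \<subseteq> real_part" using emb_vec_simps(6) by (intro span_minimal subspace_real_part) auto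
  then have o: "o' \<in> real_part"
    using so x subspace_diff[OF subspace_real_part, of x s] by auto
  obtain w z where wz: "o' = (w, z)" by (cases o')
  have ortho: "inner o' (emb_vec \<sigma> \<tau> a) = 0" for a
  proof -
    have "a \<in> rat_scale.span B" using B by simp
    then show ?thesis
    proof (induction rule: rat_scale.span_induct_alt)
      case base
      then show ?case by (simp add: emb_vec_def prod_eq_iff vec_eq_iff \<sigma>_simps \<tau>_simps inner_prod_def inner_vec_def)
    next
      case (step c b y)
      have "inner o' (emb_vec \<sigma> \<tau> b) = 0"
        using so(2)[OF span_base] step(1) unfolding orthogonal_def by blast
      then show ?case using step(2) by (simp add: emb_vec_simps inner_add_right)
    qed
  qed
  \<comment> \<open>The real inner product of complex numbers z and w is the mean of
    \<open>cnj z * w\<close> and \<open>z * cnj w\<close>; this is why orthogonality becomes a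
    relation that involves conjugate embeddings.\<close>
  have rel: "(\<Sum>i\<in>UNIV. of_real (Re (w $ i)) * \<sigma> i a) + (\<Sum>j\<in>UNIV. (cnj (z $ j) / 2) * \<tau> j a) + (\<Sum>j\<in>UNIV. (z $ j / 2) * cnj (\<tau> j a)) = 0" for a
  proof -
    have Imw: "Im (w $ i) = 0" for i using o unfolding wz real_part_def by auto
    have 1: "of_real (Re (w $ i)) * \<sigma> i a = of_real (inner (w $ i) (\<sigma> i a))" for i
      by (simp add: complex_eq_iff inner_complex_def Imw)
    have 2: "(cnj (z $ j) / 2) * \<tau> j a + (z $ j / 2) * cnj (\<tau> j a) = of_real (inner (z $ j) (\<tau> j a))" for j
      by (simp add: complex_eq_iff inner_complex_def field_simps)
    have "(\<Sum>i\<in>UNIV. of_real (Re (w $ i)) * \<sigma> i a) + (\<Sum>j\<in>UNIV. (cnj (z $ j) / 2) * \<tau> j a) + (\<Sum>j\<in>UNIV. (z $ j / 2) * cnj (\<tau> j a))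
      = (\<Sum>i\<in>UNIV. of_real (inner (w $ i) (\<sigma> i a))) + (\<Sum>j\<in>UNIV. of_real (inner (z $ j) (\<tau> j a)))"
      unfolding 1 2[symmetric] by (simp add: sum.distrib)
    also have "\<dots> = of_real (inner o' (emb_vec \<sigma> \<tau> a))"
      unfolding wz emb_vec_def by (simp add: inner_prod_def inner_vec_def)
    finally show ?thesis by (simp add: ortho)
  qed
  have "of_real (Re (w $ i)) = (0 :: complex)" "z $ j / 2 = 0" for i j
    using all_emb_independent(1)[OF rel, of i] all_emb_independent(3)[OF rel, of j] by auto
  then have "o' = 0" using o unfolding wz real_part_def by (simp add: prod_eq_iff vec_eq_iff complex_eq_iff)
  then show "x \<in> ?S" using so by simp
qed

section \<open>Cocompactness of the integers and density of their real embeddings\<close>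

lemma algebraic_field: "algebraic (x :: 'k)"
  by (rule number_field_algebraic[OF nf])

lemma ex_integral_spanning:
  obtains B :: "'k set" where "finite B" "\<And>b. b \<in> B \<Longrightarrow> algebraic_int b" "rat_scale.span B = UNIV"
proof -
  obtain B :: "'k set" where B: "finite B" "rat_scale.span B = UNIV"
    using nf unfolding number_field_def by blast
  have "\<exists>N::nat. N > 0 \<and> algebraic_int (of_nat N * x)" for x :: 'k
    by (rule ex_denominator[OF algebraic_field[of x]]) blast
  then obtain N :: "'k \<Rightarrow> nat" where N: "\<And>x. N x > 0" "\<And>x. algebraic_int (of_nat (N x) * x)" by metis
  show thesis
  proof (rule that[of "(\<lambda>b. of_nat (N b) * b) ` B"])
    let ?S = "rat_scale.span ((\<lambda>b. of_nat (N b) * b) ` B)"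
    have "b \<in> ?S" if "b \<in> B" for b
    proof -
      have "of_rat (1 / of_nat (N b)) * (of_nat (N b) * b) \<in> ?S"
        by (intro rat_scale.span_scale rat_scale.span_base) (use that in auto)
      then show ?thesis using N(1)[of b] by (simp add: of_rat_divide)
    qed
    then have "rat_scale.span B \<subseteq> ?S" by (intro rat_scale.span_minimal) auto
    then show "?S = UNIV" using B by auto
  qed (use B N in auto)
qed

text \<open>The real coefficients over an integral spanning set are rounded down: the integer parts
  assemble to an algebraic integer, and only fractional parts remain.\<close>

lemma cocompact:
  obtains C where "C > 0" "\<And>v. v \<in> real_part \<Longrightarrow> \<exists>a. algebraic_int a \<and> norm (v - emb_vec \<sigma> \<tau> a) \<le> C"
proof -
  obtain B :: "'k set" where B: "finite B" "\<And>b. b \<in> B \<Longrightarrow> algebraic_int b" "rat_scale.span B = UNIV"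
    using ex_integral_spanning by blast
  \<comment> \<open>Fractional parts lie between 0 and 1, so the sum of the norms bounds the error;
    the 1 is added to make \<open>C\<close> positive.\<close>
  define C where "C = (\<Sum>b\<in>B. norm (emb_vec \<sigma> \<tau> b)) + 1"
  have inj: "inj_on (emb_vec \<sigma> \<tau>) B"
    unfolding inj_on_def emb_vec_def by (auto simp: vec_eq_iff \<sigma>_simps)
  show thesis
  proof (rule that[of C])
    show "C > 0" unfolding C_def by (intro add_nonneg_pos sum_nonneg) auto
    fix v :: "('s, 't) model" assume "v \<in> real_part"
    then have "v \<in> span (emb_vec \<sigma> \<tau> ` B)" using real_part_subset_span[OF B(3)] by auto
    then obtain r where "v = (\<Sum>w\<in>emb_vec \<sigma> \<tau> ` B. r w *\<^sub>R w)"
      unfolding span_finite[OF finite_imageI[OF B(1)]] by auto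
    then have v: "v = (\<Sum>b\<in>B. r (emb_vec \<sigma> \<tau> b) *\<^sub>R emb_vec \<sigma> \<tau> b)" by (simp add: sum.reindex[OF inj])
    define a where "a = (\<Sum>b\<in>B. of_int \<lfloor>r (emb_vec \<sigma> \<tau> b)\<rfloor> * b)"
    have "algebraic_int a" unfolding a_def by (intro algebraic_int_sum algebraic_int_times algebraic_int_of_int B(2))
    moreover have "norm (v - emb_vec \<sigma> \<tau> a) \<le> C"
    proof -
      have "v - emb_vec \<sigma> \<tau> a = (\<Sum>b\<in>B. frac (r (emb_vec \<sigma> \<tau> b)) *\<^sub>R emb_vec \<sigma> \<tau> b)"
        unfolding v a_def by (simp add: emb_vec_simps frac_def scaleR_left_diff_distrib sum_subtractf)
      also have "norm \<dots> \<le> (\<Sum>b\<in>B. norm (emb_vec \<sigma> \<tau> b))"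
      proof (rule sum_norm_le)
        fix b assume "b \<in> B"
        have "frac (r (emb_vec \<sigma> \<tau> b)) * norm (emb_vec \<sigma> \<tau> b) \<le> 1 * norm (emb_vec \<sigma> \<tau> b)"
          by (intro mult_right_mono) (auto simp: frac_lt_1 less_imp_le)
        then show "norm (frac (r (emb_vec \<sigma> \<tau> b)) *\<^sub>R emb_vec \<sigma> \<tau> b) \<le> norm (emb_vec \<sigma> \<tau> b)" by (simp add: frac_ge_0)
      qed
      finally show ?thesis unfolding C_def by simp
    qed
    ultimately show "\<exists>a. algebraic_int a \<and> norm (v - emb_vec \<sigma> \<tau> a) \<le> C" by blast
  qed
qed

text \<open>Integers approximating vectors far out in the complex directions are distinct, yet their
  real embeddings stay bounded. By compactness two of them are close in all real embeddings, and
  their difference is the desired element.\<close>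

lemma ex_small_real_embeddings:
  assumes "\<epsilon> > 0"
  obtains a where "algebraic_int a" "a \<noteq> 0" "\<And>i. norm (\<sigma> i a) < \<epsilon>"
proof -
  obtain C where C: "C > 0" "\<And>v. v \<in> real_part \<Longrightarrow> \<exists>a. algebraic_int a \<and> norm (v - emb_vec \<sigma> \<tau> a) \<le> C"
    using cocompact by blast
  \<comment> \<open>The spacing \<open>2 * C + 1\<close> exceeds twice the approximation error
    \<open>C\<close>, so different \<open>n\<close> receive different integers.\<close>
  define v where "v = (\<lambda>n::nat. (0, \<chi> j. of_real (real n * (2 * C + 1))) :: ('s, 't) model)"
  have "v n \<in> real_part" for n unfolding v_def real_part_def by simp
  then have "\<exists>a. algebraic_int a \<and> norm (v n - emb_vec \<sigma> \<tau> a) \<le> C" for n using C(2) by blast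
  then obtain a where a: "\<And>n. algebraic_int (a n)" "\<And>n. norm (v n - emb_vec \<sigma> \<tau> (a n)) \<le> C" by metis
  have inj: "a m \<noteq> a n" if "m < n" for m n
  proof
    assume eq: "a m = a n"
    have "norm (v n - v m) \<le> norm (v n - emb_vec \<sigma> \<tau> (a n)) + norm (v m - emb_vec \<sigma> \<tau> (a m))"
      using norm_triangle_ineq4[of "v n - emb_vec \<sigma> \<tau> (a n)" "v m - emb_vec \<sigma> \<tau> (a m)"] eq by simp
    also have "\<dots> \<le> 2 * C" using a(2)[of n] a(2)[of m] by linarith
    finally have le: "norm (v n - v m) \<le> 2 * C" .
    fix j :: 't
    have "norm (snd (v n - v m) $ j) \<le> norm (v n - v m)"
      using norm_snd_le[of "snd (v n - v m)" "fst (v n - v m)"] Finite_Cartesian_Product.norm_nth_le[of "snd (v n - v m)" j]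
      by (simp del: snd_diff fst_diff)
    also have "snd (v n - v m) $ j = of_real ((real n - real m) * (2 * C + 1))"
      unfolding v_def by (simp add: algebra_simps)
    finally have 1: "\<bar>(real n - real m) * (2 * C + 1)\<bar> \<le> norm (v n - v m)" unfolding norm_of_real .
    have "1 * (2 * C + 1) \<le> (real n - real m) * (2 * C + 1)"
      using that C(1) by (intro mult_right_mono) auto
    then have "2 * C + 1 \<le> \<bar>(real n - real m) * (2 * C + 1)\<bar>" by (metis abs_ge_self mult_1 order_trans)
    then show False using 1 le by linarith
  qed
  define f where "f = (\<lambda>n. fst (emb_vec \<sigma> \<tau> (a n)))"
  have "norm (f n) \<le> C" for n
  proof -
    have "norm (fst (v n - emb_vec \<sigma> \<tau> (a n))) \<le> norm (v n - emb_vec \<sigma> \<tau> (a n))"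
      by (metis norm_fst_le prod.collapse)
    also have "fst (v n - emb_vec \<sigma> \<tau> (a n)) = - f n" unfolding f_def v_def by simp
    finally show ?thesis using a(2)[of n] by simp
  qed
  then have "bounded (range f)" unfolding bounded_iff by blast
  then obtain l r where r: "strict_mono r" "(f \<circ> r) \<longlonglongrightarrow> l"
    using bounded_imp_convergent_subsequence by blast
  obtain N where N: "\<And>m n. m \<ge> N \<Longrightarrow> n \<ge> N \<Longrightarrow> dist ((f \<circ> r) m) ((f \<circ> r) n) < \<epsilon>"
    using metric_CauchyD[OF LIMSEQ_imp_Cauchy[OF r(2)] assms] by blast
  let ?a = "a (r (Suc N)) - a (r N)"
  have "norm (f (r (Suc N)) - f (r N)) < \<epsilon>" using N[of "Suc N" N] by (simp add: dist_norm)
  moreover have "f (r (Suc N)) - f (r N) = fst (emb_vec \<sigma> \<tau> ?a)" unfolding f_def by (simp add: emb_vec_simps)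
  ultimately have "norm (\<sigma> i ?a) < \<epsilon>" for i
    using Finite_Cartesian_Product.norm_nth_le[of "fst (emb_vec \<sigma> \<tau> ?a)" i] by (simp add: emb_vec_def)
  moreover have "?a \<noteq> 0" using inj[of "r N" "r (Suc N)"] r(1) by (simp add: strict_mono_Suc_iff)
  moreover have "algebraic_int ?a" using a(1) algebraic_int_diff by blast
  ultimately show thesis using that by blast
qed

text \<open>Multiplication by an integer with small real embeddings contracts the real coordinates,
  so that bounded distance becomes small distance.\<close>

lemma real_embeddings_dense:
  assumes "\<epsilon> > 0"
  obtains a where "algebraic_int a" "\<And>i. norm (of_real (r i) - \<sigma> i a) < \<epsilon>"
proof -
  obtain C where C: "C > 0" "\<And>v. v \<in> real_part \<Longrightarrow> \<exists>a. algebraic_int a \<and> norm (v - emb_vec \<sigma> \<tau> a) \<le> C"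
    using cocompact by blast
  \<comment> \<open>The factor \<open>\<epsilon> / C\<close> shrinks the approximation error
    \<open>C\<close> below \<open>\<epsilon>\<close>. The target is divided by
    \<open>\<sigma> i a0\<close> beforehand to undo the contraction.\<close>
  obtain a0 where a0: "algebraic_int a0" "a0 \<noteq> 0" "\<And>i. norm (\<sigma> i a0) < \<epsilon> / C"
    using ex_small_real_embeddings[of "\<epsilon> / C"] assms C(1) by auto
  define v where "v = ((\<chi> i. of_real (r i) / \<sigma> i a0), 0 :: complex ^ 't)"
  have "of_real x / \<sigma> i a0 \<in> \<real>" for x i using \<sigma>_real by auto
  then have "v \<in> real_part" unfolding real_part_def v_def by (simp add: complex_is_Real_iff)
  then obtain a where a: "algebraic_int a" "norm (v - emb_vec \<sigma> \<tau> a) \<le> C" using C(2) by blast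
  have "norm (of_real (r i) - \<sigma> i (a0 * a)) < \<epsilon>" for i
  proof -
    have "norm (of_real (r i) / \<sigma> i a0 - \<sigma> i a) \<le> norm (fst (v - emb_vec \<sigma> \<tau> a))"
      using Finite_Cartesian_Product.norm_nth_le[of "fst (v - emb_vec \<sigma> \<tau> a)" i] by (simp add: v_def emb_vec_def)
    also have "\<dots> \<le> C" using a(2) by (metis norm_fst_le order_trans prod.collapse)
    finally have le: "norm (of_real (r i) / \<sigma> i a0 - \<sigma> i a) \<le> C" .
    have "of_real (r i) - \<sigma> i (a0 * a) = \<sigma> i a0 * (of_real (r i) / \<sigma> i a0 - \<sigma> i a)"
      using a0(2) by (simp add: \<sigma>_simps field_simps)
    then have "norm (of_real (r i) - \<sigma> i (a0 * a)) = norm (\<sigma> i a0) * norm (of_real (r i) / \<sigma> i a0 - \<sigma> i a)"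
      by (simp add: norm_mult)
    also have "\<dots> \<le> norm (\<sigma> i a0) * C" using le by (intro mult_left_mono) auto
    also have "\<dots> < \<epsilon>" using a0(3)[of i] C(1) by (simp add: field_simps)
    finally show ?thesis .
  qed
  then show thesis using that algebraic_int_times[OF a0(1) a(1)] by blast
qed

end

section \<open>Invariant holomorphic functions\<close>

lemma cscale_simps [simp]: "fst (cscale c v) $ i = c * fst v $ i" "snd (cscale c v) $ j = c * snd v $ j"
  by (simp_all add: cscale_def case_prod_unfold)

lemma bounded_linear_cscale: "bounded_linear (\<lambda>c. cscale c v)"
  by (subst linear_conv_bounded_linear[symmetric], rule linearI)
    (auto simp: cscale_def case_prod_unfold vec_eq_iff algebra_simps)

definition hol_fun_at :: "(('s::finite, 't::finite) model \<Rightarrow> complex) \<Rightarrow> ('s, 't) model \<Rightarrow> bool" where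
  "hol_fun_at H p \<longleftrightarrow> (\<exists>D. (H has_derivative D) (at p) \<and> (\<forall>c v. D (cscale c v) = c * D v))"

lemma hol_fun_at_shift:
  assumes "hol_fun_at H (p + v)"
  shows "hol_fun_at (\<lambda>x. H (x + v)) p"
proof -
  obtain D where D: "(H has_derivative D) (at (p + v))" "\<forall>c v. D (cscale c v) = c * D v"
    using assms unfolding hol_fun_at_def by blast
  have "((\<lambda>x. x + v) has_derivative (\<lambda>h. h)) (at p)" by (auto intro!: derivative_eq_intros)
  then have "((\<lambda>x. H (x + v)) has_derivative D) (at p)"
    using diff_chain_at[of "\<lambda>x. x + v" _ p H D] D(1) by (simp add: o_def)
  then show ?thesis unfolding hol_fun_at_def using D(2) by blast
qed

lemma hol_fun_at_diff:
  assumes "hol_fun_at f p" "hol_fun_at g p"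
  shows "hol_fun_at (\<lambda>x. f x - g x) p"
proof -
  obtain D E where D: "(f has_derivative D) (at p)" "\<forall>c v. D (cscale c v) = c * D v"
    and E: "(g has_derivative E) (at p)" "\<forall>c v. E (cscale c v) = c * E v"
    using assms unfolding hol_fun_at_def by blast
  then show ?thesis unfolding hol_fun_at_def
    by (intro exI[of _ "\<lambda>x. D x - E x"]) (auto intro!: has_derivative_diff simp: right_diff_distrib)
qed

lemma holo_at_snd_component:
  assumes "holo_at F p"
  shows "hol_fun_at (\<lambda>x. snd (F x) $ j) p"
proof -
  obtain D where D: "(F has_derivative D) (at p)" "\<And>c v. D (cscale c v) = cscale c (D v)"
    using assms unfolding holo_at_def by blast
  have "((\<lambda>x. snd (F x) $ j) has_derivative (\<lambda>x. snd (D x) $ j)) (at p)"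
    by (intro bounded_linear.has_derivative[OF bounded_linear_vec_nth] bounded_linear.has_derivative[OF bounded_linear_snd] D)
  then show ?thesis unfolding hol_fun_at_def using D(2) by (intro exI[of _ "\<lambda>x. snd (D x) $ j"]) auto
qed

context ot_data
begin

text \<open>Along a fibre of the imaginary part, an invariant function is bounded by cocompactness, so
  Liouville's theorem makes it independent of the coordinates in \<open>\<complex>\<^sup>t\<close>; by density of the real
  embeddings it is then invariant under all real translations.\<close>

lemma invariant_holomorphic_constant:
  fixes H :: "('s, 't) model \<Rightarrow> complex"
  assumes hol: "\<And>p. p \<in> ot_domain \<Longrightarrow> hol_fun_at H p"
    and inv: "\<And>p a. p \<in> ot_domain \<Longrightarrow> algebraic_int a \<Longrightarrow> H (p + emb_vec \<sigma> \<tau> a) = H p"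
    and pq: "p \<in> ot_domain" "q \<in> ot_domain"
  shows "H p = H q"
proof -
  have contH: "continuous_on ot_domain H"
    unfolding continuous_on_eq_continuous_at[OF open_ot_domain]
    using hol has_derivative_continuous unfolding hol_fun_at_def by blast
  obtain C where C: "C > 0" "\<And>v. v \<in> real_part \<Longrightarrow> \<exists>a. algebraic_int a \<and> norm (v - emb_vec \<sigma> \<tau> a) \<le> C"
    using cocompact by blast
  have bound: "\<exists>M. \<forall>v\<in>real_part. norm (H (p + v)) \<le> M" if p: "p \<in> ot_domain" for p
  proof -
    let ?K = "(\<lambda>x. p + x) ` (real_part \<inter> cball 0 C)"
    have "compact ?K"
      by (intro compact_continuous_image continuous_intros closed_Int_compact closed_subspace subspace_real_part compact_cball)
    moreover have "?K \<subseteq> ot_domain" using real_part_domain[OF p] by auto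
    ultimately have "bounded (H ` ?K)"
      using compact_imp_bounded[OF compact_continuous_image[OF continuous_on_subset[OF contH]]] by blast
    then obtain M where M: "\<And>x. x \<in> H ` ?K \<Longrightarrow> norm x \<le> M" unfolding bounded_iff by blast
    have "norm (H (p + v)) \<le> M" if v: "v \<in> real_part" for v
    proof -
      obtain a where a: "algebraic_int a" "norm (v - emb_vec \<sigma> \<tau> a) \<le> C" using C(2)[OF v] by blast
      let ?x = "v - emb_vec \<sigma> \<tau> a"
      have x: "?x \<in> real_part" using subspace_diff[OF subspace_real_part v emb_vec_simps(6)] .
      have "H (p + ?x + emb_vec \<sigma> \<tau> a) = H (p + ?x)" by (rule inv[OF real_part_domain[OF p x] a(1)])
      then have "H (p + v) = H (p + ?x)" by (simp add: algebra_simps)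
      then show ?thesis using M x a(2) by simp
    qed
    then show ?thesis by blast
  qed
  have z_inv: "H (p + (0, e)) = H p" if p: "p \<in> ot_domain" for p e
  proof -
    \<comment> \<open>A complex line in a C^t direction leaves the half-plane coordinates fixed, so
      it lies in the domain and carries a bounded entire function.\<close>
    let ?l = "\<lambda>\<zeta>. p + cscale \<zeta> (0, e)"
    let ?f = "\<lambda>\<zeta>. H (?l \<zeta>)"
    have rp: "cscale \<zeta> (0, e) \<in> real_part" for \<zeta> :: complex
      by (simp add: real_part_def)
    have "\<exists>f'. (?f has_field_derivative f') (at \<zeta>)" for \<zeta>
    proof -
      obtain D where D: "(H has_derivative D) (at (?l \<zeta>))" "\<forall>c v. D (cscale c v) = c * D v"
        using hol[OF real_part_domain[OF p rp]] unfolding hol_fun_at_def by blast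
      have "(?l has_derivative (\<lambda>h. cscale h (0, e))) (at \<zeta>)"
        using has_derivative_add[OF has_derivative_const bounded_linear_imp_has_derivative[OF bounded_linear_cscale]] by simp
      from diff_chain_at[OF this D(1)]
      have "(?f has_derivative (\<lambda>h. D (0, e) * h)) (at \<zeta>)" using D(2) by (simp add: o_def mult.commute)
      then show ?thesis unfolding has_field_derivative_def by blast
    qed
    then have "?f holomorphic_on UNIV" unfolding holomorphic_on_def field_differentiable_def by auto
    moreover have "bounded (range ?f)" using bound[OF p] rp unfolding bounded_iff by blast
    ultimately have "?f constant_on UNIV" by (rule Liouville_theorem)
    then have "?f 1 = ?f 0" unfolding constant_on_def by auto
    moreover have "cscale 1 (0, e) = ((0, e) :: ('s, 't) model)" "cscale 0 (0, e) = (0 :: ('s, 't) model)"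
      by (simp_all add: cscale_def vec_eq_iff zero_prod_def)
    ultimately show ?thesis by simp
  qed
  have x_inv: "H (p + (\<chi> i. of_real (r i), 0)) = H p" if p: "p \<in> ot_domain" for p r
  proof -
    have "\<exists>a. algebraic_int a \<and> (\<forall>i. norm (of_real (r i) - \<sigma> i a) < inverse (real (Suc n)))" for n
      by (rule real_embeddings_dense[of "inverse (real (Suc n))" r]) auto
    then obtain a where a: "\<And>n. algebraic_int (a n)" "\<And>n i. norm (of_real (r i) - \<sigma> i (a n)) < inverse (real (Suc n))"
      by metis
    let ?q = "p + (\<chi> i. of_real (r i), 0)"
    have "(\<lambda>n. \<sigma> i (a n)) \<longlonglongrightarrow> of_real (r i)" for i
      by (rule LIMSEQ_if_dist_less_inverse) (simp only: dist_norm norm_minus_commute[of "\<sigma> i (a _)"] a(2))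
    then have lv: "(\<lambda>n. (\<chi> i. \<sigma> i (a n))) \<longlonglongrightarrow> (\<chi> i. of_real (r i))" by (intro vec_tendstoI) simp
    have lim: "(\<lambda>n. p + (\<chi> i. \<sigma> i (a n), 0)) \<longlonglongrightarrow> ?q" by (intro tendsto_add tendsto_Pair tendsto_const lv)
    have "?q \<in> ot_domain" by (intro real_part_domain p) (simp add: real_part_def)
    then have "isCont H ?q" using contH continuous_on_eq_continuous_at[OF open_ot_domain] by blast
    then have "(\<lambda>n. H (p + (\<chi> i. \<sigma> i (a n), 0))) \<longlonglongrightarrow> H ?q" using lim by (rule isCont_tendsto_compose)
    \<comment> \<open>Translation by an integer also moves the C^t coordinates; by
      \<open>z_inv\<close> that part can be undone without changing \<open>H\<close>.\<close>
    moreover have "H (p + (\<chi> i. \<sigma> i (a n), 0)) = H p" for n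
    proof -
      have "p + emb_vec \<sigma> \<tau> (a n) \<in> ot_domain" by (intro real_part_domain p emb_vec_simps)
      then have "H (p + emb_vec \<sigma> \<tau> (a n) + (0, - (\<chi> j. \<tau> j (a n)))) = H (p + emb_vec \<sigma> \<tau> (a n))" by (rule z_inv)
      moreover have "p + emb_vec \<sigma> \<tau> (a n) + (0, - (\<chi> j. \<tau> j (a n))) = p + (\<chi> i. \<sigma> i (a n), 0)"
        by (simp add: emb_vec_def prod_eq_iff)
      ultimately show ?thesis using inv[OF p a(1)[of n]] by simp
    qed
    ultimately show ?thesis by (simp add: LIMSEQ_const_iff)
  qed
  have inv_all: "H (p + v) = H p" if p: "p \<in> ot_domain" and v: "v \<in> real_part" for p v
  proof -
    have e: "v = (\<chi> i. of_real (Re (fst v $ i)), 0) + (0, snd v)"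
      using v by (simp add: real_part_def prod_eq_iff vec_eq_iff complex_eq_iff)
    have "p + (\<chi> i. of_real (Re (fst v $ i)), 0) \<in> ot_domain" by (intro real_part_domain p) (simp add: real_part_def)
    then have "H (p + (\<chi> i. of_real (Re (fst v $ i)), 0) + (0, snd v)) = H p"
      using z_inv x_inv[OF p] by metis
    then show ?thesis by (subst e) (simp add: add.assoc)
  qed
  have "(H has_derivative (\<lambda>h. 0)) (at p)" if p: "p \<in> ot_domain" for p
  proof -
    obtain D where D: "(H has_derivative D) (at p)" "\<forall>c v. D (cscale c v) = c * D v"
      using hol[OF p] unfolding hol_fun_at_def by blast
    have zero: "D v = 0" if v: "v \<in> real_part" for v
    proof -
      have "((\<lambda>t::real. p + t *\<^sub>R v) has_derivative (\<lambda>t. t *\<^sub>R v)) (at 0)" by (auto intro!: derivative_eq_intros)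
      from diff_chain_at[OF this, of H D] D(1)
      have "((\<lambda>t::real. H (p + t *\<^sub>R v)) has_derivative (\<lambda>t. D (t *\<^sub>R v))) (at 0)" by (simp add: o_def)
      moreover have "(\<lambda>t::real. H (p + t *\<^sub>R v)) = (\<lambda>t. H p)"
        using inv_all[OF p] subspace_scale[OF subspace_real_part v] by auto
      ultimately have "((\<lambda>t::real. H p) has_derivative (\<lambda>t. D (t *\<^sub>R v))) (at 0)" by simp
      then have "(\<lambda>t. D (t *\<^sub>R v)) = (\<lambda>t. 0)" using has_derivative_unique[OF _ has_derivative_const] by blast
      then show ?thesis by (metis scaleR_one)
    qed
    have "D v = 0" for v
    proof -
      interpret D: bounded_linear D using D(1) by (rule has_derivative_bounded_linear)
      \<comment> \<open>\<open>real_part\<close> and its multiple by the imaginary unit together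
        span the model space, so a complex linear \<open>D\<close> that vanishes on
        \<open>real_part\<close> is zero.\<close>
      let ?v1 = "(\<chi> i. of_real (Re (fst v $ i)), snd v) :: ('s, 't) model"
      let ?v2 = "(\<chi> i. of_real (Im (fst v $ i)), 0) :: ('s, 't) model"
      have "v = ?v1 + cscale \<i> ?v2" by (simp add: cscale_def prod_eq_iff vec_eq_iff complex_eq_iff)
      then have "D v = D ?v1 + \<i> * D ?v2" using D.add D(2) by metis
      moreover have "?v1 \<in> real_part" "?v2 \<in> real_part" by (auto simp: real_part_def)
      ultimately show ?thesis using zero by simp
    qed
    then have "D = (\<lambda>h. 0)" by auto
    then show ?thesis using D(1) by simp
  qed
  then have "(H has_derivative (\<lambda>h. 0)) (at x within ot_domain)" if "x \<in> ot_domain" for x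
    using that has_derivative_at_withinI by blast
  then have "\<exists>c. \<forall>x\<in>ot_domain. H x = c"
    by (rule has_derivative_zero_constant[OF convex_ot_domain])
  then show ?thesis using pq by auto
qed

text \<open>The differences \<open>G (p + v) - G p\<close> are invariant, hence independent of \<open>p\<close>, and so equal to the
  derivative of \<open>G\<close> in the direction \<open>v\<close>.\<close>

lemma equivariant_additive_linear:
  fixes G :: "('s, 't) model \<Rightarrow> complex"
  assumes hol: "\<And>p. p \<in> ot_domain \<Longrightarrow> hol_fun_at G p"
    and eqv: "\<And>p a. p \<in> ot_domain \<Longrightarrow> algebraic_int a \<Longrightarrow> G (p + emb_vec \<sigma> \<tau> a) = G p + l a"
  obtains A B where "\<And>a. algebraic_int a \<Longrightarrow> l a = (\<Sum>i\<in>UNIV. A i * \<sigma> i a) + (\<Sum>j\<in>UNIV. B j * \<tau> j a)"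
proof -
  define p0 :: "('s, 't) model" where "p0 = (\<chi> i. \<i>, 0)"
  have p0: "p0 \<in> ot_domain" unfolding p0_def ot_domain_def by simp
  obtain D where D: "(G has_derivative D) (at p0)" "\<forall>c v. D (cscale c v) = c * D v"
    using hol[OF p0] unfolding hol_fun_at_def by blast
  interpret D: bounded_linear D using D(1) by (rule has_derivative_bounded_linear)
  define c where "c = (\<lambda>v. G (p0 + v) - G p0)"
  have const: "G (p + v) - G p = c v" if p: "p \<in> ot_domain" and v: "v \<in> real_part" for p v
    unfolding c_def
  proof (rule invariant_holomorphic_constant[OF _ _ p p0])
    fix p :: "('s, 't) model" assume p: "p \<in> ot_domain"
    show "hol_fun_at (\<lambda>p. G (p + v) - G p) p"
      by (intro hol_fun_at_diff hol_fun_at_shift hol p real_part_domain v)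
    fix a :: 'k assume a: "algebraic_int a"
    have "G (p + v + emb_vec \<sigma> \<tau> a) = G (p + v) + l a" by (rule eqv[OF real_part_domain[OF p v] a])
    then show "G (p + emb_vec \<sigma> \<tau> a + v) - G (p + emb_vec \<sigma> \<tau> a) = G (p + v) - G p"
      using eqv[OF p a] by (simp add: add.assoc add.commute[of v])
  qed
  have cD: "c v = D v" if v: "v \<in> real_part" for v
  proof -
    \<comment> \<open>By \<open>const\<close> the increments of \<open>G\<close> in direction
      \<open>v\<close> are the same at every point of the line, so the derivative at
      \<open>t\<close> is the one at 0; hence \<open>k\<close> is constant.\<close>
    define k where "k = (\<lambda>t::real. G (p0 + t *\<^sub>R v) - of_real t * D v)"
    have "(k has_derivative (\<lambda>h. 0)) (at t)" for t
    proof -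
      have "((\<lambda>x::real. p0 + (x - t) *\<^sub>R v) has_derivative (\<lambda>h. h *\<^sub>R v)) (at t)"
        by (auto intro!: derivative_eq_intros)
      from diff_chain_at[OF this, of G D] D(1)
      have "((\<lambda>x::real. G (p0 + (x - t) *\<^sub>R v)) has_derivative (\<lambda>h. D (h *\<^sub>R v))) (at t)" by (simp add: o_def)
      then have "((\<lambda>x::real. G (p0 + (x - t) *\<^sub>R v) + c (t *\<^sub>R v) - of_real x * D v) has_derivative (\<lambda>h. D (h *\<^sub>R v) - of_real h * D v)) (at t)"
        by (auto intro!: derivative_eq_intros)
      moreover have "(\<lambda>x::real. G (p0 + (x - t) *\<^sub>R v) + c (t *\<^sub>R v) - of_real x * D v) = k"
      proof
        fix x :: real
        have "G (p0 + (x - t) *\<^sub>R v + t *\<^sub>R v) - G (p0 + (x - t) *\<^sub>R v) = c (t *\<^sub>R v)"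
          by (intro const real_part_domain p0 subspace_scale[OF subspace_real_part v])
        moreover have "p0 + (x - t) *\<^sub>R v + t *\<^sub>R v = p0 + x *\<^sub>R v" by (simp add: algebra_simps)
        ultimately show "G (p0 + (x - t) *\<^sub>R v) + c (t *\<^sub>R v) - of_real x * D v = k x"
          unfolding k_def by (simp add: algebra_simps)
      qed
      ultimately show ?thesis by (simp add: D.scaleR scaleR_conv_of_real)
    qed
    then obtain C where "\<And>t. k t = C"
      using has_derivative_zero_constant[of UNIV k] by auto
    then have "k 1 = k 0" by simp
    then show ?thesis unfolding k_def c_def by (simp add: algebra_simps)
  qed
  have "l a = (\<Sum>i\<in>UNIV. D (axis i 1, 0) * \<sigma> i a) + (\<Sum>j\<in>UNIV. D (0, axis j 1) * \<tau> j a)" if a: "algebraic_int a" for a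
  proof -
    have "emb_vec \<sigma> \<tau> a = (\<Sum>i\<in>UNIV. cscale (\<sigma> i a) (axis i 1, 0)) + (\<Sum>j\<in>UNIV. cscale (\<tau> j a) (0, axis j 1))"
      by (simp add: emb_vec_def prod_eq_iff fst_sum snd_sum vec_eq_iff cscale_def axis_def if_distrib cong: if_cong)
    then have "D (emb_vec \<sigma> \<tau> a) = (\<Sum>i\<in>UNIV. \<sigma> i a * D (axis i 1, 0)) + (\<Sum>j\<in>UNIV. \<tau> j a * D (0, axis j 1))"
      using D(2) by (simp add: D.add D.sum)
    moreover have "l a = D (emb_vec \<sigma> \<tau> a)"
      using cD[OF emb_vec_simps(6)[of a]] eqv[OF p0 a] unfolding c_def by simp
    ultimately show ?thesis by (simp add: mult.commute)
  qed
  then show thesis by (rule that)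
qed

text \<open>For trivial \<open>U\<close> the logarithmic image is the zero group. There any set
  satisfies the relation with all coefficients 1, so only the empty set is independent, whereas the
  lattice has rank \<open>CARD('s)\<close>, which is positive.\<close>

lemma U_nontrivial: "\<exists>u\<in>U. u \<noteq> 1"
proof (rule ccontr)
  assume "\<not> ?thesis"
  then have "U = {1}" using U_one by auto
  then have L: "log_embedding \<sigma> ` U = {0}"
    by (simp add: log_embedding_def vec_eq_iff \<sigma>_simps)
  let ?G = "\<lparr>carrier = {0 :: real ^ 's}, monoid.mult = (+), one = 0\<rparr>"
  have "has_rank ?G CARD('s)" using adm L unfolding admissible_def is_lattice_def by simp
  then obtain B where B: "int_independent ?G B" "card B = CARD('s)" unfolding has_rank_def by blast
  have "card B > 0" using B(2) by simp
  then obtain b where b: "b \<in> B" by fastforce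
  interpret G: comm_group ?G by unfold_locales (auto simp: Units_def)
  have "B \<subseteq> {0}" using B(1) unfolding int_independent_def by auto
  then have "finprod ?G (\<lambda>b. b [^]\<^bsub>?G\<^esub> (1::int)) B = \<one>\<^bsub>?G\<^esub>"
    by (intro G.finprod_one_eqI) (auto simp: G.int_pow_1)
  moreover have "\<forall>n :: real ^ 's \<Rightarrow> int. finprod ?G (\<lambda>b. b [^]\<^bsub>?G\<^esub> n b) B = \<one>\<^bsub>?G\<^esub> \<longrightarrow> (\<forall>b\<in>B. n b = 0)"
    using B(1) unfolding int_independent_def by simp
  ultimately have "\<forall>b\<in>B. (1::int) = 0" using spec[of _ "\<lambda>_. 1::int"] by fastforce
  then show False using b by simp
qed

end

section \<open>Automorphisms of the group and of the field\<close>

lemma field_aut_iff: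
  "\<rho> \<in> (field_aut :: ('k::field_char_0 \<Rightarrow> 'k) set) \<longleftrightarrow>
     (\<forall>x y. \<rho> (x + y) = \<rho> x + \<rho> y) \<and> (\<forall>x y. \<rho> (x * y) = \<rho> x * \<rho> y) \<and> \<rho> 1 = 1 \<and> bij \<rho> \<and>
     (\<forall>q. \<rho> (of_rat q) = of_rat q)"
proof -
  have "carrier (ring_of_type_algebra :: 'k ring) = UNIV" by (simp add: ring_of_type_algebra_def)
  then show ?thesis unfolding field_aut_def ring_iso_def mem_Collect_eq ring_hom_type_iff by auto
qed

lemma field_aut_inv:
  assumes "\<rho> \<in> field_aut"
  shows "Hilbert_Choice.inv \<rho> \<in> field_aut"
proof -
  have \<rho>: "\<And>x y. \<rho> (x + y) = \<rho> x + \<rho> y" "\<And>x y. \<rho> (x * y) = \<rho> x * \<rho> y" "\<rho> 1 = 1" "bij \<rho>" "\<And>q. \<rho> (of_rat q) = of_rat q"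
    using assms unfolding field_aut_iff by auto
  have s: "\<rho> (Hilbert_Choice.inv \<rho> y) = y" for y using \<rho>(4) by (simp add: bij_is_surj surj_f_inv_f)
  have i: "Hilbert_Choice.inv \<rho> x = y \<longleftrightarrow> x = \<rho> y" for x y using \<rho>(4) s by (metis bij_inv_eq_iff)
  show ?thesis unfolding field_aut_iff using \<rho> by (auto simp: i s bij_imp_bij_inv)
qed

lemma field_aut_comp: "\<rho> \<in> field_aut \<Longrightarrow> \<rho>' \<in> field_aut \<Longrightarrow> \<rho> \<circ> \<rho>' \<in> field_aut"
  unfolding field_aut_iff by (auto intro: bij_comp)

lemma field_aut_zero: "\<rho> \<in> field_aut \<Longrightarrow> \<rho> 0 = 0"
  unfolding field_aut_iff by (metis add_cancel_right_right)

lemma field_aut_algebraic_int: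
  assumes \<rho>: "\<rho> \<in> field_aut" and x: "algebraic_int x"
  shows "algebraic_int (\<rho> x)"
proof -
  have \<rho>': "\<And>x y. \<rho> (x + y) = \<rho> x + \<rho> y" "\<And>x y. \<rho> (x * y) = \<rho> x * \<rho> y" "\<rho> 1 = 1" "\<And>q. \<rho> (of_rat q) = of_rat q"
    using \<rho> unfolding field_aut_iff by auto
  obtain p where p: "Polynomial.lead_coeff p = 1" "\<forall>i. Polynomial.coeff p i \<in> \<int>" "poly p x = 0"
    using x by (auto elim: algebraic_int.cases)
  have sum: "\<rho> (sum f A) = (\<Sum>i\<in>A. \<rho> (f i))" for f :: "nat \<Rightarrow> 'a" and A
    by (induction A rule: infinite_finite_induct) (auto simp: \<rho>' field_aut_zero[OF \<rho>])
  have pow: "\<rho> (x ^ i) = \<rho> x ^ i" for i by (induction i) (auto simp: \<rho>')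
  have "\<rho> (Polynomial.coeff p i) = Polynomial.coeff p i" for i
    using p(2) \<rho>'(4) by (metis Ints_cases of_rat_of_int_eq)
  then have "\<rho> (poly p x) = poly p (\<rho> x)"
    unfolding poly_altdef by (simp add: sum \<rho>' pow)
  then have "poly p (\<rho> x) = 0" using p(3) field_aut_zero[OF \<rho>] by simp
  then show ?thesis using p(1,2) by (intro algebraic_int.intros)
qed

lemma hom_on_comp_field_aut:
  assumes "hom_on UNIV f" "\<rho> \<in> field_aut"
  shows "hom_on UNIV (f \<circ> \<rho>)"
  using assms hom_on_UNIV_simps(1,2,3)[OF assms(1)] unfolding field_aut_iff hom_on_def by simp

text \<open>Connects the record operations in the rules of \<open>generate_field\<close> with the
  type class operations in which the maps are written.\<close>

lemma ring_of_type_algebra_inverse: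
  fixes h :: "'k::field_char_0"
  shows "a_inv ring_of_type_algebra h = - h" "h \<noteq> 0 \<Longrightarrow> m_inv ring_of_type_algebra h = inverse h"
proof -
  interpret K: Ring.field "ring_of_type_algebra :: 'k ring" by (rule field_from_type_algebra)
  show "a_inv ring_of_type_algebra h = - h"
    by (rule K.minus_equality) (auto simp: ring_of_type_algebra_def)
  show "h \<noteq> 0 \<Longrightarrow> m_inv ring_of_type_algebra h = inverse h"
    by (rule K.inv_unique'[symmetric]) (auto simp: ring_of_type_algebra_def)
qed

context ot_data
begin

lemma mem_ot_group [simp]: "(u, a) \<in> carrier (ot_group U) \<longleftrightarrow> u \<in> U \<and> algebraic_int a"
  by (simp add: ot_group_def)

lemma mult_ot_group [simp]: "(u, a) \<otimes>\<^bsub>ot_group U\<^esub> (v, b) = (u * v, a + u * b)"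
  by (simp add: ot_group_def)

lemma fst_mult_ot_group: "fst (x \<otimes>\<^bsub>ot_group U\<^esub> y) = fst x * fst y"
  by (cases x, cases y) simp

text \<open>Under a real embedding \<open>e\<close> becomes a positive real root of unity, which can
  only be 1.\<close>

lemma U_power_eq_one:
  assumes "e \<in> U" "e ^ N = 1" "N > 0"
  shows "e = 1"
proof -
  fix i :: 's
  have r: "\<sigma> i e = of_real (Re (\<sigma> i e))" by (simp add: complex_eq_iff)
  have "\<sigma> i e ^ N = 1" using assms(2) by (metis \<sigma>_simps(3,13))
  then have "Re (\<sigma> i e) ^ N = 1" by (metis r of_real_eq_1_iff of_real_power)
  then have "Re (\<sigma> i e) = 1"
    using U_pos[OF assms(1), of i] assms(3) by (metis less_imp_le power_eq_imp_eq_base power_one zero_le_one)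
  then have "\<sigma> i e = \<sigma> i 1" using r by (simp add: \<sigma>_simps(3))
  then show ?thesis by (simp add: \<sigma>_simps(11))
qed

text \<open>Every translation has a power which is a commutator \<open>[(u, 0), (1, b)]\<close>, and \<open>U\<close> is
  commutative and torsion-free, so endomorphisms map translations to translations.\<close>

lemma hom_translation:
  assumes \<phi>: "\<phi> \<in> hom (ot_group U) (ot_group U)" and a: "algebraic_int a"
  shows "fst (\<phi> (1, a)) = 1"
proof -
  define e where "e = (\<lambda>g. fst (\<phi> g))"
  have e_mult: "e (g \<otimes>\<^bsub>ot_group U\<^esub> h) = e g * e h" if "g \<in> carrier (ot_group U)" "h \<in> carrier (ot_group U)" for g h
    unfolding e_def using hom_mult[OF \<phi> that] by (simp add: fst_mult_ot_group)
  have e_U: "e g \<in> U" if "g \<in> carrier (ot_group U)" for g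
    using hom_in_carrier[OF \<phi> that] unfolding e_def by (cases "\<phi> g") auto
  obtain u where u: "u \<in> U" "u \<noteq> 1" using U_nontrivial by blast
  obtain N where N: "N > 0" "algebraic_int (of_nat N * inverse (u - 1))"
    by (rule ex_denominator[OF algebraic_field])
  \<comment> \<open>The commutator of \<open>(u, 0)\<close> and \<open>(1, b)\<close> is the
    translation by \<open>(u - 1) * b\<close>; dividing by \<open>u - 1\<close> costs the
    denominator \<open>N\<close>, which is why only a power of the given translation is
    reached.\<close>
  define b where "b = of_nat N * inverse (u - 1) * a"
  have b: "algebraic_int b" "(u - 1) * b = of_nat N * a"
    unfolding b_def using N(2) a u(2) by (auto intro: algebraic_int_times)
  have Na: "algebraic_int (of_nat n * a)" for n by (intro algebraic_int_times a algebraic_int_of_nat)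
  have "(u, 0) \<otimes>\<^bsub>ot_group U\<^esub> (1, b) = (1, of_nat N * a) \<otimes>\<^bsub>ot_group U\<^esub> ((1, b) \<otimes>\<^bsub>ot_group U\<^esub> (u, 0))"
    unfolding b(2)[symmetric] by (simp add: algebra_simps)
  then have "e (u, 0) * e (1, b) = e (1, of_nat N * a) * (e (1, b) * e (u, 0))"
    using e_mult[of "(u, 0)" "(1, b)"] e_mult[of "(1, of_nat N * a)" "(1, b) \<otimes>\<^bsub>ot_group U\<^esub> (u, 0)"]
      e_mult[of "(1, b)" "(u, 0)"] u b Na U_one by simp
  moreover have "e (u, 0) \<noteq> 0" "e (1, b) \<noteq> 0" using U_nonzero e_U u b U_one by auto
  ultimately have 1: "e (1, of_nat N * a) = 1" by simp
  have "e (1, of_nat n * a) = e (1, a) ^ n" if "n > 0" for n using that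
  proof (induction n rule: nat_induct_non_zero)
    case (Suc n)
    have "(1, of_nat (Suc n) * a) = (1, a) \<otimes>\<^bsub>ot_group U\<^esub> (1, of_nat n * a)" by (simp add: algebra_simps)
    then show ?case using e_mult[of "(1, a)" "(1, of_nat n * a)"] Suc a Na U_one by simp
  qed simp
  then have "e (1, a) ^ N = 1" using 1 N by simp
  then show ?thesis using U_power_eq_one[OF e_U[of "(1, a)"] _ N(1)] a U_one unfolding e_def by simp
qed

text \<open>Applying \<open>hom_translation\<close> to \<open>\<phi>\<close> and to its inverse
  makes \<open>\<theta>\<close> an additive bijection of O_K. Conjugation by \<open>(u, 0)\<close>
  multiplies translations by \<open>u\<close>, so \<open>\<phi>\<close> turns multiplication by
  \<open>u\<close> into multiplication by \<open>\<eta> u\<close>; it remains to upgrade this to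
  multiplicativity on the whole field.\<close>

lemma ot_group_iso_automorphism:
  assumes \<phi>: "\<phi> \<in> iso (ot_group U) (ot_group U)" and gen: "generate_field ring_of_type_algebra U = UNIV"
  obtains \<rho> c where "\<rho> \<in> carrier (aut_preserving U)" "c \<noteq> 0" "\<And>a. algebraic_int a \<Longrightarrow> \<phi> (1, a) = (1, \<rho> a * c)"
proof -
  have hom: "\<phi> \<in> hom (ot_group U) (ot_group U)" and bij: "bij_betw \<phi> (carrier (ot_group U)) (carrier (ot_group U))"
    using \<phi> unfolding iso_def by auto
  note mult = hom_mult[OF hom]
  define \<psi> where "\<psi> = inv_into (carrier (ot_group U)) \<phi>"
  have \<psi>: "\<psi> \<in> hom (ot_group U) (ot_group U)"
    using Group.group.iso_set_sym[OF group_ot \<phi>] unfolding \<psi>_def iso_def by auto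
  have \<phi>\<psi>: "\<phi> (\<psi> g) = g" if "g \<in> carrier (ot_group U)" for g
    unfolding \<psi>_def using bij that by (simp add: bij_betw_inv_into_right)
  define \<theta> where "\<theta> = (\<lambda>a. snd (\<phi> (1, a)))"
  have \<phi>1: "\<phi> (1, a) = (1, \<theta> a)" if "algebraic_int a" for a
    using hom_translation[OF hom that] unfolding \<theta>_def by (simp add: prod_eq_iff)
  have \<theta>_int: "algebraic_int (\<theta> a)" if "algebraic_int a" for a
    using hom_in_carrier[OF hom, of "(1, a)"] \<phi>1 that U_one by simp
  have \<theta>_add: "\<theta> (a + b) = \<theta> a + \<theta> b" if "algebraic_int a" "algebraic_int b" for a b
  proof -
    have "\<phi> (1, a + b) = \<phi> (1, a) \<otimes>\<^bsub>ot_group U\<^esub> \<phi> (1, b)"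
      using mult[of "(1, a)" "(1, b)"] that U_one by simp
    then show ?thesis using \<phi>1 that algebraic_int_plus[OF that] by simp
  qed
  have \<theta>_nat: "\<theta> (of_nat n * a) = of_nat n * \<theta> a" if a: "algebraic_int a" for n a
  proof (induction n)
    case 0
    then show ?case using \<theta>_add[of 0 0] by simp
  next
    case (Suc n)
    have "algebraic_int (of_nat n * a)" by (intro algebraic_int_times a algebraic_int_of_nat)
    then show ?case using \<theta>_add[OF a, of "of_nat n * a"] Suc by (simp add: algebra_simps)
  qed
  have \<theta>_surj: "\<exists>a. algebraic_int a \<and> \<theta> a = b" if b: "algebraic_int b" for b
  proof -
    obtain a where a: "\<psi> (1, b) = (1, a)" using hom_translation[OF \<psi> b] by (metis prod.collapse)
    have "(1, a) \<in> carrier (ot_group U)" using hom_in_carrier[OF \<psi>, of "(1, b)"] a b U_one by simp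
    then have "algebraic_int a" by simp
    moreover have "\<phi> (1, a) = (1, b)" using \<phi>\<psi>[of "(1, b)"] a b U_one by simp
    ultimately show ?thesis using \<phi>1 by auto
  qed
  have \<theta>_inj: "a = b" if "algebraic_int a" "algebraic_int b" "\<theta> a = \<theta> b" for a b
    using bij_betw_imp_inj_on[OF bij] \<phi>1 that U_one by (auto dest: inj_onD[of _ _ "(1, a)" "(1, b)"])
  define \<eta> where "\<eta> = (\<lambda>u. fst (\<phi> (u, 0)))"
  have \<phi>u: "fst (\<phi> (u, a)) = \<eta> u" if "u \<in> U" "algebraic_int a" for u a
  proof -
    have "\<phi> (u, a) = \<phi> (1, a) \<otimes>\<^bsub>ot_group U\<^esub> \<phi> (u, 0)"
      using mult[of "(1, a)" "(u, 0)"] that U_one by simp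
    then show ?thesis using \<phi>1[OF that(2)] unfolding \<eta>_def by (simp add: fst_mult_ot_group)
  qed
  have \<eta>_image: "\<eta> ` U = U"
  proof (intro equalityI subsetI)
    fix v assume "v \<in> \<eta> ` U"
    then obtain u where u: "u \<in> U" "v = \<eta> u" by auto
    have "\<phi> (u, 0) \<in> carrier (ot_group U)" using hom_in_carrier[OF hom, of "(u, 0)"] u by simp
    then show "v \<in> U" using u unfolding \<eta>_def by (cases "\<phi> (u, 0)") simp
  next
    fix v assume v: "v \<in> U"
    obtain u a where ua: "\<psi> (v, 0) = (u, a)" by (cases "\<psi> (v, 0)")
    then have "u \<in> U" "algebraic_int a" using hom_in_carrier[OF \<psi>, of "(v, 0)"] v by auto
    moreover have "\<phi> (u, a) = (v, 0)" using \<phi>\<psi>[of "(v, 0)"] ua v by simp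
    ultimately show "v \<in> \<eta> ` U" using \<phi>u by force
  qed
  have \<theta>_U: "\<theta> (u * a) = \<eta> u * \<theta> a" if u: "u \<in> U" and a: "algebraic_int a" for u a
  proof -
    have ua: "algebraic_int (u * a)" using algebraic_int_times[OF U_integral[OF u] a] .
    have "\<phi> (u, 0) \<otimes>\<^bsub>ot_group U\<^esub> \<phi> (1, a) = \<phi> (1, u * a) \<otimes>\<^bsub>ot_group U\<^esub> \<phi> (u, 0)"
      using mult[of "(u, 0)" "(1, a)"] mult[of "(1, u * a)" "(u, 0)"] u a ua U_one by simp
    moreover obtain s where "\<phi> (u, 0) = (\<eta> u, s)" unfolding \<eta>_def by (metis prod.collapse)
    ultimately show ?thesis using \<phi>1[OF a] \<phi>1[OF ua] by simp
  qed
  have "\<exists>N::nat. N > 0 \<and> algebraic_int (of_nat N * x)" for x :: 'k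
    by (rule ex_denominator[OF algebraic_field[of x]]) blast
  then obtain den :: "'k \<Rightarrow> nat" where den: "\<And>x. den x > 0" "\<And>x. algebraic_int (of_nat (den x) * x)" by metis
  \<comment> \<open>The extension of \<open>\<theta>\<close> from O_K to its fraction field.
    \<open>\<Theta>_eq\<close> below shows that every denominator of \<open>x\<close>, not only the
    chosen one, computes the same value.\<close>
  define \<Theta> where "\<Theta> = (\<lambda>x. \<theta> (of_nat (den x) * x) / of_nat (den x))"
  have \<Theta>_eq: "of_nat N * \<Theta> x = \<theta> (of_nat N * x)" if N: "algebraic_int (of_nat N * x)" for N x
  proof -
    have "of_nat (den x) * \<theta> (of_nat N * x) = of_nat N * \<theta> (of_nat (den x) * x)"
      using \<theta>_nat[OF N, of "den x"] \<theta>_nat[OF den(2)[of x], of N] by (simp add: mult.left_commute)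
    then show ?thesis using den(1)[of x] unfolding \<Theta>_def by (simp add: field_simps)
  qed
  have \<Theta>_int: "\<Theta> a = \<theta> a" if "algebraic_int a" for a using \<Theta>_eq[of 1 a] that by simp
  have \<Theta>_add: "\<Theta> (x + y) = \<Theta> x + \<Theta> y" for x y
  proof -
    let ?N = "den x * den y"
    have x: "algebraic_int (of_nat ?N * x)" using algebraic_int_times[OF algebraic_int_of_nat den(2)[of x], of "den y"] by (simp add: ac_simps)
    have y: "algebraic_int (of_nat ?N * y)" using algebraic_int_times[OF algebraic_int_of_nat den(2)[of y], of "den x"] by (simp add: ac_simps)
    have "algebraic_int (of_nat ?N * (x + y))" using algebraic_int_plus[OF x y] by (simp only: distrib_left)
    then have "of_nat ?N * \<Theta> (x + y) = of_nat ?N * \<Theta> x + of_nat ?N * \<Theta> y"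
      using \<theta>_add[OF x y] \<Theta>_eq[OF x] \<Theta>_eq[OF y] \<Theta>_eq[of ?N "x + y"] by (simp only: distrib_left)
    then have "of_nat ?N * \<Theta> (x + y) = of_nat ?N * (\<Theta> x + \<Theta> y)" by (simp only: distrib_left)
    moreover have "of_nat ?N \<noteq> (0::'k)" using den(1)[of x] den(1)[of y] by simp
    ultimately show ?thesis by (metis mult_left_cancel)
  qed
  have \<Theta>_U: "\<Theta> (u * x) = \<eta> u * \<Theta> x" if u: "u \<in> U" for u x
  proof -
    have i: "algebraic_int (of_nat (den x) * (u * x))"
      using algebraic_int_times[OF U_integral[OF u] den(2)[of x]] by (simp add: ac_simps)
    have "of_nat (den x) * \<Theta> (u * x) = \<theta> (u * (of_nat (den x) * x))" using \<Theta>_eq[OF i] by (simp add: ac_simps)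
    also have "\<dots> = of_nat (den x) * (\<eta> u * \<Theta> x)" using \<theta>_U[OF u den(2)[of x]] \<Theta>_eq[OF den(2)[of x]] by (simp add: ac_simps)
    finally show ?thesis using den(1)[of x] by simp
  qed
  \<comment> \<open>\<open>\<Theta>\<close> need not send 1 to 1; dividing by its value there leaves
    the semilinearity over \<open>U\<close> intact and forces \<open>\<rho>\<close> to extend
    \<open>\<eta>\<close>.\<close>
  define c where "c = \<Theta> 1"
  have \<Theta>0: "\<Theta> 0 = 0" using \<Theta>_add[of 0 0] by simp
  have "c \<noteq> 0"
  proof
    assume "c = 0"
    then have "\<theta> 1 = \<theta> 0" using \<Theta>_int[of 1] \<Theta>_int[of 0] \<Theta>0 unfolding c_def by simp
    then show False using \<theta>_inj[of 1 0] by simp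
  qed
  define \<rho> where "\<rho> = (\<lambda>x. \<Theta> x / c)"
  have \<rho>_add: "\<rho> (x + y) = \<rho> x + \<rho> y" for x y unfolding \<rho>_def by (simp add: \<Theta>_add add_divide_distrib)
  have \<rho>1: "\<rho> 1 = 1" unfolding \<rho>_def using \<open>c \<noteq> 0\<close> c_def by simp
  have \<rho>0: "\<rho> 0 = 0" unfolding \<rho>_def by (simp add: \<Theta>0)
  have \<rho>_minus: "\<rho> (- x) = - \<rho> x" for x using \<rho>_add[of x "- x"] \<rho>0 by (simp add: eq_neg_iff_add_eq_0 add.commute)
  have \<rho>_U: "\<rho> u = \<eta> u" if "u \<in> U" for u
    using \<Theta>_U[OF that, of 1] \<open>c \<noteq> 0\<close> unfolding \<rho>_def c_def by simp
  \<comment> \<open>The elements \<open>x\<close> for which this holds for all \<open>y\<close> form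
    a subfield, and it contains \<open>U\<close> by semilinearity. Having \<open>y\<close>
    quantified inside is what lets products and inverses pass through the induction.\<close>
  have "\<forall>y. \<rho> (x * y) = \<rho> x * \<rho> y" if "x \<in> generate_field ring_of_type_algebra U" for x
    using that
  proof (induction rule: generate_field.induct)
    case one
    then show ?case by (simp add: ring_of_type_algebra_def \<rho>1)
  next
    case (incl h)
    have "\<rho> (h * y) = \<eta> h * \<rho> y" for y unfolding \<rho>_def by (simp add: \<Theta>_U[OF incl])
    then show ?case by (simp add: \<rho>_U[OF incl])
  next
    case (a_inv h)
    have "\<rho> (- h * y) = \<rho> (- h) * \<rho> y" for y using a_inv by (simp add: \<rho>_minus)
    then show ?case unfolding ring_of_type_algebra_inverse(1) by blast
  next
    case (m_inv h)
    then have h: "h \<noteq> 0" by (simp add: ring_of_type_algebra_def)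
    have 1: "\<rho> y = \<rho> h * \<rho> (inverse h * y)" for y
    proof -
      have "\<rho> (h * (inverse h * y)) = \<rho> h * \<rho> (inverse h * y)" using m_inv by blast
      moreover have "h * (inverse h * y) = y" using h by simp
      ultimately show ?thesis by simp
    qed
    have "\<rho> h \<noteq> 0" using 1[of 1] \<rho>1 by auto
    have "\<rho> h * \<rho> (inverse h * y) = \<rho> h * (\<rho> (inverse h) * \<rho> y)" for y
    proof -
      have "\<rho> h * (\<rho> (inverse h) * \<rho> y) = (\<rho> h * \<rho> (inverse h * 1)) * \<rho> y" by simp
      also have "\<dots> = \<rho> y" unfolding 1[of 1, symmetric] \<rho>1 by simp
      finally show ?thesis using 1[of y] by simp
    qed
    then have "\<rho> (inverse h * y) = \<rho> (inverse h) * \<rho> y" for y using \<open>\<rho> h \<noteq> 0\<close> by (metis mult_left_cancel)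
    then show ?case unfolding ring_of_type_algebra_inverse(2)[OF h] by blast
  next
    case (eng_add h1 h2)
    then show ?case by (simp add: ring_of_type_algebra_def \<rho>_add distrib_right)
  next
    case (eng_mult h1 h2)
    then show ?case by (simp add: ring_of_type_algebra_def mult.assoc)
  qed
  then have \<rho>_mult: "\<rho> (x * y) = \<rho> x * \<rho> y" for x y using gen by blast
  have "inj \<rho>"
  proof (rule injI)
    fix x y assume "\<rho> x = \<rho> y"
    then have z: "\<rho> (x - y) = 0" using \<rho>_add[of x "- y"] \<rho>_minus by simp
    show "x = y"
    proof (rule ccontr)
      assume "x \<noteq> y"
      then have "\<rho> ((x - y) * inverse (x - y)) = 1" by (simp add: \<rho>1)
      then show False using z by (simp add: \<rho>_mult)
    qed
  qed
  moreover have "surj \<rho>"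
  proof (rule surjI)
    fix y
    let ?N = "den (y * c)"
    obtain a where a: "algebraic_int a" "\<theta> a = of_nat ?N * (y * c)" using \<theta>_surj[OF den(2)[of "y * c"]] by blast
    have "algebraic_int (of_nat ?N * (a / of_nat ?N))" using a den(1)[of "y * c"] by simp
    then have "of_nat ?N * \<Theta> (a / of_nat ?N) = of_nat ?N * (y * c)"
      using \<Theta>_eq[of ?N "a / of_nat ?N"] a(2) den(1)[of "y * c"] by simp
    then have "\<Theta> (a / of_nat ?N) = y * c" using den(1)[of "y * c"] by simp
    then have "\<rho> (a / of_nat ?N) = y" unfolding \<rho>_def using \<open>c \<noteq> 0\<close> by simp
    then show "\<rho> (inv_into UNIV \<rho> y) = y" by (metis f_inv_into_f rangeI)
  qed
  ultimately have "bij \<rho>" by (simp add: bij_def)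
  \<comment> \<open>Composition with a real embedding gives an embedding into C, which fixes
    rationals; injectivity of the real embedding brings this back to the field.\<close>
  have "\<rho> (of_rat q) = of_rat q" for q
  proof -
    fix i :: 's
    have "hom_on UNIV (\<sigma> i \<circ> \<rho>)" unfolding hom_on_def using \<sigma>_simps by (simp add: \<rho>_add \<rho>_mult \<rho>1)
    then have "\<sigma> i (\<rho> (of_rat q)) = \<sigma> i (of_rat q)" using hom_on_of_rat[of UNIV "\<sigma> i \<circ> \<rho>" q] by (simp add: \<sigma>_simps)
    then show ?thesis by (simp only: \<sigma>_simps(11))
  qed
  then have "\<rho> \<in> field_aut" unfolding field_aut_iff using \<rho>_add \<rho>_mult \<rho>1 \<open>bij \<rho>\<close> by blast
  moreover have "\<rho> ` U = U" using \<eta>_image \<rho>_U by (simp cong: image_cong)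
  moreover have "\<phi> (1, a) = (1, \<rho> a * c)" if "algebraic_int a" for a
    unfolding \<rho>_def using \<open>c \<noteq> 0\<close> \<phi>1[OF that] \<Theta>_int[OF that] by simp
  ultimately show thesis using that[of \<rho> c] \<open>c \<noteq> 0\<close> unfolding aut_preserving_def by simp
qed

end

section \<open>The classification\<close>

text \<open>A type meets each of the \<open>CARD('t)\<close> disjoint conjugate pairs in one
  element, so it has exactly \<open>CARD('t)\<close> elements. Hence it is the range of some tuple,
  and every tuple with this range is injective.\<close>

lemma embedding_types_ot_data:
  fixes \<sigma> :: "'s::finite \<Rightarrow> 'k::field_char_0 \<Rightarrow> complex" and \<kappa> :: "'t::finite \<Rightarrow> 'k \<Rightarrow> complex"
  assumes nf: "number_field TYPE('k)" and lab: "embedding_labelling \<sigma> \<kappa>" and adm: "admissible \<sigma> U"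
    and T: "T \<in> embedding_types \<kappa>"
  shows "\<exists>\<tau> :: 't \<Rightarrow> 'k \<Rightarrow> complex. range \<tau> = T"
    and "range (\<tau> :: 't \<Rightarrow> 'k \<Rightarrow> complex) = T \<Longrightarrow> ot_data \<sigma> \<tau> U"
proof -
  have bij: "bij_betw (case_sum \<kappa> (\<lambda>j. conj_embedding (\<kappa> j))) UNIV nonreal_embeddings"
    and bij_\<sigma>: "bij_betw \<sigma> UNIV real_embeddings" using lab unfolding embedding_labelling_def by auto
  have sub: "T \<subseteq> nonreal_embeddings" and one: "\<And>j. card (T \<inter> {\<kappa> j, conj_embedding (\<kappa> j)}) = 1"
    using T unfolding embedding_types_def by auto
  have inj: "inj (case_sum \<kappa> (\<lambda>j. conj_embedding (\<kappa> j)))" using bij by (simp add: bij_betw_def)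
  have k1: "\<kappa> i = \<kappa> j \<longleftrightarrow> i = j" for i j using injD[OF inj, of "Inl i" "Inl j"] by auto
  have k2: "conj_embedding (\<kappa> i) = conj_embedding (\<kappa> j) \<longleftrightarrow> i = j" for i j using injD[OF inj, of "Inr i" "Inr j"] by auto
  have k3: "\<kappa> i \<noteq> conj_embedding (\<kappa> j)" for i j using injD[OF inj, of "Inl i" "Inr j"] by auto
  have cases: "\<exists>j. f = \<kappa> j \<or> f = conj_embedding (\<kappa> j)" if "f \<in> nonreal_embeddings" for f
  proof -
    have "f \<in> case_sum \<kappa> (\<lambda>j. conj_embedding (\<kappa> j)) ` UNIV" using bij that by (simp add: bij_betw_def)
    then obtain x where "f = case_sum \<kappa> (\<lambda>j. conj_embedding (\<kappa> j)) x" by auto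
    then show ?thesis by (cases x) auto
  qed
  have conj2: "conj_embedding (conj_embedding f) = f" for f :: "'k \<Rightarrow> complex"
    by (auto simp: conj_embedding_def)
  have "T = (\<Union>j. T \<inter> {\<kappa> j, conj_embedding (\<kappa> j)})" using sub cases by blast
  moreover have "card (\<Union>j. T \<inter> {\<kappa> j, conj_embedding (\<kappa> j)}) = (\<Sum>j\<in>UNIV. card (T \<inter> {\<kappa> j, conj_embedding (\<kappa> j)}))"
    by (rule card_UN_disjoint) (use k1 k2 k3 k3[symmetric] in auto)
  ultimately have card: "card T = CARD('t)" by (simp add: one)
  then have "finite T" using card_ge_0_finite[of T] by simp
  have "\<exists>h. bij_betw h (UNIV :: 't set) T"
    by (rule finite_same_card_bij) (use card \<open>finite T\<close> in auto)
  then show "\<exists>\<tau> :: 't \<Rightarrow> 'k \<Rightarrow> complex. range \<tau> = T" by (auto simp: bij_betw_def)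
  assume range: "range \<tau> = T"
  show "ot_data \<sigma> \<tau> U"
  proof
    show "inj \<tau>" by (rule eq_card_imp_inj_on) (auto simp: range card)
    show "range \<tau> \<subseteq> nonreal_embeddings" using range sub by simp
    fix f assume "f \<in> (nonreal_embeddings :: ('k \<Rightarrow> complex) set)"
    then obtain j where j: "f = \<kappa> j \<or> f = conj_embedding (\<kappa> j)" using cases by blast
    have "T \<inter> {\<kappa> j, conj_embedding (\<kappa> j)} \<noteq> {}" using one[of j] by (metis card.empty zero_neq_one)
    then have "\<kappa> j \<in> T \<or> conj_embedding (\<kappa> j) \<in> T" by auto
    then show "f \<in> range \<tau> \<or> conj_embedding f \<in> range \<tau>" using j conj2 range by auto
  next
    fix j
    show "conj_embedding (\<tau> j) \<notin> range \<tau>"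
    proof
      assume c: "conj_embedding (\<tau> j) \<in> range \<tau>"
      have t: "\<tau> j \<in> T" using range by auto
      then obtain i where i: "\<tau> j = \<kappa> i \<or> \<tau> j = conj_embedding (\<kappa> i)" using sub cases by blast
      then have "\<kappa> i \<in> T" "conj_embedding (\<kappa> i) \<in> T" using c t unfolding range by (metis conj2)+
      then have "T \<inter> {\<kappa> i, conj_embedding (\<kappa> i)} = {\<kappa> i, conj_embedding (\<kappa> i)}" by auto
      then show False using one[of i] k3[of i i] by simp
    qed
  qed (use nf adm bij_\<sigma> in auto)
qed

text \<open>Note the direction: equivariance of \<open>F\<close> relates
  \<open>\<tau>' j \<circ> \<rho>\<close> to the coordinates of the source, so \<open>\<rho>\<close>
  carries \<open>range \<tau>'\<close> to \<open>range \<tau>\<close>.\<close>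

lemma biholomorphic_imp_automorphism:
  fixes \<sigma> :: "'s::finite \<Rightarrow> 'k::field_char_0 \<Rightarrow> complex" and \<tau> \<tau>' :: "'t::finite \<Rightarrow> 'k \<Rightarrow> complex"
  assumes A: "ot_data \<sigma> \<tau> U" and B: "ot_data \<sigma> \<tau>' U" and gen: "generate_field ring_of_type_algebra U = UNIV"
    and bih: "biholomorphic (ot_manifold \<sigma> U \<tau>) (ot_manifold \<sigma> U \<tau>')"
  shows "\<exists>\<rho>\<in>carrier (aut_preserving U). aut_act \<rho> (range \<tau>') = range \<tau>"
proof -
  interpret A: ot_data \<sigma> \<tau> U by fact
  interpret B: ot_data \<sigma> \<tau>' U by fact
  note ts = A.topspace_ot_manifold B.topspace_ot_manifold
  obtain f g where f: "holomorphic_between (ot_manifold \<sigma> U \<tau>) (ot_manifold \<sigma> U \<tau>') f"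
    and g: "holomorphic_between (ot_manifold \<sigma> U \<tau>') (ot_manifold \<sigma> U \<tau>) g"
    and gf: "\<And>p. p \<in> ot_domain \<Longrightarrow> g (f (ot_proj \<sigma> U \<tau> p)) = ot_proj \<sigma> U \<tau> p"
    and fg: "\<And>p. p \<in> ot_domain \<Longrightarrow> f (g (ot_proj \<sigma> U \<tau>' p)) = ot_proj \<sigma> U \<tau>' p"
    using bih unfolding biholomorphic_def ts by (elim exE conjE) auto
  obtain F where F: "\<And>p. p \<in> ot_domain \<Longrightarrow> F p \<in> ot_domain" "\<And>p. p \<in> ot_domain \<Longrightarrow> holo_at F p"
    "continuous_on ot_domain F" "\<And>p. p \<in> ot_domain \<Longrightarrow> ot_proj \<sigma> U \<tau>' (F p) = f (ot_proj \<sigma> U \<tau> p)"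
    using holomorphic_between_lift[OF A B f] by (metis (no_types, lifting))
  obtain F' where F': "\<And>p. p \<in> ot_domain \<Longrightarrow> F' p \<in> ot_domain" "\<And>p. p \<in> ot_domain \<Longrightarrow> holo_at F' p"
    "continuous_on ot_domain F'" "\<And>p. p \<in> ot_domain \<Longrightarrow> ot_proj \<sigma> U \<tau> (F' p) = g (ot_proj \<sigma> U \<tau>' p)"
    using holomorphic_between_lift[OF B A g] by (metis (no_types, lifting))
  have conn: "connected (ot_domain :: ('s, 't) model set)" by (rule convex_connected[OF A.convex_ot_domain])
  have ne: "(ot_domain :: ('s, 't) model set) \<noteq> {}"
  proof -
    have "((\<chi> i. \<i>, 0) :: ('s, 't) model) \<in> ot_domain" by (simp add: ot_domain_def)
    then show ?thesis by blast
  qed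
  \<comment> \<open>\<open>ot_group U\<close> depends on \<open>U\<close> alone, so both quotients
    are by the same abstract group and \<open>\<phi>\<close> is an automorphism of it.\<close>
  obtain \<phi> where \<phi>: "\<phi> \<in> iso (ot_group U) (ot_group U)"
    "\<And>g p. g \<in> carrier (ot_group U) \<Longrightarrow> p \<in> ot_domain \<Longrightarrow> F (ot_action \<sigma> \<tau> g p) = ot_action \<sigma> \<tau>' (\<phi> g) (F p)"
  proof (rule equivariance_iso[OF A.pd_action_ot B.pd_action_ot conn conn ne F(3) _ F'(3)])
    show "F \<in> ot_domain \<rightarrow> ot_domain" "F' \<in> ot_domain \<rightarrow> ot_domain" using F F' by auto
  qed (use F F' gf fg in \<open>simp_all flip: ot_proj_def\<close>)
  obtain \<rho> c where \<rho>: "\<rho> \<in> carrier (aut_preserving U)" "c \<noteq> 0" "\<And>a. algebraic_int a \<Longrightarrow> \<phi> (1, a) = (1, \<rho> a * c)"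
    using A.ot_group_iso_automorphism[OF \<phi>(1) gen] by metis
  have \<rho>_aut: "\<rho> \<in> field_aut" using \<rho>(1) unfolding aut_preserving_def by simp
  then have "bij \<rho>" unfolding field_aut_iff by simp
  have transl: "ot_action \<sigma> \<tau> (1, a) p = p + emb_vec \<sigma> \<tau> a" "ot_action \<sigma> \<tau>' (1, a) p = p + emb_vec \<sigma> \<tau>' a" for a p
    unfolding A.ot_action_eq B.ot_action_eq by (simp_all add: A.\<sigma>_simps(3) A.\<tau>_simps(3) B.\<tau>_simps(3))
  have F_transl: "F (p + emb_vec \<sigma> \<tau> a) = F p + emb_vec \<sigma> \<tau>' (\<rho> a * c)" if "p \<in> ot_domain" "algebraic_int a" for p a
    using \<phi>(2)[of "(1, a)" p] that \<rho>(3) A.U_one by (simp add: transl)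
  have mem: "\<tau>' j \<circ> \<rho> \<in> range \<tau>" for j
  proof -
    let ?f = "\<tau>' j \<circ> \<rho>" and ?d = "\<tau>' j c"
    have hom: "hom_on UNIV ?f" by (rule hom_on_comp_field_aut[OF B.\<tau>_hom \<rho>_aut])
    have d: "?d \<noteq> 0" using \<rho>(2) by (simp add: B.\<tau>_simps)
    obtain a b where "\<And>x. algebraic_int x \<Longrightarrow> \<tau>' j (\<rho> x * c) = (\<Sum>i\<in>UNIV. a i * \<sigma> i x) + (\<Sum>k\<in>UNIV. b k * \<tau> k x)"
    proof (rule A.equivariant_additive_linear[of "\<lambda>p. snd (F p) $ j" "\<lambda>x. \<tau>' j (\<rho> x * c)"])
      show "hol_fun_at (\<lambda>p. snd (F p) $ j) p" if "p \<in> ot_domain" for p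
        by (rule holo_at_snd_component[OF F(2)[OF that]])
      show "snd (F (p + emb_vec \<sigma> \<tau> x)) $ j = snd (F p) $ j + \<tau>' j (\<rho> x * c)" if "p \<in> ot_domain" "algebraic_int x" for p x
        unfolding F_transl[OF that] by (simp add: emb_vec_def)
    qed (metis that)
    then have int: "?d * ?f x = (\<Sum>i\<in>UNIV. a i * \<sigma> i x) + (\<Sum>k\<in>UNIV. b k * \<tau> k x)" if "algebraic_int x" for x
      using that by (simp add: B.\<tau>_simps mult.commute)
    \<comment> \<open>Clearing denominators extends the relation from O_K to the whole field, as the
      independence of characters demands.\<close>
    have rel: "?d * ?f x = (\<Sum>i\<in>UNIV. a i * \<sigma> i x) + (\<Sum>k\<in>UNIV. b k * \<tau> k x)" for x
    proof -
      obtain N where N: "N > 0" "algebraic_int (of_nat N * x)" by (rule ex_denominator[OF A.algebraic_field])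
      have "of_nat N * (?d * ?f x) = ?d * ?f (of_nat N * x)" using hom_on_UNIV_simps(2,9)[OF hom] by simp
      also have "\<dots> = (\<Sum>i\<in>UNIV. a i * \<sigma> i (of_nat N * x)) + (\<Sum>k\<in>UNIV. b k * \<tau> k (of_nat N * x))" by (rule int[OF N(2)])
      also have "\<dots> = of_nat N * ((\<Sum>i\<in>UNIV. a i * \<sigma> i x) + (\<Sum>k\<in>UNIV. b k * \<tau> k x))"
        by (simp add: A.\<sigma>_simps A.\<tau>_simps sum_distrib_left distrib_left mult.left_commute)
      finally show ?thesis using N(1) by simp
    qed
    show ?thesis
    proof (rule A.embedding_cases[OF hom])
      fix i assume "?f = \<sigma> i"
      then have "range ?f \<subseteq> \<real>" using A.\<sigma>_real by auto
      moreover have "range ?f = range (\<tau>' j)" using \<open>bij \<rho>\<close> by (metis bij_is_surj image_comp)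
      ultimately show ?thesis using B.\<tau>_not_real(1) by auto
    next
      fix k assume k: "?f = cnj \<circ> \<tau> k"
      \<comment> \<open>If \<open>?f\<close> were the conjugate of \<open>\<tau> k\<close>, the
        relation would express it through the \<open>\<sigma> i\<close> and \<open>\<tau> m\<close>
        alone; moved to one side, its coefficient \<open>- ?d\<close> must vanish.\<close>
      have "(\<Sum>i\<in>UNIV. a i * \<sigma> i x) + (\<Sum>m\<in>UNIV. b m * \<tau> m x) + (\<Sum>m\<in>UNIV. (if m = k then - ?d else 0) * cnj (\<tau> m x)) = 0" for x
      proof -
        have "(\<Sum>m\<in>UNIV. (if m = k then - ?d else 0) * cnj (\<tau> m x)) = - (?d * ?f x)"
          unfolding k by (simp add: if_distrib[of "\<lambda>z. z * _"] cong: if_cong)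
        then show ?thesis using rel[of x] by simp
      qed
      from A.all_emb_independent(3)[OF this, of k] show ?thesis using d by simp
    qed auto
  qed
  have "aut_act \<rho> (range \<tau>') \<subseteq> range \<tau>" using mem unfolding aut_act_def by auto
  moreover have "card (aut_act \<rho> (range \<tau>')) = card (range \<tau>)"
  proof -
    have "inj_on (\<lambda>\<sigma>. \<sigma> \<circ> \<rho>) (range \<tau>')"
      using \<open>bij \<rho>\<close> by (intro inj_onI) (metis bij_is_surj fun.map_cong_pred surj_fun_eq)
    then show ?thesis unfolding aut_act_def by (simp add: card_image A.inj_\<tau> B.inj_\<tau>)
  qed
  ultimately have "aut_act \<rho> (range \<tau>') = range \<tau>" by (intro card_subset_eq) auto
  then show ?thesis using \<rho>(1) by blast
qed

section \<open>Biholomorphic maps from field automorphisms\<close>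

definition permute_coordinates :: "('s::finite \<Rightarrow> 's) \<Rightarrow> ('t::finite \<Rightarrow> 't) \<Rightarrow> ('s, 't) model \<Rightarrow> ('s, 't) model" where
  "permute_coordinates \<pi> \<pi>' p = (\<chi> i. fst p $ \<pi> i, \<chi> j. snd p $ \<pi>' j)"

lemma permute_coordinates_domain: "p \<in> ot_domain \<Longrightarrow> permute_coordinates \<pi> \<pi>' p \<in> ot_domain"
  by (auto simp: ot_domain_def permute_coordinates_def)

lemma holo_at_permute_coordinates: "holo_at (permute_coordinates \<pi> \<pi>') p"
proof -
  have "linear (permute_coordinates \<pi> \<pi>')"
    by (rule linearI) (auto simp: permute_coordinates_def vec_eq_iff)
  then have "(permute_coordinates \<pi> \<pi>' has_derivative permute_coordinates \<pi> \<pi>') (at p)"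
    by (simp add: linear_conv_bounded_linear bounded_linear_imp_has_derivative)
  moreover have "permute_coordinates \<pi> \<pi>' (cscale c v) = cscale c (permute_coordinates \<pi> \<pi>' v)" for c v
    by (simp add: permute_coordinates_def cscale_def case_prod_unfold vec_eq_iff)
  ultimately show ?thesis unfolding holo_at_def by blast
qed

lemma permute_coordinates_inverse:
  "bij \<pi> \<Longrightarrow> bij \<pi>' \<Longrightarrow> permute_coordinates (Hilbert_Choice.inv \<pi>) (Hilbert_Choice.inv \<pi>') (permute_coordinates \<pi> \<pi>' p) = p"
  "bij \<pi> \<Longrightarrow> bij \<pi>' \<Longrightarrow> permute_coordinates \<pi> \<pi>' (permute_coordinates (Hilbert_Choice.inv \<pi>) (Hilbert_Choice.inv \<pi>') p) = p"
  by (simp_all add: permute_coordinates_def prod_eq_iff vec_eq_iff bij_is_surj surj_f_inv_f bij_is_inj)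

text \<open>Permuting coordinates turns the action of \<open>(\<rho> u, \<rho> a)\<close> for
  \<open>\<tau>\<close> into that of \<open>(u, a)\<close> for \<open>\<tau>'\<close>. Since
  \<open>\<rho>\<close> preserves both \<open>U\<close> and O_K, the permutation and its inverse
  respect orbits and descend.\<close>

lemma automorphism_imp_biholomorphic:
  fixes \<sigma> :: "'s::finite \<Rightarrow> 'k::field_char_0 \<Rightarrow> complex" and \<tau> \<tau>' :: "'t::finite \<Rightarrow> 'k \<Rightarrow> complex"
  assumes A: "ot_data \<sigma> \<tau> U" and B: "ot_data \<sigma> \<tau>' U"
    and \<rho>: "\<rho> \<in> carrier (aut_preserving U)" "aut_act \<rho> (range \<tau>) = range \<tau>'"
  shows "biholomorphic (ot_manifold \<sigma> U \<tau>) (ot_manifold \<sigma> U \<tau>')"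
proof -
  interpret A: ot_data \<sigma> \<tau> U by fact
  interpret B: ot_data \<sigma> \<tau>' U by fact
  have \<rho>_aut: "\<rho> \<in> field_aut" and \<rho>U: "\<rho> ` U = U" using \<rho>(1) unfolding aut_preserving_def by simp_all
  then have "bij \<rho>" unfolding field_aut_iff by simp
  then have surj: "\<rho> (Hilbert_Choice.inv \<rho> x) = x" and inv_l: "Hilbert_Choice.inv \<rho> (\<rho> x) = x" for x
    by (simp_all add: bij_is_surj surj_f_inv_f bij_is_inj)
  note inv_aut = field_aut_inv[OF \<rho>_aut]
  have "\<exists>k. \<sigma> k = \<sigma> i \<circ> Hilbert_Choice.inv \<rho>" for i
  proof -
    have "hom_on UNIV (\<sigma> i \<circ> Hilbert_Choice.inv \<rho>)" by (rule hom_on_comp_field_aut[OF A.\<sigma>_hom inv_aut])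
    moreover have "range (\<sigma> i \<circ> Hilbert_Choice.inv \<rho>) \<subseteq> \<real>" using A.\<sigma>_real by auto
    ultimately have "\<sigma> i \<circ> Hilbert_Choice.inv \<rho> \<in> real_embeddings"
      unfolding real_embeddings_def ring_hom_type_iff_hom_on by simp
    then show ?thesis using A.bij_\<sigma> unfolding bij_betw_def by (metis imageE)
  qed
  \<comment> \<open>The real embeddings are permuted through the inverse of \<open>\<rho>\<close> so
    that both permutations obey the same rule: \<open>\<sigma> (\<pi> i) \<circ> \<rho>\<close> is
    \<open>\<sigma> i\<close>, and \<open>\<tau> (\<pi>' j) \<circ> \<rho>\<close> is
    \<open>\<tau>' j\<close>.\<close>
  then obtain \<pi> where "\<And>i. \<sigma> (\<pi> i) = \<sigma> i \<circ> Hilbert_Choice.inv \<rho>" by metis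
  then have \<pi>: "\<sigma> (\<pi> i) (\<rho> x) = \<sigma> i x" for i x by (simp add: inv_l)
  have "\<exists>k. \<tau>' j = \<tau> k \<circ> \<rho>" for j
  proof -
    have "\<tau>' j \<in> aut_act \<rho> (range \<tau>)" using \<rho>(2) by simp
    then show ?thesis unfolding aut_act_def by auto
  qed
  then obtain \<pi>' where "\<And>j. \<tau>' j = \<tau> (\<pi>' j) \<circ> \<rho>" by metis
  then have \<pi>': "\<tau> (\<pi>' j) (\<rho> x) = \<tau>' j x" for j x by simp
  have "inj \<pi>"
  proof (rule injI)
    fix i k assume "\<pi> i = \<pi> k"
    then have "\<sigma> i = \<sigma> k" using \<pi> by (intro ext) metis
    then show "i = k" using A.bij_\<sigma> unfolding bij_betw_def by (auto dest: injD)
  qed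
  then have b: "bij \<pi>" by (simp add: bij_def finite_UNIV_inj_surj)
  have "inj \<pi>'"
  proof (rule injI)
    fix i k assume "\<pi>' i = \<pi>' k"
    then have "\<tau>' i = \<tau>' k" using \<pi>' by (intro ext) metis
    then show "i = k" using B.inj_\<tau> by (auto dest: injD)
  qed
  then have b': "bij \<pi>'" by (simp add: bij_def finite_UNIV_inj_surj)
  define F where "F = permute_coordinates \<pi> \<pi>'"
  define F' where "F' = permute_coordinates (Hilbert_Choice.inv \<pi>) (Hilbert_Choice.inv \<pi>')"
  have FF': "F' (F p) = p" "F (F' p) = p" for p
    unfolding F_def F'_def using permute_coordinates_inverse[OF b b'] by simp_all
  have dom: "F p \<in> ot_domain" "F' p \<in> ot_domain" if "p \<in> ot_domain" for p
    unfolding F_def F'_def by (intro permute_coordinates_domain that)+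
  have eqv: "F (ot_action \<sigma> \<tau> (\<rho> u, \<rho> a) p) = ot_action \<sigma> \<tau>' (u, a) (F p)" for u a p
    unfolding F_def by (cases p) (simp add: ot_action_def permute_coordinates_def \<pi> \<pi>')
  have eqv': "F' (ot_action \<sigma> \<tau>' (u, a) p) = ot_action \<sigma> \<tau> (\<rho> u, \<rho> a) (F' p)" for u a p
    using eqv[of u a "F' p"] FF' by metis
  obtain f where f: "holomorphic_between (ot_manifold \<sigma> U \<tau>) (ot_manifold \<sigma> U \<tau>') f"
    "\<And>p. p \<in> ot_domain \<Longrightarrow> f (ot_proj \<sigma> U \<tau> p) = ot_proj \<sigma> U \<tau>' (F p)"
  proof (rule holomorphic_between_descend[OF A B, of F])
    show "holo_at F p" for p unfolding F_def by (rule holo_at_permute_coordinates)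
    fix p p' :: "('s, 't) model"
    assume p: "p \<in> ot_domain" "p' \<in> ot_domain" "ot_proj \<sigma> U \<tau> p = ot_proj \<sigma> U \<tau> p'"
    then obtain g where "g \<in> carrier (ot_group U)" "p' = ot_action \<sigma> \<tau> g p"
      using A.ot.proj_eq_iff[OF p(1,2)] unfolding A.ot_proj_eq by blast
    then obtain u a where ua: "u \<in> U" "algebraic_int a" "p' = ot_action \<sigma> \<tau> (u, a) p"
      by (cases g) auto
    obtain u' where u': "u' \<in> U" "u = \<rho> u'" using ua(1) \<rho>U by blast
    let ?a = "Hilbert_Choice.inv \<rho> a"
    have a': "algebraic_int ?a" "a = \<rho> ?a" using field_aut_algebraic_int[OF inv_aut ua(2)] surj by auto
    have "F p' = ot_action \<sigma> \<tau>' (u', ?a) (F p)" unfolding ua(3) u'(2) using eqv[of u' ?a p] a'(2) by simp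
    then show "ot_proj \<sigma> U \<tau>' (F p) = ot_proj \<sigma> U \<tau>' (F p')"
      unfolding B.ot_proj_eq using B.ot.proj_act[of "(u', ?a)" "F p"] u'(1) a'(1) dom p by simp
  qed (use dom in auto)
  obtain g where g: "holomorphic_between (ot_manifold \<sigma> U \<tau>') (ot_manifold \<sigma> U \<tau>) g"
    "\<And>p. p \<in> ot_domain \<Longrightarrow> g (ot_proj \<sigma> U \<tau>' p) = ot_proj \<sigma> U \<tau> (F' p)"
  proof (rule holomorphic_between_descend[OF B A, of F'])
    show "holo_at F' p" for p unfolding F'_def by (rule holo_at_permute_coordinates)
    fix p p' :: "('s, 't) model"
    assume p: "p \<in> ot_domain" "p' \<in> ot_domain" "ot_proj \<sigma> U \<tau>' p = ot_proj \<sigma> U \<tau>' p'"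
    then obtain g where "g \<in> carrier (ot_group U)" "p' = ot_action \<sigma> \<tau>' g p"
      using B.ot.proj_eq_iff[OF p(1,2)] unfolding B.ot_proj_eq by blast
    then obtain u a where ua: "u \<in> U" "algebraic_int a" "p' = ot_action \<sigma> \<tau>' (u, a) p"
      by (cases g) auto
    have "\<rho> u \<in> U" "algebraic_int (\<rho> a)" using ua \<rho>U field_aut_algebraic_int[OF \<rho>_aut] by auto
    then show "ot_proj \<sigma> U \<tau> (F' p) = ot_proj \<sigma> U \<tau> (F' p')"
      unfolding A.ot_proj_eq ua(3) eqv' using A.ot.proj_act[of "(\<rho> u, \<rho> a)" "F' p"] dom p by simp
  qed (use dom in auto)
  note ts = A.topspace_ot_manifold B.topspace_ot_manifold
  show ?thesis unfolding biholomorphic_def ts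
  proof (rule exI[of _ f], rule exI[of _ g], intro conjI ballI)
    show "holomorphic_between (ot_manifold \<sigma> U \<tau>) (ot_manifold \<sigma> U \<tau>') f" by (fact f(1))
    show "holomorphic_between (ot_manifold \<sigma> U \<tau>') (ot_manifold \<sigma> U \<tau>) g" by (fact g(1))
  next
    fix x assume "x \<in> ot_proj \<sigma> U \<tau> ` (ot_domain :: ('s, 't) model set)"
    then show "g (f x) = x" by (elim imageE) (simp only: f(2) g(2) dom FF')
  next
    fix x assume "x \<in> ot_proj \<sigma> U \<tau>' ` (ot_domain :: ('s, 't) model set)"
    then show "f (g x) = x" by (elim imageE) (simp only: f(2) g(2) dom FF')
  qed
qed

section \<open>Orbits and the count of classes\<close>

lemma biholomorphic_refl:
  assumes "complex_manifold M"
  shows "biholomorphic M M"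
proof -
  obtain Z A where M: "M = (Z, A)" by (cases M)
  have "holomorphic_between M M id"
    using assms unfolding M complex_manifold_def holomorphic_between_def by simp
  then show ?thesis unfolding biholomorphic_def by (intro exI[of _ id]) auto
qed

lemma aut_preserving_closed:
  shows "id \<in> carrier (aut_preserving U)"
    and "\<rho> \<in> carrier (aut_preserving U) \<Longrightarrow> \<rho>' \<in> carrier (aut_preserving U) \<Longrightarrow> \<rho> \<circ> \<rho>' \<in> carrier (aut_preserving U)"
    and "\<rho> \<in> carrier (aut_preserving U) \<Longrightarrow> Hilbert_Choice.inv \<rho> \<in> carrier (aut_preserving U)"
proof -
  show "id \<in> carrier (aut_preserving U)" by (simp add: aut_preserving_def field_aut_iff)
  show "\<rho> \<in> carrier (aut_preserving U) \<Longrightarrow> \<rho>' \<in> carrier (aut_preserving U) \<Longrightarrow> \<rho> \<circ> \<rho>' \<in> carrier (aut_preserving U)"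
    using image_comp[of \<rho> \<rho>' U] by (simp add: aut_preserving_def field_aut_comp)
  assume \<rho>: "\<rho> \<in> carrier (aut_preserving U)"
  then have "inj \<rho>" by (simp add: aut_preserving_def field_aut_iff bij_def)
  moreover have "\<rho> ` U = U" using \<rho> by (simp add: aut_preserving_def)
  ultimately have "Hilbert_Choice.inv \<rho> ` U = U" by (metis image_inv_f_f)
  then show "Hilbert_Choice.inv \<rho> \<in> carrier (aut_preserving U)"
    using \<rho> by (simp add: aut_preserving_def field_aut_inv)
qed

lemma aut_act_comp: "aut_act \<rho> (aut_act \<rho>' T) = aut_act (\<rho>' \<circ> \<rho>) T"
  by (simp add: aut_act_def image_image comp_assoc)

text \<open>Precomposition reverses the order of composition, so this is a right action and the
  facts on left actions do not apply as they stand. Closure of the automorphisms under composition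
  and inverse gives the orbits directly.\<close>

lemma aut_orbit_eq_iff:
  "orbit (aut_preserving U) aut_act T = orbit (aut_preserving U) aut_act T' \<longleftrightarrow>
     (\<exists>\<rho>\<in>carrier (aut_preserving U). aut_act \<rho> T = T')"
proof
  assume eq: "orbit (aut_preserving U) aut_act T = orbit (aut_preserving U) aut_act T'"
  have "aut_act id T' = T'" by (simp add: aut_act_def)
  then have "T' \<in> orbit (aut_preserving U) aut_act T'"
    unfolding orbit_def using aut_preserving_closed(1)[of U] by (metis (mono_tags, lifting) mem_Collect_eq)
  then have "T' \<in> orbit (aut_preserving U) aut_act T" using eq by simp
  then show "\<exists>\<rho>\<in>carrier (aut_preserving U). aut_act \<rho> T = T'" unfolding orbit_def by auto
next
  assume "\<exists>\<rho>\<in>carrier (aut_preserving U). aut_act \<rho> T = T'"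
  then obtain \<rho> where \<rho>: "\<rho> \<in> carrier (aut_preserving U)" "T' = aut_act \<rho> T" by blast
  have sub: "orbit (aut_preserving U) aut_act (aut_act \<rho> T) \<subseteq> orbit (aut_preserving U) aut_act T"
    if "\<rho> \<in> carrier (aut_preserving U)" for \<rho> T
    unfolding orbit_def aut_act_comp using aut_preserving_closed(2)[OF that] by blast
  have "surj \<rho>" using \<rho>(1) by (simp add: aut_preserving_def field_aut_iff bij_def)
  then have "\<rho> \<circ> Hilbert_Choice.inv \<rho> = id" by (simp add: surj_iff)
  then have "aut_act (Hilbert_Choice.inv \<rho>) T' = T" unfolding \<rho>(2) aut_act_comp by (simp add: aut_act_def)
  then show "orbit (aut_preserving U) aut_act T = orbit (aut_preserving U) aut_act T'"
    using sub[OF \<rho>(1), of T] sub[OF aut_preserving_closed(3)[OF \<rho>(1)], of T'] \<rho>(2) by auto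
qed

text \<open>Two maps with the same fibres have images in bijection. It turns the criterion for
  equality of classes into the count by orbits.\<close>

lemma card_image_same_kernel:
  assumes "\<And>x y. x \<in> A \<Longrightarrow> y \<in> A \<Longrightarrow> f x = f y \<longleftrightarrow> g x = g y"
  shows "card (f ` A) = card (g ` A)"
proof -
  have r: "g (inv_into A f (f x)) = g x" if "x \<in> A" for x
    using assms[of "inv_into A f (f x)" x] that by (simp add: inv_into_into f_inv_into_f)
  have "inj_on (\<lambda>y. g (inv_into A f y)) (f ` A)"
    by (rule inj_onI) (auto simp: r assms)
  moreover have "(\<lambda>y. g (inv_into A f y)) ` f ` A = g ` A"
    unfolding image_image by (rule image_cong) (auto simp: r)
  ultimately show ?thesis using card_image by fastforce
qed

theorem theorem1p1:
  fixes \<sigma> :: "'s::finite \<Rightarrow> 'k::field_char_0 \<Rightarrow> complex"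
    and \<kappa> :: "'t::finite \<Rightarrow> 'k \<Rightarrow> complex"
    and U :: "'k set"
  assumes "number_field TYPE('k)"
    and "embedding_labelling \<sigma> \<kappa>"
    and "admissible \<sigma> U"
    and "generate_field ring_of_type_algebra U = UNIV"
  shows "(\<forall>T\<in>embedding_types \<kappa>. \<forall>T'\<in>embedding_types \<kappa>.
            (ot_class \<sigma> U TYPE('t) T = ot_class \<sigma> U TYPE('t) T' \<longleftrightarrow>
               (\<exists>\<rho>\<in>carrier (aut_preserving U). aut_act \<rho> T = T')) \<and>
            (\<forall>\<tau> \<tau>' :: 't \<Rightarrow> 'k \<Rightarrow> complex. range \<tau> = T \<and> range \<tau>' = T' \<longrightarrow>
               (biholomorphic (ot_manifold \<sigma> U \<tau>) (ot_manifold \<sigma> U \<tau>') \<longleftrightarrow>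
                  (\<exists>\<rho>\<in>carrier (aut_preserving U). aut_act \<rho> T = T')))) \<and>
         card (ot_class \<sigma> U TYPE('t) ` embedding_types \<kappa>) =
           card (orbits (aut_preserving U) (embedding_types \<kappa>) aut_act)"
proof -
  note data = embedding_types_ot_data[OF assms(1-3)]
  have bih_iff: "biholomorphic (ot_manifold \<sigma> U \<tau>) (ot_manifold \<sigma> U \<tau>') \<longleftrightarrow>
      (\<exists>\<rho>\<in>carrier (aut_preserving U). aut_act \<rho> T = T')"
    if T: "T \<in> embedding_types \<kappa>" "T' \<in> embedding_types \<kappa>" and \<tau>: "range \<tau> = T" "range \<tau>' = T'"
    for T T' and \<tau> \<tau>' :: "'t \<Rightarrow> 'k \<Rightarrow> complex"
  proof -
    note A = data(2)[OF T(1) \<tau>(1)] and B = data(2)[OF T(2) \<tau>(2)]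
    \<comment> \<open>The necessity lemma is applied with the two tuples exchanged, since it returns
      an automorphism carrying the type of the target to that of the source.\<close>
    show ?thesis
      using biholomorphic_imp_automorphism[OF B A assms(4) biholomorphic_sym]
        automorphism_imp_biholomorphic[OF A B] unfolding \<tau> by blast
  qed
  have class_iff: "ot_class \<sigma> U TYPE('t) T = ot_class \<sigma> U TYPE('t) T' \<longleftrightarrow>
      (\<exists>\<rho>\<in>carrier (aut_preserving U). aut_act \<rho> T = T')"
    if T: "T \<in> embedding_types \<kappa>" "T' \<in> embedding_types \<kappa>" for T T'
  proof
    obtain \<tau> :: "'t \<Rightarrow> 'k \<Rightarrow> complex" where \<tau>: "range \<tau> = T" using data(1)[OF T(1)] by blast
    have "complex_manifold (ot_manifold \<sigma> U \<tau>)" by (rule ot_data.complex_manifold_ot[OF data(2)[OF T(1) \<tau>]])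
    \<comment> \<open>The class contains the quotient itself, so equal classes make this quotient
      biholomorphic to one of the second type.\<close>
    then have "ot_manifold \<sigma> U \<tau> \<in> ot_class \<sigma> U TYPE('t) T"
      unfolding ot_class_def using \<tau> biholomorphic_refl by blast
    moreover assume "ot_class \<sigma> U TYPE('t) T = ot_class \<sigma> U TYPE('t) T'"
    ultimately obtain \<tau>' :: "'t \<Rightarrow> 'k \<Rightarrow> complex" where "range \<tau>' = T'" "biholomorphic (ot_manifold \<sigma> U \<tau>) (ot_manifold \<sigma> U \<tau>')"
      unfolding ot_class_def by blast
    then show "\<exists>\<rho>\<in>carrier (aut_preserving U). aut_act \<rho> T = T'" using bih_iff[OF T \<tau>] by blast
  next
    assume \<rho>: "\<exists>\<rho>\<in>carrier (aut_preserving U). aut_act \<rho> T = T'"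
    \<comment> \<open>Stated for fresh types and with biholomorphy as a premise, so that it serves
      both inclusions; the second uses symmetry of biholomorphy in place of an inverse
      automorphism.\<close>
    have sub: "ot_class \<sigma> U TYPE('t) T \<subseteq> ot_class \<sigma> U TYPE('t) T'"
      if T: "T \<in> embedding_types \<kappa>" "T' \<in> embedding_types \<kappa>"
        and bih: "\<And>\<tau> \<tau>' :: 't \<Rightarrow> 'k \<Rightarrow> complex. range \<tau> = T \<Longrightarrow> range \<tau>' = T' \<Longrightarrow> biholomorphic (ot_manifold \<sigma> U \<tau>) (ot_manifold \<sigma> U \<tau>')" for T T'
    proof
      fix M assume "M \<in> ot_class \<sigma> U TYPE('t) T"
      then obtain \<tau> :: "'t \<Rightarrow> 'k \<Rightarrow> complex" where M: "complex_manifold M" "range \<tau> = T" "biholomorphic M (ot_manifold \<sigma> U \<tau>)"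
        unfolding ot_class_def by blast
      obtain \<tau>' :: "'t \<Rightarrow> 'k \<Rightarrow> complex" where \<tau>': "range \<tau>' = T'" using data(1)[OF T(2)] by blast
      have "biholomorphic M (ot_manifold \<sigma> U \<tau>')"
        by (rule biholomorphic_trans[OF M(1) _ _ M(3) bih[OF M(2) \<tau>']])
          (rule ot_data.complex_manifold_ot[OF data(2)[OF T(1) M(2)]],
           rule ot_data.complex_manifold_ot[OF data(2)[OF T(2) \<tau>']])
      then show "M \<in> ot_class \<sigma> U TYPE('t) T'" unfolding ot_class_def using M(1) \<tau>' by blast
    qed
    show "ot_class \<sigma> U TYPE('t) T = ot_class \<sigma> U TYPE('t) T'"
    proof
      show "ot_class \<sigma> U TYPE('t) T \<subseteq> ot_class \<sigma> U TYPE('t) T'"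
        using sub[OF T] bih_iff[OF T] \<rho> by blast
      show "ot_class \<sigma> U TYPE('t) T' \<subseteq> ot_class \<sigma> U TYPE('t) T"
        using sub[OF T(2,1)] bih_iff[OF T] \<rho> biholomorphic_sym by blast
    qed
  qed
  have "card (ot_class \<sigma> U TYPE('t) ` embedding_types \<kappa>) =
      card ((\<lambda>T. orbit (aut_preserving U) aut_act T) ` embedding_types \<kappa>)"
    by (rule card_image_same_kernel) (simp only: class_iff aut_orbit_eq_iff)
  also have "(\<lambda>T. orbit (aut_preserving U) aut_act T) ` embedding_types \<kappa> =
      orbits (aut_preserving U) (embedding_types \<kappa>) aut_act"
    unfolding orbits_def by auto
  finally have card: "card (ot_class \<sigma> U TYPE('t) ` embedding_types \<kappa>) =
      card (orbits (aut_preserving U) (embedding_types \<kappa>) aut_act)" .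
  show ?thesis
  proof (intro conjI ballI allI impI)
    fix T T' assume T: "T \<in> embedding_types \<kappa>" "T' \<in> embedding_types \<kappa>"
    show "ot_class \<sigma> U TYPE('t) T = ot_class \<sigma> U TYPE('t) T' \<longleftrightarrow>
        (\<exists>\<rho>\<in>carrier (aut_preserving U). aut_act \<rho> T = T')" by (rule class_iff[OF T])
    fix \<tau> \<tau>' :: "'t \<Rightarrow> 'k \<Rightarrow> complex" assume "range \<tau> = T \<and> range \<tau>' = T'"
    then show "biholomorphic (ot_manifold \<sigma> U \<tau>) (ot_manifold \<sigma> U \<tau>') \<longleftrightarrow>
        (\<exists>\<rho>\<in>carrier (aut_preserving U). aut_act \<rho> T = T')" using bih_iff[OF T] by blast
  qed (fact card)
qed

end
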